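(* Let $k_B \geq k_A \geq 3$ be positive integers. Then there exists a constant $c>0$ (depending only on $k_A$ and $k_B$) such that the following holds. Let $A$ and $B$ be linear equations of lengths $k_A$ and $k_B$ respectively such that their underlying matrices are both irredundant. If $p=p(n)$ satisfies $$p \leq c\,n^{-\frac{k_Ak_B-k_A-k_B}{k_Ak_B-k_A}},$$ then $$\lim_{n \to \infty} \mathbb{P}\big[\, [n]_p \text{ is } (A,B)\text{-Rado}\,\big]=0.$$
   Context: $\mathbb{N}$ is the set of positive integers and $[n]:=\{1,\dots,n\}$. The random set $[n]_p$ is obtained by including each element of $[n]$ with probability $p$, independently of all other elements. A linear equation $A$ of length $k$ is an equation $A'x=d$ in $k$ variables $x=(x_1,\dots,x_k)$, where $d\in\mathbb{Z}$ and $A'$ is a $1\times k$ integer matrix all of whose entries are non-zero; $A'$ is called the underlying matrix of $A$. (The equation may be inhomogeneous, i.e. $d\neq 0$ is allowed.) For a set $S$ of integers, a $k$-distinct solution of $A$ in $S$ is a vector $x=(x_1,\dots,x_k)\in S^k$ satisfying $A$ whose entries $x_1,\dots,x_k$ are pairwise distinct. An integer matrix $A'$ with $k$ columns is irredundant if $A'x=0$ has a $k$-distinct solution in $\mathbb{N}$ (i.e. a solution in $\mathbb N^k$ with pairwise distinct entries). A set $S$ of integers is $(A,B)$-Rado if for every colouring of $S$ with colours $1$ and $2$ there is either a $k_A$-distinct solution of $A$ in $S$ all of whose entries have colour $1$, or a $k_B$-distinct solution of $B$ in $S$ all of whose entries have colour $2$. *)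

theory Defs
  imports "HOL-Probability.Probability" "Jordan_Normal_Form.Matrix"
begin

text \<open>
  Matrices and vectors are the dimension-indexed ones of \<open>Jordan_Normal_Form.Matrix\<close>, since the
  lengths of the equations are numbers quantified in the statement.
\<close>

definition distinct_solution :: "int mat \<Rightarrow> int vec \<Rightarrow> int set \<Rightarrow> int vec \<Rightarrow> bool" where
  "distinct_solution M b S x \<longleftrightarrow>
     x \<in> carrier_vec (dim_col M) \<and> set\<^sub>v x \<subseteq> S \<and> M *\<^sub>v x = b \<and> distinct (list_of_vec x)"

definition irredundant :: "int mat \<Rightarrow> bool" where
  "irredundant M \<longleftrightarrow> (\<exists>x. distinct_solution M (0\<^sub>v (dim_row M)) {1..} x)"

datatype lin_eq = Lin_Eq (underlying_matrix: "int mat") (rhs: int)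

definition linear_equation :: "nat \<Rightarrow> lin_eq \<Rightarrow> bool" where
  "linear_equation k A \<longleftrightarrow>
     underlying_matrix A \<in> carrier_mat 1 k \<and> (\<forall>j<k. underlying_matrix A $$ (0, j) \<noteq> 0)"

definition eq_solution :: "lin_eq \<Rightarrow> int set \<Rightarrow> int vec \<Rightarrow> bool" where
  "eq_solution A S x \<longleftrightarrow> distinct_solution (underlying_matrix A) (vec 1 (\<lambda>_. rhs A)) S x"

definition rado :: "lin_eq \<Rightarrow> lin_eq \<Rightarrow> int set \<Rightarrow> bool" where
  "rado A B S \<longleftrightarrow>
     (\<forall>col \<in> S \<rightarrow> {1::nat, 2}.
        (\<exists>x. eq_solution A S x \<and> (\<forall>y \<in> set\<^sub>v x. col y = 1)) \<or>
        (\<exists>x. eq_solution B S x \<and> (\<forall>y \<in> set\<^sub>v x. col y = 2)))"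

text \<open>
  The law of the random set \<open>[n]\<^sub>p\<close>. Only meaningful for \<open>0 \<le> p \<le> 1\<close>:
  \<^const>\<open>bernoulli_pmf\<close> truncates its parameter to that interval.
\<close>

definition random_subset :: "nat \<Rightarrow> real \<Rightarrow> int set pmf" where
  "random_subset n p =
     map_pmf (\<lambda>f. {i \<in> {1..int n}. f i}) (Pi_pmf {1..int n} False (\<lambda>_. bernoulli_pmf p))"

end

theory Submission
  imports Defs "HOL-Library.Disjoint_Sets"
begin

text \<open>
  The sets of entries of the solutions of the two equations form an \<open>a\<close>-uniform and a
  \<open>b\<close>-uniform hypergraph on the first \<open>n\<close> integers, where $a = k_A \le b = k_B$. A
  solution is determined by all but one of its entries, so at
  most a constant times $n^{k - 1 - t}$ solutions contain \<open>t\<close> given integers. The constant depends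
  on the length only, which is why \<open>c\<close> can be chosen independently of the coefficients.

  If the random set is Rado, then it contains a minimal pair of families without a proper colouring.
  Minimality forces branching: every point of an edge of one kind lies on an edge of the other kind
  that meets the first edge nowhere else (\<open>critical_privateA\<close>, \<open>critical_privateB\<close>). Starting from an
  edge one can therefore walk along a path until it returns to itself, and it has to return in
  several places.

  The expected number of configurations is measured by a weight, the exponent of \<open>n\<close>. For \<open>p\<close> of order
  $n^{\beta - 1}$, where $\beta = b / (a (b - 1))$, each new point adds $\beta$ and each edge
  with a new point subtracts 1. The threshold is such that an edge of the second kind through a given
  point, together with an edge of the first kind at each of its other points, has weight 0. So a
  path of such stars has the weight $\alpha = 1 / (b - 1)$ of its first edge, whatever its length, and
  if \<open>c\<close> is small, the number of paths decreases geometrically with the length. At the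
  end of a longest path every further star meets the
  path again. This costs at least $\alpha$ each time, and as the path can be continued in several
  directions, it happens often enough to make the weight negative. Such configurations are
  unlikely: a path of any length with a bounded number of further edges and negative weight occurs
  with probability $O(n^{-\delta})$, where $\delta = 1 / (a (b - 1))$, by the first moment
  (\<open>mass_of_bad\<close>).

  A configuration is counted by the order in which its edges are added, and an edge counts only if
  it contributes a new point. The deterministic part (\<open>symmetric_case\<close>, \<open>asymmetric_case\<close>) is
  therefore a search for good orders, in which few points are spread over many edges; the main trick is
  to insert an edge that leaves the path at a free point before the last edge of the path, which still
  contributes its other free points.
  For $a < b$ the gap between $\alpha$ and $\beta$ makes all coincidences but one too expensive. For
  $a = b$ loose paths suffice, and only for $a = b = 3$ there is an exceptional
  configuration of weight 0, the dual of the complete graph on four vertices. It is excluded because it can be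
  coloured.
\<close>

section \<open>Critical pairs\<close>

text \<open>
  Let \<open>EA\<close> be the sets of entries of the solutions of the first equation and \<open>EB\<close> those of the
  second. \<open>R\<close> is the first colour class: it may contain no member of \<open>EA\<close>, and its complement
  no member of \<open>EB\<close>.
\<close>
definition colourable :: "'v set set \<Rightarrow> 'v set set \<Rightarrow> bool" where
  "colourable EA EB \<longleftrightarrow> (\<exists>R. (\<forall>e\<in>EA. \<not> e \<subseteq> R) \<and> (\<forall>f\<in>EB. f \<inter> R \<noteq> {}))"

definition critical :: "'v set set \<Rightarrow> 'v set set \<Rightarrow> bool" where
  "critical EA EB \<longleftrightarrow> \<not> colourable EA EB \<and>
     (\<forall>EA' EB'. EA' \<subseteq> EA \<longrightarrow> EB' \<subseteq> EB \<longrightarrow> EA' \<noteq> EA \<or> EB' \<noteq> EB \<longrightarrow> colourable EA' EB')"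

lemma critical_not_colourable: "critical EA EB \<Longrightarrow> \<not> colourable EA EB"
  unfolding critical_def by simp

lemma critical_remove:
  "critical EA EB \<Longrightarrow> EA - F \<noteq> EA \<or> EB - G \<noteq> EB \<Longrightarrow> colourable (EA - F) (EB - G)"
  unfolding critical_def by simp

lemma critical_subpair:
  assumes "finite EA" "finite EB" "\<not> colourable EA EB"
  obtains EA' EB' where "EA' \<subseteq> EA" "EB' \<subseteq> EB" "critical EA' EB'"
proof -
  \<comment> \<open>A non-colourable subpair with the fewest sets.\<close>
  define Bad where "Bad = {(EA', EB'). EA' \<subseteq> EA \<and> EB' \<subseteq> EB \<and> \<not> colourable EA' EB'}"
  have "(EA, EB) \<in> Bad" using assms by (auto simp: Bad_def)
  then obtain q where q: "q \<in> Bad"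
    and least: "\<And>q'. q' \<in> Bad \<Longrightarrow> card (fst q) + card (snd q) \<le> card (fst q') + card (snd q')"
    using ex_has_least_nat[of "\<lambda>q. q \<in> Bad" _ "\<lambda>q. card (fst q) + card (snd q)"] by blast
  obtain EA' EB' where [simp]: "q = (EA', EB')" by (cases q)
  have sub: "EA' \<subseteq> EA" "EB' \<subseteq> EB" "\<not> colourable EA' EB'" using q by (auto simp: Bad_def)
  have fin: "finite EA'" "finite EB'" using sub assms finite_subset by auto
  have "critical EA' EB'" unfolding critical_def
  proof (intro conjI allI impI)
    fix A B assume AB: "A \<subseteq> EA'" "B \<subseteq> EB'" "A \<noteq> EA' \<or> B \<noteq> EB'"
    have "card A + card B < card EA' + card EB'"
      using AB fin by (metis add_le_less_mono add_less_le_mono card_mono psubset_card_mono psubsetI)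
    then have "(A, B) \<notin> Bad" using least[of "(A, B)"] by auto
    then show "colourable A B" using AB sub by (auto simp: Bad_def)
  qed (fact sub)
  then show ?thesis using that sub by blast
qed

text \<open>
  A colouring of the pair without \<open>e\<close> must put all of \<open>e\<close> into the first class. Moving \<open>v\<close> to the
  second class repairs \<open>e\<close>, so it has to break some \<open>f\<close>, and every point of \<open>f\<close> other than \<open>v\<close> has
  the second colour and is therefore outside \<open>e\<close>.
\<close>
lemma critical_privateA:
  assumes crit: "critical EA EB" and e: "e \<in> EA" "v \<in> e"
  obtains f where "f \<in> EB" "e \<inter> f = {v}"
proof -
  have "EA - {e} \<noteq> EA" using e by blast
  then have "colourable (EA - {e}) EB" using critical_remove[OF crit, of "{e}" "{}"] by simp
  then obtain R where R: "\<forall>h\<in>EA - {e}. \<not> h \<subseteq> R" "\<forall>f\<in>EB. f \<inter> R \<noteq> {}"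
    unfolding colourable_def by blast
  have bad: "\<not> colourable EA EB" using critical_not_colourable[OF crit] .
  then have eR: "e \<subseteq> R" using R unfolding colourable_def by blast
  have "\<forall>h\<in>EA. \<not> h \<subseteq> R - {v}" using R e by blast
  then obtain f where f: "f \<in> EB" "f \<inter> (R - {v}) = {}" using bad unfolding colourable_def by blast
  have "f \<inter> R \<noteq> {}" using R f by blast
  then have "e \<inter> f = {v}" using f eR e by blast
  with f that show ?thesis by blast
qed

lemma critical_privateB:
  assumes crit: "critical EA EB" and f: "f \<in> EB" "v \<in> f"
  obtains e where "e \<in> EA" "e \<inter> f = {v}"
proof -
  have "EB - {f} \<noteq> EB" using f by blast
  then have "colourable EA (EB - {f})" using critical_remove[OF crit, of "{}" "{f}"] by simp
  then obtain R where R: "\<forall>h\<in>EA. \<not> h \<subseteq> R" "\<forall>h\<in>EB - {f}. h \<inter> R \<noteq> {}"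
    unfolding colourable_def by blast
  have bad: "\<not> colourable EA EB" using critical_not_colourable[OF crit] .
  then have fR: "f \<inter> R = {}" using R unfolding colourable_def by blast
  have "\<forall>h\<in>EB. h \<inter> (insert v R) \<noteq> {}" using R f by blast
  then obtain e where e: "e \<in> EA" "e \<subseteq> insert v R" using bad unfolding colourable_def by blast
  have "\<not> e \<subseteq> R" using R e by blast
  then have "e \<inter> f = {v}" using f fR e by blast
  with e that show ?thesis by blast
qed

section \<open>Weights of configurations\<close>

text \<open>
  A list of edges, each of which contributes a new point when it is added to \<open>X\<close>. Only such edges
  restrict the choice of the new points, so only they count in the weight of a configuration.
\<close>
fun growing :: "'v set set \<Rightarrow> 'v set \<Rightarrow> 'v set list \<Rightarrow> bool" where
  "growing E X [] \<longleftrightarrow> True"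
| "growing E X (h # hs) \<longleftrightarrow> h \<in> E \<and> \<not> h \<subseteq> X \<and> growing E (X \<union> h) hs"

lemma growing_append:
  "growing E X (hs @ hs') \<longleftrightarrow> growing E X hs \<and> growing E (X \<union> \<Union>(set hs)) hs'"
  by (induction hs arbitrary: X) (auto simp: Un_assoc)

lemma growing_mono_edges: "growing E X hs \<Longrightarrow> E \<subseteq> E' \<Longrightarrow> growing E' X hs"
  by (induction hs arbitrary: X) auto

lemma growing_subset: "growing E X hs \<Longrightarrow> set hs \<subseteq> E"
  by (induction hs arbitrary: X) auto

text \<open>
  If the probability is of order $n^{\beta - 1}$, then a new point multiplies the
  expected number of configurations by about $n^\beta$, and an equation that it has to
  satisfy divides this number by \<open>n\<close>. So $n^\alpha$ is the order of the expected
  number of solutions of the first equation: \<open>beta a b * a - 1 = alpha b\<close>.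
\<close>
definition alpha :: "nat \<Rightarrow> real" where "alpha b = 1 / (real b - 1)"
definition beta :: "nat \<Rightarrow> nat \<Rightarrow> real" where "beta a b = real b / (real a * (real b - 1))"

text \<open>
  \<open>w\<close> is the weight of the configuration \<open>X\<close>: the exponent of \<open>n\<close> in its expected number. A
  configuration is built by at most \<open>s\<close> edges from nothing or from the points \<open>Q\<close> of a path;
  \<open>P\<close> says which sets \<open>Q\<close> these are. Every path has weight \<open>alpha b\<close>, however long it is.
\<close>
definition reaches :: "'v set set \<Rightarrow> ('v set \<Rightarrow> bool) \<Rightarrow> nat \<Rightarrow> nat \<Rightarrow> nat \<Rightarrow> 'v set \<Rightarrow> real \<Rightarrow> bool" where
  "reaches E P a b s X w \<longleftrightarrow>
     (\<exists>Q w0 hs. (Q = {} \<and> w0 = 0 \<or> P Q \<and> w0 = alpha b) \<and> growing E Q hs \<and> length hs \<le> s \<and>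
        X = Q \<union> \<Union>(set hs) \<and> w = w0 + beta a b * card (X - Q) - length hs)"

lemma reaches_empty: "reaches E P a b 0 {} 0"
  unfolding reaches_def by (intro exI[of _ "{}"] exI[of _ 0] exI[of _ "[]"]) auto

lemma reaches_state: "P Q \<Longrightarrow> reaches E P a b 0 Q (alpha b)"
  unfolding reaches_def by (intro exI[of _ Q] exI[of _ "alpha b"] exI[of _ "[]"]) auto

lemma reaches_mono:
  assumes "reaches E P a b s X w" "E \<subseteq> E'" "\<And>Q. P Q \<Longrightarrow> P' Q" "s \<le> s'"
  shows "reaches E' P' a b s' X w"
proof -
  obtain Q w0 hs where *: "Q = {} \<and> w0 = 0 \<or> P Q \<and> w0 = alpha b" "growing E Q hs" "length hs \<le> s"
    "X = Q \<union> \<Union>(set hs)" "w = w0 + beta a b * card (X - Q) - length hs"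
    using assms(1) unfolding reaches_def by blast
  show ?thesis unfolding reaches_def
    using * assms(3)[of Q] growing_mono_edges[OF *(2) assms(2)] assms(4)
    by (intro exI[of _ Q] exI[of _ w0] exI[of _ hs]) auto
qed

lemma reaches_extend:
  assumes r: "reaches E P a b s X w" and c: "growing E X hs" and fin: "\<And>e. e \<in> E \<Longrightarrow> finite e"
  shows "reaches E P a b (s + length hs) (X \<union> \<Union>(set hs))
           (w + beta a b * card (\<Union>(set hs) - X) - length hs)"
proof -
  obtain Q w0 ks where *: "Q = {} \<and> w0 = 0 \<or> P Q \<and> w0 = alpha b" "growing E Q ks" "length ks \<le> s"
    "X = Q \<union> \<Union>(set ks)" "w = w0 + beta a b * card (X - Q) - length ks"
    using r unfolding reaches_def by blast
  have "finite (\<Union>(set ks))" using growing_subset[OF *(2)] fin by auto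
  then have f1: "finite (X - Q)" using *(4) by (simp add: Un_Diff)
  have f2: "finite (\<Union>(set hs) - X)" using growing_subset[OF c] fin by auto
  have "(X \<union> \<Union>(set hs)) - Q = (X - Q) \<union> (\<Union>(set hs) - X)" using * by auto
  moreover have "(X - Q) \<inter> (\<Union>(set hs) - X) = {}" by auto
  ultimately have "card ((X \<union> \<Union>(set hs)) - Q) = card (X - Q) + card (\<Union>(set hs) - X)"
    using card_Un_disjoint f1 f2 by metis
  then show ?thesis unfolding reaches_def
    using * c by (intro exI[of _ Q] exI[of _ w0] exI[of _ "ks @ hs"]) (auto simp: growing_append algebra_simps)
qed

text \<open>
  The form in which the absence of configurations of negative weight is exploited: each gain of an
  edge over the new points has to be paid for by the weight \<open>w\<close>.
\<close>
lemma growing_length_le: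
  assumes nonneg: "\<forall>X w. reaches E P a b S X w \<longrightarrow> 0 \<le> w"
    and r: "reaches E P a b s X w" and c: "growing E X hs" and fin: "\<And>e. e \<in> E \<Longrightarrow> finite e"
    and len: "s + length hs \<le> S" and N: "card (\<Union>(set hs) - X) \<le> N" and b: "2 \<le> b"
  shows "length hs \<le> w + beta a b * N"
proof -
  have "0 \<le> w + beta a b * card (\<Union>(set hs) - X) - length hs"
    using nonneg reaches_mono[OF reaches_extend[OF r c fin] order_refl _ len] by blast
  moreover have "beta a b * card (\<Union>(set hs) - X) \<le> beta a b * N"
    using N b by (intro mult_left_mono) (auto simp: beta_def)
  ultimately show ?thesis by linarith
qed

section \<open>Equations of equal length\<close>

text \<open>
  The head of the list is the end at which the path is prolonged, and edges that leave the path
  there are inserted before it.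
\<close>
fun loose :: "'v set set \<Rightarrow> 'v set list \<Rightarrow> bool" where
  "loose E [] \<longleftrightarrow> False"
| "loose E [e] \<longleftrightarrow> e \<in> E"
| "loose E (e # f # es) \<longleftrightarrow>
     e \<in> E \<and> (\<exists>v. e \<inter> f = {v}) \<and> (\<forall>h\<in>set es. e \<inter> h = {}) \<and> loose E (f # es)"

lemma loose_snoc:
  "loose E (es @ [f, e]) \<longleftrightarrow>
     e \<in> E \<and> (\<exists>v. e \<inter> f = {v}) \<and> (\<forall>h\<in>set es. e \<inter> h = {}) \<and> loose E (es @ [f])"
proof (induction es)
  case Nil
  then show ?case by (auto simp: Int_commute)
next
  case (Cons x es)
  then show ?case by (cases es) (auto simp: Int_commute)
qed

lemma loose_rev: "loose E (rev es) \<longleftrightarrow> loose E es"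
proof (induction es rule: induct_list012)
  case (3 x y zs)
  then show ?case using loose_snoc[of E "rev zs" y x] by auto
qed auto

lemma loose_tl: "loose E (e # ms) \<Longrightarrow> ms \<noteq> [] \<Longrightarrow> loose E ms"
  by (cases ms) auto

lemma loose_edges: "loose E es \<Longrightarrow> set es \<subseteq> E"
  by (induction es rule: induct_list012) auto

lemma loose_mono: "loose E es \<Longrightarrow> E \<subseteq> E' \<Longrightarrow> loose E' es"
  by (induction E es rule: loose.induct) auto

lemma loose_joint:
  assumes "loose E (e # ms)" "ms \<noteq> []"
  obtains v where "e \<inter> \<Union>(set ms) = {v}"
proof -
  obtain f es where ms: "ms = f # es" using assms(2) by (cases ms) auto
  obtain v where "e \<inter> f = {v}" using assms(1) ms by auto
  moreover have "e \<inter> \<Union>(set es) = {}" using assms(1) ms by auto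
  ultimately have "e \<inter> \<Union>(set ms) = {v}" using ms by auto
  then show ?thesis by (rule that)
qed

lemma loose_distinct:
  assumes "loose E es" "\<And>e. e \<in> E \<Longrightarrow> card e \<ge> 2"
  shows "distinct es"
  using assms(1)
proof (induction es rule: induct_list012)
  case (3 e f es)
  have "e \<noteq> f"
  proof
    assume "e = f"
    then have "card e = 1" using 3(3) by auto
    then show False using assms(2)[of e] 3(3) by auto
  qed
  moreover have "e \<notin> set es"
  proof
    assume "e \<in> set es"
    then have "e = {}" using 3(3) by auto
    then show False using assms(2)[of e] 3(3) by auto
  qed
  ultimately show ?case using 3 by auto
qed auto

lemma longest_loose:
  assumes "finite E" "\<And>e. e \<in> E \<Longrightarrow> card e \<ge> 2" "loose E ks"
  obtains es where "loose E es" "length ks \<le> length es"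
    "\<And>es'. loose E es' \<Longrightarrow> length es' \<le> length es"
proof -
  have "length es \<le> card E" if "loose E es" for es
    using loose_distinct[OF that assms(2)] loose_edges[OF that] assms(1)
    by (metis card_mono distinct_card)
  then obtain es where "loose E es" "\<And>es'. loose E es' \<Longrightarrow> length es' \<le> length es"
    using ex_has_greatest_nat[of "loose E" ks length "Suc (card E)"] assms(3) by (metis less_Suc_eq_le)
  then show ?thesis using that assms(3) by blast
qed

lemma card_less_obtain:
  assumes "finite B" "card B < card A"
  obtains y where "y \<in> A" "y \<notin> B"
  using assms by (metis card_mono not_le subsetI)

text \<open>
  For equations of equal length the two kinds of edges play the same role, and the union of a
  critical pair is studied as one \<open>k\<close>-uniform hypergraph. The last assumption is the one to be
  refuted.
\<close>
locale uniform_graph =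
  fixes E :: "'v set set" and k :: nat
  assumes finE: "finite E" and k3: "3 \<le> k"
    and cardE: "\<And>e. e \<in> E \<Longrightarrow> card e = k"
    and lone: "\<And>e v. e \<in> E \<Longrightarrow> v \<in> e \<Longrightarrow> \<exists>g\<in>E. e \<inter> g = {v}"
    and nonneg: "\<forall>X w. reaches E (\<lambda>Q. \<exists>es. loose E es \<and> Q = \<Union>(set es)) k k 3 X w \<longrightarrow> 0 \<le> w"
begin

lemma fin: "e \<in> E \<Longrightarrow> finite e" using cardE k3 by (metis card.infinite not_numeral_le_zero)

lemma beta_eq: "beta k k = alpha k"
  using k3 by (simp add: alpha_def beta_def field_simps)

lemma alpha_pos: "alpha k > 0" and alpha_k: "alpha k * k = 1 + alpha k" and alpha_le: "alpha k \<le> 1/2"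
  using k3 by (auto simp: alpha_def field_simps)

lemma path_length_le:
  assumes "loose E es" "growing E (\<Union>(set es)) hs" "length hs \<le> 3" "card (\<Union>(set hs) - \<Union>(set es)) \<le> N"
  shows "length hs \<le> alpha k + alpha k * N"
proof -
  have "length hs \<le> alpha k + beta k k * N"
    by (rule growing_length_le[OF nonneg reaches_state assms(2) fin _ assms(4)]) (use assms k3 in auto)
  then show ?thesis by (simp add: beta_eq)
qed

definition longest where "longest es \<longleftrightarrow> loose E es \<and> (\<forall>es'. loose E es' \<longrightarrow> length es' \<le> length es)"

lemma longest_rev: "longest es \<Longrightarrow> longest (rev es)" by (simp add: longest_def loose_rev)

text \<open>
  An edge \<open>g\<close> that leaves the end \<open>e\<close> of a longest loose path at a free point \<open>x\<close> must come back to
  the path, for otherwise the path could be prolonged. If \<open>g\<close> had no new point at all, it could be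
  inserted before \<open>e\<close>: it then contributes \<open>x\<close>, while \<open>e\<close> still contributes its other free points,
  and an edge has been gained without a new point.
\<close>
lemma end_edge:
  assumes m: "longest (e # ms)" "ms \<noteq> []" and x: "x \<in> e" "x \<notin> \<Union>(set ms)" and g: "g \<in> E" "e \<inter> g = {x}"
  shows "g \<inter> \<Union>(set ms) \<noteq> {}" "\<not> g \<subseteq> e \<union> \<Union>(set ms)"
proof -
  have l: "loose E (e # ms)" and mx: "\<And>es'. loose E es' \<Longrightarrow> length es' \<le> length (e # ms)"
    using m by (auto simp: longest_def)
  have lm: "loose E ms" using l m loose_tl by blast
  have eE: "e \<in> E" using loose_edges[OF l] by auto
  show "g \<inter> \<Union>(set ms) \<noteq> {}"
  proof
    assume "g \<inter> \<Union>(set ms) = {}"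
    then have "loose E (g # e # ms)" using g l by (auto simp: Int_commute)
    then show False using mx[of "g # e # ms"] by simp
  qed
  obtain v where v: "e \<inter> \<Union>(set ms) = {v}" using loose_joint[OF l m(2)] .
  show "\<not> g \<subseteq> e \<union> \<Union>(set ms)"
  proof
    assume sub: "g \<subseteq> e \<union> \<Union>(set ms)"
    have "card {x, v} < card e" using cardE[OF eE] k3 by (simp add: card_insert_if)
    then obtain y where y: "y \<in> e" "y \<noteq> x" "y \<noteq> v" using card_less_obtain[of "{x, v}" e] by auto
    have "y \<notin> \<Union>(set ms) \<union> g" using y v g by blast
    moreover have "x \<in> g" using g by blast
    ultimately have c: "growing E (\<Union>(set ms)) [g, e]" using x(2) y(1) g(1) eE by auto
    have "\<Union>(set [g, e]) - \<Union>(set ms) \<subseteq> e - {v}" using sub v by auto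
    then have "card (\<Union>(set [g, e]) - \<Union>(set ms)) \<le> card (e - {v})"
      using fin[OF eE] by (intro card_mono) auto
    also have "\<dots> = k - 1" using cardE[OF eE] v by (auto simp: card_Diff_singleton_if)
    finally have "2 \<le> alpha k + alpha k * (k - 1)" using path_length_le[OF lm c] by simp
    moreover have "alpha k + alpha k * (k - 1) = 1 + alpha k" using alpha_k k3 by (simp add: algebra_simps of_nat_diff)
    ultimately show False using alpha_le by linarith
  qed
qed

lemma new_part:
  assumes m: "longest (e # ms)" "ms \<noteq> []" and x: "x \<in> e" "x \<notin> \<Union>(set ms)" and g: "g \<in> E" "e \<inter> g = {x}"
  shows "card (g - (e \<union> \<Union>(set ms))) \<le> k - 2"
proof -
  obtain c where c: "c \<in> g" "c \<in> \<Union>(set ms)" using end_edge(1)[OF assms] by blast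
  have "c \<noteq> x" "x \<in> g" using c x g by auto
  then have "card (g - {c, x}) = k - 2" using cardE[OF g(1)] fin[OF g(1)] c by (simp add: card_Diff_subset)
  moreover have "g - (e \<union> \<Union>(set ms)) \<subseteq> g - {c, x}" using c x by auto
  ultimately show ?thesis using fin[OF g(1)] by (metis card_mono finite_Diff)
qed

text \<open>
  An edge with at most \<open>k - 2\<close> new points costs at least \<open>alpha k\<close>. Two such edges bring the weight
  \<open>alpha k\<close> of the path below zero, unless the second one has no new point after the first.
\<close>
lemma two_extensions:
  assumes l: "loose E es" and g: "g \<in> E" "h \<in> E" and j: "card (g - \<Union>(set es)) \<le> k - 2" "card (h - \<Union>(set es)) \<le> k - 2"
    and new: "\<not> g \<subseteq> \<Union>(set es)"
  shows "h \<subseteq> \<Union>(set es) \<union> g"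
proof (rule ccontr)
  assume n: "\<not> h \<subseteq> \<Union>(set es) \<union> g"
  have c: "growing E (\<Union>(set es)) [g, h]" using g new n by auto
  have "\<Union>(set [g, h]) - \<Union>(set es) = (g - \<Union>(set es)) \<union> (h - \<Union>(set es))" by auto
  then have "card (\<Union>(set [g, h]) - \<Union>(set es)) \<le> 2 * (k - 2)" using j by (simp add: card_Un_le[THEN order_trans])
  from path_length_le[OF l c _ this] have "2 \<le> alpha k + alpha k * (2 * (k - 2))" by simp
  also have "\<dots> = alpha k + 2 * (alpha k * k) - 4 * alpha k" using k3 by (simp add: algebra_simps of_nat_diff)
  finally show False using alpha_k alpha_pos by linarith
qed

lemma max_loose_exists:
  assumes "E \<noteq> {}"
  obtains e ms where "longest (e # ms)" "ms \<noteq> []"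
proof -
  obtain e where e: "e \<in> E" using assms by blast
  then obtain v where "v \<in> e" using cardE[OF e] k3 by fastforce
  then obtain g where g: "g \<in> E" "e \<inter> g = {v}" using lone e by blast
  have "loose E [e, g]" using e g by auto
  then obtain es where es: "loose E es" "2 \<le> length es" "\<And>es'. loose E es' \<Longrightarrow> length es' \<le> length es"
    using longest_loose[OF finE, of "[e, g]"] cardE k3 by (metis One_nat_def Suc_1 Suc_leD length_Cons list.size(3) numeral_3_eq_3)
  obtain e' ms where [simp]: "es = e' # ms" using es(2) by (cases es) auto
  have "ms \<noteq> []" using es(2) by auto
  moreover have "longest (e' # ms)" using es by (simp add: longest_def)
  ultimately show ?thesis using that by blast
qed

text \<open>
  By the preceding lemmas the edges \<open>g\<close> and \<open>h\<close> that leave the end \<open>e\<close> at two free points have the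
  same new points. Adding both to the path without \<open>e\<close> brings at most \<open>k\<close> new points with two
  edges, which is too few for \<open>4 \<le> k\<close>.
\<close>
lemma no_edges_if_ge4: assumes "4 \<le> k" shows "E = {}"
proof (rule ccontr)
  assume "E \<noteq> {}"
  then obtain e ms where m: "longest (e # ms)" "ms \<noteq> []" using max_loose_exists by blast
  have l: "loose E (e # ms)" using m by (auto simp: longest_def)
  have lm: "loose E ms" using l m loose_tl by blast
  have eE: "e \<in> E" using loose_edges[OF l] by auto
  obtain v where v: "e \<inter> \<Union>(set ms) = {v}" using loose_joint[OF l m(2)] .
  obtain x where x: "x \<in> e" "x \<noteq> v" using card_less_obtain[of "{v}" e] cardE[OF eE] k3 by auto
  obtain y where y: "y \<in> e" "y \<noteq> v" "y \<noteq> x"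
    using card_less_obtain[of "{v, x}" e] cardE[OF eE] k3 x by auto
  note xy = x(1) y(1) x(2) y(2) y(3)[symmetric]
  obtain g where g: "g \<in> E" "e \<inter> g = {x}" using lone[OF eE xy(1)] by blast
  obtain h where h: "h \<in> E" "e \<inter> h = {y}" using lone[OF eE xy(2)] by blast
  have x': "x \<notin> \<Union>(set ms)" "y \<notin> \<Union>(set ms)" using v xy by auto
  note gE = end_edge[OF m xy(1) x'(1) g] new_part[OF m xy(1) x'(1) g]
  note hE = end_edge[OF m xy(2) x'(2) h] new_part[OF m xy(2) x'(2) h]
  have W: "\<Union>(set (e # ms)) = e \<union> \<Union>(set ms)" by simp
  have sub: "h \<subseteq> e \<union> \<Union>(set ms) \<union> g"
    using two_extensions[OF l g(1) h(1), unfolded W, OF gE(3) hE(3) gE(2)] .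
  have "y \<notin> g" "x \<in> g" using g(2) xy(2,5) by auto
  moreover have "y \<in> h" using h(2) by auto
  ultimately have "\<not> g \<subseteq> \<Union>(set ms)" "\<not> h \<subseteq> \<Union>(set ms) \<union> g" using x' by blast+
  then have c: "growing E (\<Union>(set ms)) [g, h]" using g(1) h(1) by simp
  have "g \<union> h - \<Union>(set ms) \<subseteq> {x, y} \<union> (g - (e \<union> \<Union>(set ms)))" using sub g(2) h(2) by blast
  then have "\<Union>(set [g, h]) - \<Union>(set ms) \<subseteq> {x, y} \<union> (g - (e \<union> \<Union>(set ms)))" by simp
  then have "card (\<Union>(set [g, h]) - \<Union>(set ms)) \<le> card ({x, y} \<union> (g - (e \<union> \<Union>(set ms))))"
    using fin g by (intro card_mono) auto
  also have "\<dots> \<le> card {x, y} + card (g - (e \<union> \<Union>(set ms)))" by (rule card_Un_le)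
  also have "\<dots> \<le> k" using gE(3) xy assms by simp
  finally have "2 \<le> alpha k + alpha k * k" using path_length_le[OF lm c] by simp
  moreover have "alpha k \<le> 1/3" using assms by (simp add: alpha_def field_simps)
  ultimately show False using alpha_k by linarith
qed

end

lemma obtain_two:
  assumes "card A = 2" obtains x y where "A = {x, y}" "x \<noteq> y"
  using assms by (auto simp: card_2_iff)

context uniform_graph begin

text \<open>
  An end \<open>e\<close> of a longest loose path with points \<open>W\<close>, where \<open>U\<close> are the points of the other edges.
  A path has two ends, and for \<open>k = 3\<close> both are needed.
\<close>
definition path_end where
  "path_end W e U \<longleftrightarrow> (\<exists>ms. longest (e # ms) \<and> ms \<noteq> [] \<and> U = \<Union>(set ms) \<and> W = e \<union> U)"

lemma path_endD:
  assumes "path_end W e U"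
  shows "e \<in> E" "W = e \<union> U" "card (e - U) = k - 1"
    "x \<in> e - U \<Longrightarrow> g \<in> E \<Longrightarrow> e \<inter> g = {x} \<Longrightarrow> g \<inter> U \<noteq> {} \<and> \<not> g \<subseteq> W \<and> card (g - W) \<le> k - 2"
    "growing E U hs \<Longrightarrow> length hs \<le> 3 \<Longrightarrow> card (\<Union>(set hs) - U) \<le> N \<Longrightarrow> length hs \<le> alpha k + alpha k * N"
    "g \<in> E \<Longrightarrow> h \<in> E \<Longrightarrow> card (g - W) \<le> k - 2 \<Longrightarrow> card (h - W) \<le> k - 2 \<Longrightarrow> \<not> g \<subseteq> W \<Longrightarrow> h \<subseteq> W \<union> g"
proof -
  obtain ms where m: "longest (e # ms)" "ms \<noteq> []" and U: "U = \<Union>(set ms)" and W: "W = e \<union> U"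
    using assms unfolding path_end_def by blast
  have l: "loose E (e # ms)" using m by (auto simp: longest_def)
  have lm: "loose E ms" using l m loose_tl by blast
  show eE: "e \<in> E" using loose_edges[OF l] by auto
  show "W = e \<union> U" by (rule W)
  obtain v where v: "e \<inter> \<Union>(set ms) = {v}" using loose_joint[OF l m(2)] .
  have "e - U = e - {v}" "v \<in> e" using v U by blast+
  then show "card (e - U) = k - 1" using cardE[OF eE] by simp
  have W': "\<Union>(set (e # ms)) = W" using U W by simp
  show "x \<in> e - U \<Longrightarrow> g \<in> E \<Longrightarrow> e \<inter> g = {x} \<Longrightarrow> g \<inter> U \<noteq> {} \<and> \<not> g \<subseteq> W \<and> card (g - W) \<le> k - 2"
    using end_edge[OF m, of x g] new_part[OF m, of x g] unfolding U W by (metis DiffD1 DiffD2)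
  show "growing E U hs \<Longrightarrow> length hs \<le> 3 \<Longrightarrow> card (\<Union>(set hs) - U) \<le> N \<Longrightarrow> length hs \<le> alpha k + alpha k * N"
    using path_length_le[OF lm] unfolding U by blast
  show "g \<in> E \<Longrightarrow> h \<in> E \<Longrightarrow> card (g - W) \<le> k - 2 \<Longrightarrow> card (h - W) \<le> k - 2 \<Longrightarrow> \<not> g \<subseteq> W \<Longrightarrow> h \<subseteq> W \<union> g"
    using two_extensions[OF l] unfolding W' by blast
qed

lemma common_new_vertex:
  assumes 3: "k = 3" and e: "path_end W e U" "x \<in> e - U" "g \<in> E" "e \<inter> g = {x}"
    and e': "path_end W e' U'" "x' \<in> e' - U'" "g' \<in> E" "e' \<inter> g' = {x'}"
    and d: "g - W = {d}"
  shows "g' - W = {d}"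
proof -
  have a: "\<not> g \<subseteq> W" "card (g - W) \<le> k - 2" using path_endD(4)[OF e] by auto
  have b: "\<not> g' \<subseteq> W" "card (g' - W) \<le> k - 2" using path_endD(4)[OF e'] by auto
  have "g' \<subseteq> W \<union> g" using path_endD(6)[OF e(1) e(3) e'(3) a(2) b(2) a(1)] .
  then have "g' - W \<subseteq> {d}" using d by blast
  then show ?thesis using b(1) by blast
qed

lemma new_vertex:
  assumes 3: "k = 3" and e: "path_end W e U" "x \<in> e - U" "g \<in> E" "e \<inter> g = {x}"
  obtains d where "g - W = {d}"
proof -
  have a: "\<not> g \<subseteq> W" "card (g - W) \<le> 1" using path_endD(4)[OF e] 3 by auto
  have "finite (g - W)" using fin e by auto
  then have "card (g - W) \<noteq> 0" using a by auto
  then have "card (g - W) = 1" using a by linarith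
  then show ?thesis using that by (metis card_1_singletonE)
qed

text \<open>
  If the third point of \<open>g'\<close> were in \<open>U\<close>, then \<open>g'\<close> would contribute only \<open>d\<close> to the path without
  \<open>e\<close>, and afterwards \<open>g\<close> would contribute only \<open>x\<close>, since its two other points are \<open>d\<close> and a point
  of \<open>U\<close>. Two edges with one new point each are too expensive.
\<close>
lemma cross_edge:
  assumes 3: "k = 3" and e: "path_end W e U" "x \<in> e - U" "g \<in> E" "e \<inter> g = {x}"
    and e': "path_end W e' U'" "x' \<in> e' - U'" "g' \<in> E" "e' \<inter> g' = {x'}"
    and d: "g' - W = {d}" and sub: "e' \<subseteq> U"
  obtains c where "c \<in> e - U" "g' = {x', c, d}"
proof -
  have dg: "g - W = {d}" using common_new_vertex[OF 3 e' e d] .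
  have W: "W = e \<union> U" using path_endD(2)[OF e(1)] .
  have x'W: "x' \<in> W" using sub W e'(2) by auto
  have "card {x', d} < card g'" using cardE[OF e'(3)] 3 by (simp add: card_insert_if)
  then obtain c where c: "c \<in> g'" "c \<noteq> x'" "c \<noteq> d" using card_less_obtain[of "{x', d}" g'] by auto
  have in': "x' \<in> g'" "d \<in> g'" "x' \<noteq> d" using e'(4) d x'W by blast+
  have "card {x', c, d} = card g'" using c in' cardE[OF e'(3)] 3 by simp
  then have g'eq: "g' = {x', c, d}" using c in' fin[OF e'(3)] by (metis card_subset_eq empty_subsetI insert_subset)
  have cW: "c \<in> W" using c d by blast
  have "c \<notin> U"
  proof
    assume cU: "c \<in> U"
    have dW: "d \<notin> U" using d W by blast
    have xg': "x \<notin> g'" using g'eq e(2) cU sub e'(2) W d by blast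
    have "\<not> g' \<subseteq> U" "\<not> g \<subseteq> U \<union> g'" using dW in' xg' e(2,4) by blast+
    then have ch: "growing E U [g', g]" using e(3) e'(3) by simp
    have "g - U \<subseteq> {x, d}" using dg W e(4) by blast
    moreover have "g' - U \<subseteq> {d}" using g'eq cU sub e'(2) by blast
    ultimately have "\<Union>(set [g', g]) - U \<subseteq> {x, d}" by auto
    then have "card (\<Union>(set [g', g]) - U) \<le> card {x, d}" by (intro card_mono) auto
    also have "\<dots> \<le> 2" by (simp add: card_insert_if)
    finally have "length [g', g] \<le> alpha k + alpha k * 2" using path_endD(5)[OF e(1) ch, of 2] by simp
    then show False using 3 by (simp add: alpha_def)
  qed
  then show ?thesis using that g'eq cW W by blast
qed

text \<open>
  The six points are the edges of the complete graph on four vertices, and the four triples are its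
  vertex stars. This configuration has weight 0 and every edge has, at each of its points, another
  edge that meets it only there. So it satisfies all consequences of criticality used so far, and it
  has to be excluded by a colouring.
\<close>
definition K4 where
  "K4 p q r s t u \<longleftrightarrow> distinct [p, q, r, s, t, u] \<and>
     {p, q, r} \<in> E \<and> {p, s, t} \<in> E \<and> {q, s, u} \<in> E \<and> {r, t, u} \<in> E"

lemma K4_swaps:
  assumes "K4 p q r s t u" shows "K4 q p r s u t" "K4 p r q t s u" "K4 p s t q r u"
  using assms unfolding K4_def by (auto simp: insert_commute)

text \<open>
  A fifth triple \<open>h\<close> with two points of the star \<open>{p, q, r}\<close> adds one point to this star. Two of the
  other stars then add one point each, so that three edges have only three new points.
\<close>
lemma K4_fifth:
  assumes 3: "k = 3" and K: "K4 p q r s t u" and h: "h \<in> E" "h \<subseteq> {p, q, r, s, t, u}"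
  shows "\<not> (p \<in> h \<and> q \<in> h \<and> r \<notin> h)"
proof
  assume pq: "p \<in> h \<and> q \<in> h \<and> r \<notin> h"
  have E4: "{p, q, r} \<in> E" "{p, s, t} \<in> E" "{q, s, u} \<in> E" "{r, t, u} \<in> E" and ds: "distinct [p, q, r, s, t, u]"
    using K unfolding K4_def by auto
  have "card {p, q} < card h" using cardE[OF h(1)] 3 by (simp add: card_insert_if)
  then obtain z where z: "z \<in> h" "z \<noteq> p" "z \<noteq> q" using card_less_obtain[of "{p, q}" h] by auto
  have "card {p, q, z} = card h" using z ds cardE[OF h(1)] 3 by simp
  then have hz: "h = {p, q, z}" using z pq fin[OF h(1)] by (metis card_subset_eq empty_subsetI insert_subset)
  have *: False if M: "M \<in> E" "M' \<in> E" "M \<union> M' \<subseteq> {p, q, r, s, t, u}"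
    and c: "c \<in> M" "c \<notin> {p, q, r, z}" "d \<in> M'" "d \<notin> {p, q, r, z}" "d \<notin> M" for M M' c d
  proof -
    have "\<not> h \<subseteq> {p, q, r}" using z pq by blast
    moreover have "c \<notin> {p, q, r} \<union> h" "d \<notin> {p, q, r} \<union> h \<union> M" using c unfolding hz by simp_all
    then have "\<not> M \<subseteq> {p, q, r} \<union> h" "\<not> M' \<subseteq> {p, q, r} \<union> h \<union> M" using c(1,3) by - (blast+)
    ultimately have ch: "growing E (\<Union>(set [{p, q, r}])) [h, M, M']" using M h(1) by simp
    have "h \<union> (M \<union> M') \<subseteq> {p, q, r, s, t, u}" using M(3) h(2) by (rule Un_least[rotated])
    then have "h \<union> (M \<union> M') - {p, q, r} \<subseteq> {s, t, u}" by blast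
    then have "\<Union>(set [h, M, M']) - \<Union>(set [{p, q, r}]) \<subseteq> {s, t, u}" by simp
    then have "card (\<Union>(set [h, M, M']) - \<Union>(set [{p, q, r}])) \<le> card {s, t, u}" by (intro card_mono) auto
    also have "\<dots> \<le> 3" by (simp add: card_insert_if)
    finally have "length [h, M, M'] \<le> alpha k + alpha k * 3"
      using path_length_le[OF _ ch, of 3] E4 by simp
    then show False using 3 by (simp add: alpha_def)
  qed
  have "z \<in> {p, q, r, s, t, u}" using z(1) h(2) by (rule set_mp[rotated])
  moreover have "z \<noteq> r" using z(1) pq by blast
  ultimately have "z = s \<or> z = t \<or> z = u" using z(2,3) by simp
  then consider "z = s" | "z = t" | "z = u" by blast
  then show False
  proof cases
    case 1
    show ?thesis by (rule *[of "{p, s, t}" "{q, s, u}" t u]) (use E4 ds 1 in auto)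
  next
    case 2
    show ?thesis by (rule *[of "{p, s, t}" "{r, t, u}" s u]) (use E4 ds 2 in auto)
  next
    case 3
    show ?thesis by (rule *[of "{q, s, u}" "{r, t, u}" s t]) (use E4 ds 3 in auto)
  qed
qed

lemma K4_triple:
  assumes 3: "k = 3" and K: "K4 p q r s t u" and h: "h \<in> E" "h \<subseteq> {p, q, r, s, t, u}"
    and n: "\<not> {p, q, r} \<subseteq> h"
  shows "\<not> (p \<in> h \<and> q \<in> h)" "\<not> (p \<in> h \<and> r \<in> h)" "\<not> (q \<in> h \<and> r \<in> h)"
proof -
  have h2: "h \<subseteq> {p, r, q, t, s, u}" and h3: "h \<subseteq> {q, r, p, u, s, t}" using h(2) by (simp_all add: insert_commute)
  have n': "\<not> (p \<in> h \<and> q \<in> h \<and> r \<in> h)" using n by simp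
  show "\<not> (p \<in> h \<and> q \<in> h)" using K4_fifth[OF 3 K h] n' by blast
  show "\<not> (p \<in> h \<and> r \<in> h)" using K4_fifth[OF 3 K4_swaps(2)[OF K] h(1) h2] n' by blast
  show "\<not> (q \<in> h \<and> r \<in> h)"
    using K4_fifth[OF 3 K4_swaps(2)[OF K4_swaps(1)[OF K]] h(1) h3] n' by blast
qed

text \<open>
  Another edge through one of the six points would, if it has one of them, prolong a loose path;
  if it has two of them, be a second edge with one new point; and if it has three of them, contain two
  points of some star.
\<close>
lemma K4_isolated:
  assumes 3: "k = 3" and K: "K4 p q r s t u" and mx: "\<And>es. loose E es \<Longrightarrow> length es \<le> 2"
    and h: "h \<in> E" "h \<inter> {p, q, r, s, t, u} \<noteq> {}"
  shows "h \<in> {{p, q, r}, {p, s, t}, {q, s, u}, {r, t, u}}"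
proof -
  let ?Q = "{p, q, r, s, t, u}"
  have E4: "{p, q, r} \<in> E" "{p, s, t} \<in> E" "{q, s, u} \<in> E" "{r, t, u} \<in> E" and ds: "distinct [p, q, r, s, t, u]"
    using K unfolding K4_def by auto
  have hc: "card h = 3" "finite h" using cardE[OF h(1)] fin[OF h(1)] 3 by auto
  have one: False if q': "h \<inter> ?Q = {c}" for c
  proof -
    have *: False if "M \<in> E" "M' \<in> E" "M \<subseteq> ?Q" "M' \<subseteq> ?Q" "c \<in> M" "c \<notin> M'" "\<exists>v. M \<inter> M' = {v}" for M M'
    proof -
      have "h \<inter> M = (h \<inter> ?Q) \<inter> M" "h \<inter> M' = (h \<inter> ?Q) \<inter> M'" using that(3,4) by (metis Int_absorb1 Int_assoc)+
      then have "h \<inter> M = {c}" "h \<inter> M' = {}" using that(5,6) unfolding q' by simp_all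
      then have "loose E [h, M, M']" using that(1,2,7) h(1) by auto
      then show False using mx[of "[h, M, M']"] by simp
    qed
    have "c \<in> ?Q" using q' by blast
    then consider "c = p" | "c = q" | "c = r" | "c = s" | "c = t" | "c = u" by blast
    then show False
    proof cases
      case 1 show ?thesis by (rule *[of "{p, q, r}" "{q, s, u}"]) (use E4 ds 1 in auto) next
      case 2 show ?thesis by (rule *[of "{p, q, r}" "{p, s, t}"]) (use E4 ds 2 in auto) next
      case 3 show ?thesis by (rule *[of "{p, q, r}" "{p, s, t}"]) (use E4 ds 3 in auto) next
      case 4 show ?thesis by (rule *[of "{p, s, t}" "{p, q, r}"]) (use E4 ds 4 in auto) next
      case 5 show ?thesis by (rule *[of "{p, s, t}" "{p, q, r}"]) (use E4 ds 5 in auto) next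
      case 6 show ?thesis by (rule *[of "{q, s, u}" "{p, q, r}"]) (use E4 ds 6 in auto)
    qed
  qed
  note sw = K4_swaps
  note K2 = sw(3)[OF K] and K3 = sw(3)[OF sw(1)[OF K]] and K4 = sw(3)[OF sw(1)[OF sw(2)[OF K]]]
  have hQ: "h \<subseteq> ?Q"
  proof (rule ccontr)
    assume n: "\<not> h \<subseteq> ?Q"
    have c1: "card (h - ?Q) \<le> 1"
    proof (rule ccontr)
      assume "\<not> card (h - ?Q) \<le> 1"
      moreover have "card (h - ?Q) + card (h \<inter> ?Q) = 3" using hc
        by (metis card_Diff_subset_Int card_mono finite_Int inf_le1 le_add_diff_inverse2)
      moreover have "card (h \<inter> ?Q) \<noteq> 0" using h(2) hc by simp
      ultimately have "card (h \<inter> ?Q) = 1" by linarith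
      then show False using one by (metis card_1_singletonE)
    qed
    have l: "loose E [{p, q, r}, {p, s, t}]" using E4 ds by auto
    have "\<not> {q, s, u} \<subseteq> {p, q, r} \<union> {p, s, t}" using ds by auto
    moreover have "\<not> h \<subseteq> {p, q, r} \<union> {p, s, t} \<union> {q, s, u}" using n by auto
    ultimately have ch: "growing E (\<Union>(set [{p, q, r}, {p, s, t}])) [{q, s, u}, h]"
      using E4(3) h(1) by (simp add: Un_assoc)
    have "\<Union>(set [{q, s, u}, h]) - \<Union>(set [{p, q, r}, {p, s, t}]) \<subseteq> insert u (h - ?Q)" by auto
    then have "card (\<Union>(set [{q, s, u}, h]) - \<Union>(set [{p, q, r}, {p, s, t}])) \<le> card (insert u (h - ?Q))"
      using hc by (intro card_mono) auto
    also have "\<dots> \<le> 2" using c1 hc by (simp add: card_insert_if)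
    finally have "length [{q, s, u}, h] \<le> alpha k + alpha k * 2" using path_length_le[OF l ch, of 2] by simp
    then show False using 3 by (simp add: alpha_def)
  qed
  have hQ2: "h \<subseteq> {p, s, t, q, r, u}" and hQ3: "h \<subseteq> {q, s, u, p, r, t}" and hQ4: "h \<subseteq> {r, t, u, p, q, s}"
    using hQ by (simp_all add: insert_commute)
  show ?thesis
  proof (rule ccontr)
    assume n: "h \<notin> {{p, q, r}, {p, s, t}, {q, s, u}, {r, t, u}}"
    have star: "A \<subseteq> h \<Longrightarrow> A = h" if "A \<in> E" for A
      using card_subset_eq[OF hc(2)] cardE[OF that] hc(1) 3 by simp
    have ns: "\<not> A \<subseteq> h" if "A \<in> {{p, q, r}, {p, s, t}, {q, s, u}, {r, t, u}}" "A \<in> E" for A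
      using star[OF that(2)] that(1) n by metis
    have "\<not> {p, q, r} \<subseteq> h" "\<not> {p, s, t} \<subseteq> h" "\<not> {q, s, u} \<subseteq> h" "\<not> {r, t, u} \<subseteq> h"
      by (rule ns; use E4 in simp)+
    note nadj = K4_triple[OF 3 K h(1) hQ this(1)] K4_triple[OF 3 K2 h(1) hQ2 this(2)]
      K4_triple[OF 3 K3 h(1) hQ3 this(3)] K4_triple[OF 3 K4 h(1) hQ4 this(4)]
    consider "p \<in> h \<or> u \<in> h" | "q \<in> h \<or> t \<in> h" | "r \<in> h \<or> s \<in> h" using h(2) by blast
    then have "h \<subseteq> {p, u} \<or> h \<subseteq> {q, t} \<or> h \<subseteq> {r, s}"
    proof cases
      case 1
      then have "q \<notin> h" "r \<notin> h" "s \<notin> h" "t \<notin> h" using nadj by metis+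
      then show ?thesis using hQ by blast
    next
      case 2
      then have "p \<notin> h" "r \<notin> h" "s \<notin> h" "u \<notin> h" using nadj by metis+
      then show ?thesis using hQ by blast
    next
      case 3
      then have "p \<notin> h" "q \<notin> h" "t \<notin> h" "u \<notin> h" using nadj by metis+
      then show ?thesis using hQ by blast
    qed
    moreover have "\<not> h \<subseteq> {x, y}" for x y
    proof
      assume "h \<subseteq> {x, y}"
      then have "card h \<le> card {x, y}" by (intro card_mono) auto
      also have "\<dots> \<le> 2" by (simp add: card_insert_if)
      finally show False using hc(1) by simp
    qed
    ultimately show False by metis
  qed
qed

text \<open>
  The edges that leave the path at the free points of its two ends join them through one new
  point \<open>d\<close>.
\<close>
lemma opposite_end:
  assumes 3: "k = 3" and e: "path_end W e U" and e': "path_end W e' U'" "e' \<subseteq> U"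
    and d: "\<And>x g. x \<in> e - U \<Longrightarrow> g \<in> E \<Longrightarrow> e \<inter> g = {x} \<Longrightarrow> g - W = {d}"
    and x': "x' \<in> e' - U'"
  shows "\<exists>c\<in>e - U. {c, x', d} \<in> E"
proof -
  have "card (e - U) \<noteq> 0" using path_endD(3)[OF e] 3 by simp
  then obtain x where x: "x \<in> e - U" by (metis card.empty ex_in_conv)
  then obtain g where g: "g \<in> E" "e \<inter> g = {x}" using lone[OF path_endD(1)[OF e]] by blast
  obtain g' where g': "g' \<in> E" "e' \<inter> g' = {x'}" using lone[OF path_endD(1)[OF e'(1)]] x' by blast
  have gd: "g - W = {d}" using d x g by blast
  have "g' - W = {d}" using common_new_vertex[OF 3 e x g e'(1) x' g' gd] .
  then obtain c where "c \<in> e - U" "g' = {x', c, d}" using cross_edge[OF 3 e x g e'(1) x' g' _ e'(2)] by blast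
  then show ?thesis using g'(1) by (metis insert_commute)
qed

text \<open>
  Every free point of an end is joined by an edge through \<open>d\<close> to a free point of the opposite end,
  so there are two disjoint such pairs, $\{a, a'\}$ and $\{b, b'\}$. The edge
  $\{a, a', d\}$ can replace $e'$ in the path. For the new longest path the edge
  $\{b, b', d\}$ leaves the end at \<open>d\<close>, and so it should meet the opposite end; this is
  possible only if the path has just two edges, and then the four edges form a \<open>K4\<close>.
\<close>
lemma triples_contain_K4:
  assumes 3: "k = 3" and ne: "E \<noteq> {}"
  shows "\<exists>p q r s t u. K4 p q r s t u \<and> (\<forall>es. loose E es \<longrightarrow> length es \<le> 2)"
proof -
  obtain e ms where m: "longest (e # ms)" "ms \<noteq> []" using max_loose_exists[OF ne] .
  obtain mid e' where mid: "ms = mid @ [e']" using m(2) by (metis rev_exhaust)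
  have l: "loose E (e # mid @ [e'])" using m mid by (auto simp: longest_def)
  have l': "loose E (e' # rev mid @ [e])" using l loose_rev[of E "e # mid @ [e']"] by simp
  have m': "longest (e' # rev mid @ [e])" using longest_rev[OF m(1)] mid by simp
  define U where "U = \<Union>(set (mid @ [e']))"
  define U' where "U' = \<Union>(set (rev mid @ [e]))"
  define W where "W = e \<union> U"
  have W': "W = e' \<union> U'" unfolding W_def U_def U'_def by auto
  have pe: "path_end W e U" unfolding path_end_def using m mid W_def U_def by blast
  have pe': "path_end W e' U'" unfolding path_end_def using m' W' U'_def by blast
  have sub: "e \<subseteq> U'" "e' \<subseteq> U" unfolding U_def U'_def by auto
  obtain x y where xy: "e - U = {x, y}" "x \<noteq> y" using obtain_two[OF path_endD(3)[OF pe, unfolded 3, simplified]] .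
  obtain x' y' where xy': "e' - U' = {x', y'}" "x' \<noteq> y'"
    using obtain_two[OF path_endD(3)[OF pe', unfolded 3, simplified]] .
  have x: "x \<in> e - U" using xy by blast
  obtain g where g: "g \<in> E" "e \<inter> g = {x}" using lone[OF path_endD(1)[OF pe]] x by blast
  obtain d where d: "g - W = {d}" using new_vertex[OF 3 pe x g] .
  have dW: "d \<notin> W" using d by blast
  have all: "h - W = {d}" if "z \<in> e - U" "h \<in> E" "e \<inter> h = {z}" for z h
    using common_new_vertex[OF 3 pe x g pe that d] .
  have all': "h - W = {d}" if "z \<in> e' - U'" "h \<in> E" "e' \<inter> h = {z}" for z h
    using common_new_vertex[OF 3 pe x g pe' that d] .
  have fw: "\<exists>c\<in>{x', y'}. {c, z, d} \<in> E" if "z \<in> e - U" for z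
    using opposite_end[OF 3 pe' pe sub(1) all' that] unfolding xy' .
  have bw: "\<exists>c\<in>{x, y}. {c, z, d} \<in> E" if "z \<in> e' - U'" for z
    using opposite_end[OF 3 pe pe' sub(2) all that] unfolding xy .
  have in4: "x \<in> e - U" "y \<in> e - U" "x' \<in> e' - U'" "y' \<in> e' - U'" using xy xy' by blast+
  \<comment> \<open>A bipartite graph on two plus two points without isolated points has a perfect matching.\<close>
  have "({x, x', d} \<in> E \<and> {y, y', d} \<in> E) \<or> ({x, y', d} \<in> E \<and> {y, x', d} \<in> E)"
    using fw[OF in4(1)] fw[OF in4(2)] bw[OF in4(3)] bw[OF in4(4)] by (auto simp: insert_commute)
  then obtain a' b' where ab': "{a', b'} = {x', y'}" and M: "{x, a', d} \<in> E" "{y, b', d} \<in> E"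
  proof
    assume "{x, x', d} \<in> E \<and> {y, y', d} \<in> E"
    then show thesis using that[of x' y'] by simp
  next
    assume "{x, y', d} \<in> E \<and> {y, x', d} \<in> E"
    then show thesis using that[of y' x'] by (simp add: insert_commute)
  qed
  obtain a b where ab: "{a, b} = {x, y}" "a = x" "b = y" by blast
  note M = M[folded ab(2,3)] and ab = ab(1) ab'
  have ab_in: "a \<in> e - U" "b \<in> e - U" "a' \<in> e' - U'" "b' \<in> e' - U'" "a \<noteq> b" "a' \<noteq> b'"
    using ab xy xy' by (auto simp: doubleton_eq_iff)
  have apart: "a' \<notin> e" "b' \<notin> e" "a \<notin> e'" "b \<notin> e'" "d \<notin> e" "d \<notin> e'"
    using ab_in(1-4) sub dW W_def W' by blast+
  have mid_apart: "a \<notin> h" "b \<notin> h" "a' \<notin> h" "b' \<notin> h" "d \<notin> h" if "h \<in> set mid" for h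
    using ab_in(1-4) that dW W_def unfolding U_def U'_def by auto
  have eE: "e \<in> E" "e' \<in> E" using path_endD(1) pe pe' by blast+
  \<comment> \<open>Otherwise the path in which $\{a, a', d\}$ replaces $e'$ has another end \<open>f\<close>, far from \<open>b\<close>.\<close>
  have "mid = []"
  proof (rule ccontr)
    assume "mid \<noteq> []"
    then obtain m0 f where f: "mid = m0 @ [f]" by (metis rev_exhaust)
    let ?M = "{a, a', d}"
    have lmid: "loose E (e # mid)" using l loose_rev[of E "e # mid"] loose_tl[OF l'] loose_rev[of E "rev mid @ [e]"] by simp
    have "?M \<inter> e = {a}" using ab_in(1) apart by auto
    moreover have "\<forall>h\<in>set mid. ?M \<inter> h = {}" using mid_apart by blast
    ultimately have lM: "loose E (?M # e # mid)" using M lmid by auto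
    then have mM: "longest (?M # e # mid)" using m mid by (auto simp: longest_def)
    have mM': "longest (f # rev m0 @ [e, ?M])" using longest_rev[OF mM] f by simp
    define V where "V = \<Union>(set (e # mid))"
    define V' where "V' = \<Union>(set (rev m0 @ [e, ?M]))"
    have VV: "?M \<union> V = f \<union> V'" unfolding V_def V'_def f by auto
    have q: "path_end (?M \<union> V) ?M V" unfolding path_end_def V_def using mM by blast
    have q': "path_end (?M \<union> V) f V'" unfolding path_end_def VV V'_def using mM' by blast
    have fE: "f \<in> E" using path_endD(1)[OF q'] .
    have "card (f - V') \<noteq> 0" using path_endD(3)[OF q'] 3 by simp
    then obtain z where z: "z \<in> f - V'" by (metis card.empty ex_in_conv)
    obtain h where h: "h \<in> E" "f \<inter> h = {z}" using lone[OF fE] z by blast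
    have dV: "d \<notin> V" using apart mid_apart unfolding V_def by auto
    have b'V: "b' \<notin> V" using apart mid_apart unfolding V_def by auto
    have ne2: "b \<noteq> d" "b' \<noteq> d" "b \<noteq> a'" using ab_in apart by blast+
    have Mb: "?M \<inter> {b, b', d} = {d}" using ab_in(5,6) ne2 apart ab_in by auto
    have b'n: "{b, b', d} - (?M \<union> V) = {b'}" using ab_in ne2 b'V apart unfolding V_def by auto
    have "?M \<subseteq> V'" unfolding V'_def by auto
    moreover have "d \<in> ?M - V" using dV by blast
    ultimately obtain c where c: "c \<in> f - V'" "{b, b', d} = {d, c, b'}"
      using cross_edge[OF 3 q' z h q _ M(2) Mb b'n] by blast
    have "b \<in> V'" "d \<in> V'" using ab_in unfolding V'_def by auto
    moreover have "b' \<notin> f" using mid_apart f by simp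
    moreover have "c \<in> {b, b', d}" unfolding c(2) by simp
    ultimately show False using c(1) by auto
  qed
  obtain p where p: "e \<inter> e' = {p}" using l \<open>mid = []\<close> by auto
  have U: "U = e'" "U' = e" unfolding U_def U'_def using \<open>mid = []\<close> by auto
  have "e = (e \<inter> e') \<union> (e - e')" "e' = (e \<inter> e') \<union> (e' - e)" by blast+
  then have ee: "e = {p, a, b}" "e' = {p, a', b'}"
    unfolding p xy(1)[unfolded U] xy'(1)[unfolded U] ab(1)[symmetric] ab(2)[symmetric] by (simp_all add: insert_commute)
  have pe: "p \<in> e" "p \<in> e'" using p by blast+
  have in': "a \<in> e" "b \<in> e" "a' \<in> e'" "b' \<in> e'" using ab_in by blast+
  have "distinct [p, a, b, a', b', d]"
    using ab_in(5,6) apart pe in' by auto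
  moreover have "{p, a, b} \<in> E" "{p, a', b'} \<in> E" using eE unfolding ee[symmetric] .
  ultimately have "K4 p a b a' b' d" unfolding K4_def using M by simp
  moreover have "length es \<le> 2" if "loose E es" for es
    using m that mid \<open>mid = []\<close> unfolding longest_def by fastforce
  ultimately show ?thesis by blast
qed

end

text \<open>
  Two opposite edges \<open>p\<close> and \<open>u\<close> of the complete graph meet every vertex star in exactly one edge.
  So \<open>{p, u}\<close> colours a \<open>K4\<close> that no further edge touches, and a colouring of the remaining edges,
  which exists by criticality, can be combined with it.
\<close>
theorem symmetric_case:
  assumes crit: "critical EA EB" and fin: "finite EA" "finite EB" and k: "3 \<le> k"
    and card: "\<And>e. e \<in> EA \<Longrightarrow> card e = k" "\<And>e. e \<in> EB \<Longrightarrow> card e = k"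
  shows "\<exists>X w. reaches (EA \<union> EB) (\<lambda>Q. \<exists>es. loose (EA \<union> EB) es \<and> Q = \<Union>(set es)) k k 3 X w \<and> w < 0"
proof (rule ccontr)
  assume "\<not> ?thesis"
  then have nonneg: "\<forall>X w. reaches (EA \<union> EB) (\<lambda>Q. \<exists>es. loose (EA \<union> EB) es \<and> Q = \<Union>(set es)) k k 3 X w \<longrightarrow> 0 \<le> w"
    by force
  have "\<exists>g\<in>EA \<union> EB. e \<inter> g = {v}" if ev: "e \<in> EA \<union> EB" "v \<in> e" for e v
  proof (cases "e \<in> EA")
    case True
    obtain f where "f \<in> EB" "e \<inter> f = {v}" using critical_privateA[OF crit True ev(2)] .
    then show ?thesis by blast
  next
    case False
    then have "e \<in> EB" using ev by blast
    from critical_privateB[OF crit this ev(2)] obtain h where "h \<in> EA" "h \<inter> e = {v}" .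
    then show ?thesis by (metis Int_commute UnCI)
  qed
  then interpret uniform_graph "EA \<union> EB" k
    using fin k card nonneg by unfold_locales auto
  have bad: "\<not> colourable EA EB" using critical_not_colourable[OF crit] .
  have ne: "EA \<union> EB \<noteq> {}"
  proof
    assume "EA \<union> EB = {}"
    then have "colourable EA EB" unfolding colourable_def by blast
    then show False using bad by blast
  qed
  then have k3: "k = 3" using no_edges_if_ge4 k by fastforce
  obtain p q r s t u where K: "K4 p q r s t u" and mx: "\<And>es. loose (EA \<union> EB) es \<Longrightarrow> length es \<le> 2"
    using triples_contain_K4[OF k3 ne] by blast
  define F where "F = {{p, q, r}, {p, s, t}, {q, s, u}, {r, t, u}}"
  define Q where "Q = {p, q, r, s, t, u}"
  have iso: "h \<inter> Q = {}" if "h \<in> EA \<union> EB" "h \<notin> F" for h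
    using K4_isolated[OF k3 K mx that(1)] that(2) unfolding Q_def F_def by metis
  have ds: "distinct [p, q, r, s, t, u]" and "{p, q, r} \<in> EA \<union> EB" using K unfolding K4_def by metis+
  moreover have "{p, q, r} \<in> F" by (simp add: F_def)
  ultimately have "EA - F \<noteq> EA \<or> EB - F \<noteq> EB" by blast
  then have "colourable (EA - F) (EB - F)" by (rule critical_remove[OF crit])
  then obtain R where R: "\<forall>e\<in>EA - F. \<not> e \<subseteq> R" "\<forall>f\<in>EB - F. f \<inter> R \<noteq> {}"
    unfolding colourable_def by blast
  define R' where "R' = {p, u} \<union> (R - Q)"
  have "q \<notin> R'" "s \<notin> R'" "t \<notin> R'" "p \<in> R'" "u \<in> R'" using ds by (auto simp: R'_def Q_def)
  then have F: "\<not> h \<subseteq> R' \<and> h \<inter> R' \<noteq> {}" if "h \<in> F" for h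
    using that unfolding F_def by (elim insertE) simp_all
  have R'Q: "R' - Q \<subseteq> R" "R - Q \<subseteq> R'" unfolding R'_def Q_def by blast+
  have "\<not> e \<subseteq> R'" if "e \<in> EA" for e
  proof (cases "e \<in> F")
    case False
    then have "e \<inter> Q = {}" "\<not> e \<subseteq> R" using iso R(1) that by blast+
    then show ?thesis using R'Q(1) by blast
  qed (use F in blast)
  moreover have "f \<inter> R' \<noteq> {}" if "f \<in> EB" for f
  proof (cases "f \<in> F")
    case False
    then have "f \<inter> Q = {}" "f \<inter> R \<noteq> {}" using iso R(2) that by blast+
    then show ?thesis using R'Q(2) by blast
  qed (use F in blast)
  ultimately have "colourable EA EB" unfolding colourable_def by blast
  then show False using bad by blast
qed

section \<open>Equations of different lengths\<close>

text \<open>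
  A star is an edge \<open>f\<close> of the second kind with an edge \<open>g u\<close> of the first kind at each of its
  points other than \<open>v\<close>. A star whose points other than \<open>v\<close> are all new has weight 0: it
  has \<open>(b - 1) * a\<close> new points and \<open>b\<close> edges, and \<open>beta a b * ((b - 1) * a) = b\<close>.
\<close>
definition fresh_star :: "'v set set \<Rightarrow> 'v set set \<Rightarrow> 'v set \<Rightarrow> 'v \<Rightarrow> 'v set \<Rightarrow> ('v \<Rightarrow> 'v set) \<Rightarrow> bool" where
  "fresh_star EA EB W v f g \<longleftrightarrow> f \<in> EB \<and> f \<inter> W = {v} \<and>
     (\<forall>u\<in>f - {v}. g u \<in> EA \<and> g u \<inter> f = {u} \<and> g u \<inter> W = {}) \<and> disjoint_family_on g (f - {v})"

text \<open>
  The path is continued at a point of one of the edges of the first kind of its last star, which is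
  recorded as the last argument.
\<close>
inductive star_path :: "'v set set \<Rightarrow> 'v set set \<Rightarrow> nat \<Rightarrow> 'v set \<Rightarrow> 'v set \<Rightarrow> bool" for EA EB where
  start: "e \<in> EA \<Longrightarrow> star_path EA EB 0 e e"
| step: "star_path EA EB j W e \<Longrightarrow> v \<in> e \<Longrightarrow> fresh_star EA EB W v f g \<Longrightarrow> u \<in> f - {v} \<Longrightarrow>
    star_path EA EB (Suc j) (W \<union> \<Union>(g ` (f - {v}))) (g u)"

lemma star_path_mono:
  assumes "star_path EA EB j W e" "EA \<subseteq> EA'" "EB \<subseteq> EB'"
  shows "star_path EA' EB' j W e"
  using assms(1)
proof induction
  case (start e)
  then show ?case using assms(2) by (blast intro: star_path.start)
next
  case (step j W e v f g u)
  have "fresh_star EA' EB' W v f g"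
  proof -
    have "f \<in> EB'" using step.hyps(3) assms(3) unfolding fresh_star_def by (meson subsetD)
    moreover have "\<forall>u\<in>f - {v}. g u \<in> EA'" using step.hyps(3) assms(2) unfolding fresh_star_def by (meson subsetD)
    ultimately show ?thesis using step.hyps(3) unfolding fresh_star_def by simp
  qed
  then show ?case using star_path.step step by metis
qed

lemma star_path_sub: "star_path EA EB j W e \<Longrightarrow> W \<subseteq> \<Union>EA \<and> e \<in> EA"
proof (induction rule: star_path.induct)
  case (step j W e v f g u)
  then have "\<forall>u\<in>f - {v}. g u \<in> EA" unfolding fresh_star_def by blast
  then show ?case using step by blast
qed auto

lemma growing_map:
  assumes "distinct us" "\<And>u. u \<in> set us \<Longrightarrow> g u \<in> E \<and> u \<in> g u \<and> u \<notin> X"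
    "\<And>u u'. u \<in> set us \<Longrightarrow> u' \<in> set us \<Longrightarrow> u \<noteq> u' \<Longrightarrow> u \<notin> g u'"
  shows "growing E X (map g us)"
  using assms
proof (induction us arbitrary: X)
  case (Cons a us)
  have "growing E (X \<union> g a) (map g us)"
  proof (rule Cons.IH)
    show "distinct us" using Cons.prems(1) by simp
    show "g u \<in> E \<and> u \<in> g u \<and> u \<notin> X \<union> g a" if "u \<in> set us" for u
      using that Cons.prems(1) Cons.prems(2)[of u] Cons.prems(3)[of u a] by auto
    show "u \<notin> g u'" if "u \<in> set us" "u' \<in> set us" "u \<noteq> u'" for u u'
      using that Cons.prems(3)[of u u'] by simp
  qed
  then show ?case using Cons.prems(2)[of a] by auto
qed auto

lemma card_UN_const_le:
  assumes "finite U" "\<And>u. u \<in> U \<Longrightarrow> card (g u) \<le> a"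
  shows "card (\<Union>(g ` U)) \<le> card U * a"
  by (rule order_trans[OF card_UN_le[OF assms(1)]]) (use sum_bounded_above[of U "\<lambda>u. card (g u)" a] assms in simp)

text \<open>
  The case of different lengths. The strict inequality \<open>\<alpha> < \<beta>\<close> is what it gains over
  the symmetric one; the last assumption is the one to be refuted.
\<close>
locale star_graph =
  fixes EA EB :: "'v set set" and a b :: nat
  assumes finAB: "finite EA" "finite EB" and a3: "3 \<le> a" and ab: "a < b"
    and cardA: "\<And>e. e \<in> EA \<Longrightarrow> card e = a" and cardB: "\<And>e. e \<in> EB \<Longrightarrow> card e = b"
    and loneA: "\<And>e v. e \<in> EA \<Longrightarrow> v \<in> e \<Longrightarrow> \<exists>f\<in>EB. e \<inter> f = {v}"
    and loneB: "\<And>f u. f \<in> EB \<Longrightarrow> u \<in> f \<Longrightarrow> \<exists>e\<in>EA. e \<inter> f = {u}"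
    and nonneg: "\<forall>X w. reaches (EA \<union> EB) (\<lambda>Q. \<exists>j e. star_path EA EB j Q e) a b (3 * b) X w \<longrightarrow> 0 \<le> w"
begin

abbreviation "E \<equiv> EA \<union> EB"
abbreviation "\<alpha> \<equiv> alpha b"
abbreviation "\<beta> \<equiv> beta a b"
abbreviation "rch \<equiv> reaches E (\<lambda>Q. \<exists>j e. star_path EA EB j Q e) a b"

lemma finE: "e \<in> E \<Longrightarrow> finite e"
  using cardA cardB a3 ab by (metis Un_iff card.infinite not_numeral_le_zero not_less_zero)

lemma finA: "e \<in> EA \<Longrightarrow> finite e" and finB: "e \<in> EB \<Longrightarrow> finite e" using finE by auto

lemma \<beta>_a: "\<beta> * a = 1 + \<alpha>" and \<alpha>_b: "\<alpha> * b = 1 + \<alpha>" and \<alpha>_pos: "0 < \<alpha>" and \<alpha>_le: "\<alpha> \<le> 1/3"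
  using a3 ab by (auto simp: alpha_def beta_def field_simps)

lemma \<alpha>_less_\<beta>: "\<alpha> < \<beta>"
proof -
  have "\<alpha> * a < \<alpha> * b" using \<alpha>_pos ab by simp
  then have "\<alpha> * a < \<beta> * a" using \<beta>_a \<alpha>_b by simp
  then show ?thesis using a3 by simp
qed

lemma \<alpha>\<beta>_less: "\<alpha> + \<beta> < 1"
proof -
  have "\<beta> * 3 \<le> \<beta> * a" using \<alpha>_less_\<beta> \<alpha>_pos a3 by (intro mult_left_mono) auto
  then show ?thesis using \<beta>_a \<alpha>_le by linarith
qed

lemma \<beta>_mult: "\<beta> * real (m * a) = m + m * \<alpha>"
proof -
  have "\<beta> * real (m * a) = m * (\<beta> * a)" by simp
  then show ?thesis unfolding \<beta>_a by (simp add: algebra_simps)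
qed

lemma \<alpha>_mult: "r + c \<le> b \<Longrightarrow> r * \<alpha> \<le> 1 + \<alpha> - c * \<alpha>"
proof -
  assume "r + c \<le> b"
  then have "real r + real c \<le> real b" by simp
  then have "(real r + real c) * \<alpha> \<le> real b * \<alpha>" using \<alpha>_pos by (intro mult_right_mono) auto
  then show ?thesis using \<alpha>_b by (simp add: algebra_simps)
qed

lemma length_le:
  assumes "rch s X w" "growing E X hs" "s + length hs \<le> 3 * b" "card (\<Union>(set hs) - X) \<le> N"
  shows "length hs \<le> w + \<beta> * N"
  by (rule growing_length_le[OF nonneg assms(1,2) finE assms(3,4)]) (use a3 ab in auto)

text \<open>
  A star at the points of \<open>f\<close> outside \<open>V\<close>, which may meet \<open>V\<close> and overlap itself. Since
  \<open>g u\<close> meets \<open>f\<close> only in \<open>u\<close>, the members \<open>g u\<close> can be added to \<open>V\<close> in any order, and each of them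
  contributes at least \<open>u\<close>.
\<close>
definition fan where
  "fan V f g \<longleftrightarrow> f \<in> EB \<and> (\<forall>u\<in>f - V. g u \<in> EA \<and> g u \<inter> f = {u})"

lemma fanD: assumes "fan V f g" "u \<in> f - V"
  shows "g u \<in> EA" "g u \<inter> f = {u}" "u \<in> g u" "finite (g u)" "card (g u) = a"
  using assms finA cardA unfolding fan_def by auto

lemma fan_apart: assumes "fan V f g" "u \<in> f - V" "u' \<in> f - V" "u \<noteq> u'" shows "u \<notin> g u'"
  using fanD(2)[OF assms(1,3)] assms(2,4) by blast

lemma fan_fin: assumes "fan V f g" shows "finite (f - V)"
  using assms finB unfolding fan_def by auto

lemma fan_growing:
  assumes "fan V f g" "X \<subseteq> V" "distinct us" "set us \<subseteq> f - V"
  shows "growing E X (map g us)"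
proof (rule growing_map[OF assms(3)])
  fix u assume u: "u \<in> set us"
  then have "u \<in> f - V" using assms(4) by blast
  then show "g u \<in> E \<and> u \<in> g u \<and> u \<notin> X" using fanD(1,3)[OF assms(1)] assms(2) by blast
next
  fix u u' assume "u \<in> set us" "u' \<in> set us" "u \<noteq> u'"
  then have "u \<in> f - V" "u' \<in> f - V" "u \<noteq> u'" using assms(4) by blast+
  then show "u \<notin> g u'" using fanD(2)[OF assms(1)] by blast
qed

lemma fan_single:
  assumes "rch s V w" "s + 1 \<le> 3 * b" "fan V f g" "u \<in> f - V" "card (g u - V) \<le> N"
  shows "1 \<le> w + \<beta> * N"
proof -
  have "growing E V [g u]" using fan_growing[OF assms(3) order_refl, of "[u]"] assms(4) by simp
  then show ?thesis using length_le[OF assms(1), of "[g u]" N] assms by simp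
qed

text \<open>
  Once a member is left out, its point \<open>u\<close> on \<open>f\<close> is new for \<open>f\<close>, so that \<open>f\<close> counts.
\<close>
lemma fan_drop:
  assumes r: "rch s V w" "fan V f g" and u: "u \<in> f - V" and s: "s + card (f - V) \<le> 3 * b"
    and N: "card (\<Union>(g ` (f - V - {u})) - V) \<le> N"
  shows "card (f - V) \<le> w + \<beta> * (N + 1)"
proof -
  have fin: "finite (f - V)" using fan_fin r by blast
  obtain us where us: "set us = f - V - {u}" "distinct us"
    using finite_distinct_list[of "f - V - {u}"] fin by auto
  have c: "growing E V (map g us)" using fan_growing[OF r(2) order_refl us(2)] us(1) by blast
  have "u \<notin> g u'" if "u' \<in> f - V - {u}" for u' using fan_apart[OF r(2) u, of u'] that by blast
  then have "\<not> f \<subseteq> V \<union> \<Union>(set (map g us))" using u us(1) by auto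
  moreover have "f \<in> E" using r(2) unfolding fan_def by blast
  ultimately have ch: "growing E V (map g us @ [f])" using c by (simp add: growing_append)
  have len: "length (map g us @ [f]) = card (f - V)"
    using us(1) distinct_card[OF us(2)] card.remove[OF fin u] by simp
  have "\<Union>(set (map g us @ [f])) - V \<subseteq> insert u (\<Union>(g ` (f - V - {u})) - V)"
  proof
    fix x assume x: "x \<in> \<Union>(set (map g us @ [f])) - V"
    show "x \<in> insert u (\<Union>(g ` (f - V - {u})) - V)"
    proof (cases "x \<in> f")
      case True
      then show ?thesis using x fanD(3)[OF r(2), of x] by auto
    qed (use x us(1) in auto)
  qed
  moreover have "finite (\<Union>(g ` (f - V - {u})) - V)" using fin fanD(4)[OF r(2)] by auto
  ultimately have "card (\<Union>(set (map g us @ [f])) - V) \<le> card (insert u (\<Union>(g ` (f - V - {u})) - V))"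
    by (intro card_mono) auto
  also have "\<dots> \<le> N + 1" using N \<open>finite (\<Union>(g ` (f - V - {u})) - V)\<close> by (simp add: card_insert_if)
  finally have new: "card (\<Union>(set (map g us @ [f])) - V) \<le> N + 1" .
  have "length (map g us @ [f]) \<le> w + \<beta> * real (N + 1)"
    by (rule length_le[OF r(1) ch _ new]) (unfold len, rule s)
  then show ?thesis unfolding len by (simp add: add.commute)
qed

text \<open>
  A member with a new point \<open>y\<close> outside all other members may be added after \<open>f\<close>. Then \<open>f\<close>
  contributes \<open>u\<close>, the member contributes \<open>y\<close>, and all edges of the star count.
\<close>
lemma fan_private:
  assumes r: "rch s V w" "fan V f g" and u: "u \<in> f - V" and s: "s + card (f - V) + 1 \<le> 3 * b"
    and y: "y \<in> g u" "y \<noteq> u" "y \<notin> V" "\<And>u'. u' \<in> f - V - {u} \<Longrightarrow> y \<notin> g u'"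
    and N: "card (\<Union>(g ` (f - V)) - V) \<le> N"
  shows "card (f - V) + 1 \<le> w + \<beta> * N"
proof -
  have fin: "finite (f - V)" using fan_fin r by blast
  obtain us where us: "set us = f - V - {u}" "distinct us"
    using finite_distinct_list[of "f - V - {u}"] fin by auto
  have c: "growing E V (map g us)" using fan_growing[OF r(2) order_refl us(2)] us(1) by blast
  have "u \<notin> g u'" if "u' \<in> f - V - {u}" for u' using fan_apart[OF r(2) u, of u'] that by blast
  then have n1: "\<not> f \<subseteq> V \<union> \<Union>(set (map g us))" using u us(1) by auto
  have "y \<notin> f" using y(1,2) fanD(2)[OF r(2) u] by blast
  then have n2: "\<not> g u \<subseteq> V \<union> \<Union>(set (map g us)) \<union> f" using y us(1) by auto
  have "f \<in> E" using r(2) unfolding fan_def by blast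
  then have ch: "growing E V (map g us @ [f, g u])" using c n1 n2 fanD(1)[OF r(2) u] by (simp add: growing_append Un_assoc)
  have len: "length (map g us @ [f, g u]) = card (f - V) + 1"
    using us(1) distinct_card[OF us(2)] card.remove[OF fin u] by simp
  have sub: "\<Union>(set (map g us @ [f, g u])) - V \<subseteq> \<Union>(g ` (f - V)) - V"
  proof
    fix x assume x: "x \<in> \<Union>(set (map g us @ [f, g u])) - V"
    show "x \<in> \<Union>(g ` (f - V)) - V"
    proof (cases "x \<in> f")
      case True
      then show ?thesis using x fanD(3)[OF r(2), of x] by auto
    qed (use x us(1) u in auto)
  qed
  moreover have "finite (\<Union>(g ` (f - V)) - V)" using fin fanD(4)[OF r(2)] by auto
  ultimately have new: "card (\<Union>(set (map g us @ [f, g u])) - V) \<le> N" using N card_mono order_trans by blast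
  have "length (map g us @ [f, g u]) \<le> w + \<beta> * real N"
    by (rule length_le[OF r(1) ch _ new]) (unfold len, use s in simp)
  then show ?thesis unfolding len by simp
qed

lemma fan_card:
  assumes "fan V f g" "U \<subseteq> f - V" shows "card (\<Union>(g ` U)) \<le> card U * a" "finite (\<Union>(g ` U))"
proof -
  have fU: "finite U" using fan_fin[OF assms(1)] assms(2) finite_subset by blast
  show "card (\<Union>(g ` U)) \<le> card U * a" using card_UN_const_le[OF fU, of g a] fanD(5)[OF assms(1)] assms(2) by fastforce
  show "finite (\<Union>(g ` U))" using fU fanD(4)[OF assms(1)] assms(2) by auto
qed

text \<open>
  Each point of a member that lies in \<open>Z\<close> or in another member is saved in the union.
\<close>
lemma fan_card_less:
  assumes f: "fan V f g" "U \<subseteq> f - V" "u \<in> U" and D: "D \<subseteq> g u" "D \<subseteq> Z \<union> \<Union>(g ` (U - {u}))"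
  shows "card (\<Union>(g ` U) - Z) + card D \<le> card U * a"
proof -
  have fU: "finite U" using fan_fin[OF f(1)] f(2) finite_subset by blast
  have u: "u \<in> f - V" using f by blast
  have "\<Union>(g ` U) - Z \<subseteq> (g u - D) \<union> \<Union>(g ` (U - {u}))" using D f(3) by blast
  moreover have fin2: "finite (\<Union>(g ` (U - {u})))" by (rule fan_card(2)[OF f(1)]) (use f(2) in blast)
  ultimately have "card (\<Union>(g ` U) - Z) \<le> card ((g u - D) \<union> \<Union>(g ` (U - {u})))"
    using fanD(4)[OF f(1) u] by (intro card_mono) auto
  also have "\<dots> \<le> card (g u - D) + card (\<Union>(g ` (U - {u})))" by (rule card_Un_le)
  also have "card (\<Union>(g ` (U - {u}))) \<le> card (U - {u}) * a" by (rule fan_card(1)[OF f(1)]) (use f(2) in blast)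
  also have "card (g u - D) = a - card D" using D fanD(4,5)[OF f(1) u] by (simp add: card_Diff_subset finite_subset)
  finally have "card (\<Union>(g ` U) - Z) \<le> a - card D + card (U - {u}) * a" by simp
  moreover have "card D \<le> a" using card_mono[OF fanD(4)[OF f(1) u] D(1)] fanD(5)[OF f(1) u] by simp
  moreover have "card U = Suc (card (U - {u}))" using f(3) fU by (rule card.remove[rotated])
  ultimately show ?thesis by simp
qed

lemma fan_not_private:
  assumes f: "fan V f g" and np: "\<forall>u\<in>f - V. \<forall>y\<in>g u. y \<noteq> u \<longrightarrow> y \<notin> V \<longrightarrow> (\<exists>u'\<in>f - V - {u}. y \<in> g u')"
    and u: "u \<in> f - V" and D: "card (D \<union> {u}) < a" "finite D" "g u \<inter> V \<subseteq> D"
  obtains y u' where "y \<in> g u" "y \<notin> D" "y \<notin> V" "y \<noteq> u" "u' \<in> f - V - {u}" "y \<in> g u'"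
proof -
  have "card (D \<union> {u}) < card (g u)" using D fanD(5)[OF f u] by simp
  then obtain y where y: "y \<in> g u" "y \<notin> D \<union> {u}" using card_less_obtain[of "D \<union> {u}" "g u"] D(2) by blast
  then have yV: "y \<notin> V" using D(3) by blast
  then obtain u' where "u' \<in> f - V - {u}" "y \<in> g u'" using np u y yV by blast
  then show ?thesis using that y yV by blast
qed

text \<open>
  At weight 0 every loss is fatal. A member that meets \<open>V\<close> costs at least \<open>\<beta> - \<alpha>\<close>.
  Otherwise the whole star would cost \<open>1 - r * \<alpha> > 0\<close> for \<open>r < b - 1\<close> new points of \<open>f\<close>, provided that
  \<open>f\<close> can be counted. If no member has a private point, then the members overlap, and one
  of them can be left out to make \<open>f\<close> count.
\<close>
lemma star_at_weight_zero:
  assumes r: "rch s V 0" and s: "s + b \<le> 3 * b" and f: "fan V f g"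
    and pos: "f - V \<noteq> {}" and le: "card (f - V) + 2 \<le> b"
  shows False
proof -
  let ?U = "f - V"
  have fin: "finite ?U" using fan_fin[OF f] .
  have off: "g u \<inter> V = {}" if u: "u \<in> ?U" for u
  proof (rule ccontr)
    assume "g u \<inter> V \<noteq> {}"
    then have "card (g u - V) < card (g u)" using fanD(4)[OF f u] by (intro psubset_card_mono) blast+
    then have "card (g u - V) \<le> a - 1" using fanD(5)[OF f u] by simp
    then have "1 \<le> 0 + \<beta> * real (a - 1)" using fan_single[OF r _ f u] s ab by auto
    moreover have "\<beta> * real (a - 1) = 1 + \<alpha> - \<beta>" using \<beta>_a a3 by (simp add: of_nat_diff algebra_simps)
    ultimately show False using \<alpha>_less_\<beta> by linarith
  qed
  \<comment> \<open>Otherwise \<open>y\<close> is a private point of \<open>g u\<close> and the whole star counts.\<close>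
  have np: "\<exists>u'\<in>?U - {u}. y \<in> g u'" if "u \<in> ?U" "y \<in> g u" "y \<noteq> u" "y \<notin> V" for u y
  proof (rule ccontr)
    assume n: "\<not> ?thesis"
    have "card (\<Union>(g ` ?U) - V) \<le> card (\<Union>(g ` ?U))" using fan_card(2)[OF f order_refl] by (intro card_mono) auto
    then have "card (\<Union>(g ` ?U) - V) \<le> card ?U * a" using fan_card(1)[OF f order_refl] by linarith
    then have "card ?U + 1 \<le> 0 + \<beta> * real (card ?U * a)"
      using fan_private[OF r f that(1) _ that(2-4)] n s le by fastforce
    then show False using \<alpha>_mult[OF le] \<alpha>_pos unfolding \<beta>_mult by simp
  qed
  obtain u where u: "u \<in> ?U" using pos by blast
  have npo: "\<forall>u\<in>f - V. \<forall>y\<in>g u. y \<noteq> u \<longrightarrow> y \<notin> V \<longrightarrow> (\<exists>u'\<in>f - V - {u}. y \<in> g u')"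
    using np by blast
  have "card ({} \<union> {u}) < a" "finite {}" "g u \<inter> V \<subseteq> {}" using off[OF u] a3 by auto
  then obtain y u' where y: "y \<in> g u" "y \<noteq> u" "u' \<in> ?U - {u}" "y \<in> g u'"
    using fan_not_private[OF f npo u] by metis
  show False
  proof (cases "?U - {u, u'} = {}")
    case True
    then have U: "?U = {u, u'}" using u y(3) by blast
    then have c: "card ?U = 2" using y(3) by (simp add: card_insert_if)
    have "?U - {u'} = {u}" using U y(3) by blast
    then have "card (\<Union>(g ` (?U - {u'})) - V) \<le> a"
      using fanD(5)[OF f u] card_mono[OF fanD(4)[OF f u], of "g u - V"] by simp
    then have "card ?U \<le> 0 + \<beta> * (a + 1)" using fan_drop[OF r f, of u' a] y(3) s le by (auto simp: add.commute)
    then show False using c \<beta>_a \<alpha>\<beta>_less by (simp add: algebra_simps)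
  next
    case False
    then obtain w where w: "w \<in> ?U" "w \<noteq> u" "w \<noteq> u'" by blast
    have c1: "card (?U - {w}) + 1 = card ?U" using card.remove[OF fin w(1)] by simp
    have "card (\<Union>(g ` (?U - {w})) - V) + card {y} \<le> card (?U - {w}) * a"
      by (rule fan_card_less[OF f, of _ u]) (use u w y in auto)
    then have "card (\<Union>(g ` (?U - {w})) - V) \<le> card (?U - {w}) * a - 1" by simp
    from fan_drop[OF r f w(1) _ this] have "card ?U \<le> 0 + \<beta> * real (card (?U - {w}) * a - 1 + 1)"
      using s le by (simp add: add.commute)
    moreover have "card (?U - {w}) * a - 1 + 1 = card (?U - {w}) * a"
    proof -
      have "u \<in> ?U - {w}" using u w by blast
      then have "0 < card (?U - {w})" using fin by (metis card_gt_0_iff empty_iff finite_Diff)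
      then have "0 < card (?U - {w}) * a" using a3 by simp
      then show ?thesis by simp
    qed
    ultimately have "card ?U \<le> card (?U - {w}) + card (?U - {w}) * \<alpha>" using \<beta>_mult[of "card (?U - {w})"] by (metis add_0)
    moreover have "card (?U - {w}) * \<alpha> \<le> 1 + \<alpha> - real 3 * \<alpha>" using \<alpha>_mult[of "card (?U - {w})" 3] le c1 by simp
    ultimately show False using c1 \<alpha>_pos by linarith
  qed
qed

text \<open>
  Here \<open>e\<close> is a last edge of a path with points \<open>V\<close>, and \<open>X\<close> are the points of the path without \<open>e\<close>.
  If the star at a free point \<open>v\<close> of \<open>e\<close> is not fresh, then it must lose exactly \<open>\<alpha>\<close>:
  any further coincidence makes the weight negative. The only possibility left
  is that \<open>f\<close> has one more point in \<open>V\<close> and that everything else is new and disjoint.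
\<close>
lemma leaf_star:
  assumes r: "rch s X wX" and s: "s + b + 2 \<le> 3 * b" and e: "e \<in> EA" "X \<inter> e \<subseteq> {u0}"
    and wX: "wX + \<beta> * card (e - X) - 1 = \<alpha>" and V: "V = X \<union> e"
    and v: "v \<in> e" "v \<noteq> u0" and f: "fan V f g" "e \<inter> f = {v}" and nf: "\<not> fresh_star EA EB V v f g"
  shows "card (f - V) + 2 = b" "\<And>u. u \<in> f - V \<Longrightarrow> g u \<inter> V = {}" "disjoint_family_on g (f - V)"
proof -
  let ?U = "f - V"
  have fin: "finite ?U" using fan_fin[OF f(1)] .
  have fB: "f \<in> EB" using f unfolding fan_def by blast
  have vX: "v \<notin> X" using e v by blast
  have vf: "v \<in> f" using f by blast
  have Ub: "card ?U + 1 \<le> b"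
  proof -
    have "card ?U \<le> card (f - {v})" using finB[OF fB] v V by (intro card_mono) auto
    then show ?thesis using cardB[OF fB] vf finB[OF fB] ab by simp
  qed
  have "\<Union>(set [e]) - X = e - X" by simp
  moreover have che: "growing E X [e]" using e v vX by auto
  ultimately have rV: "rch (s + 1) V \<alpha>" using reaches_extend[OF r che finE] wX V by simp
  have finl: "finite (e - X)" using finA[OF e(1)] by simp
  have "card {u0, v} < card e" using cardA[OF e(1)] a3 by (simp add: card_insert_if)
  then obtain y0 where y0: "y0 \<in> e" "y0 \<noteq> u0" "y0 \<noteq> v" using card_less_obtain[of "{u0, v}" e] by auto
  have y0X: "y0 \<notin> X" "y0 \<notin> f" using y0 e(2) f(2) by blast+
  \<comment> \<open>Insertion: \<open>f\<close> is added before \<open>e\<close> and contributes \<open>v\<close>, while \<open>y0\<close> keeps \<open>e\<close> counting. So \<open>f\<close> and \<open>e\<close> count although the other points of \<open>f\<close> may all be old.\<close>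
  have inner: "card ?U + 1 \<le> \<alpha> + \<beta> * N" if off: "\<And>u. u \<in> ?U \<Longrightarrow> g u \<inter> V = {}" and N: "card (\<Union>(g ` ?U) - V) \<le> N" for N
  proof -
    obtain us where us: "set us = ?U" "distinct us" using finite_distinct_list[OF fin] by auto
    have c: "growing E X (map g us)" using fan_growing[OF f(1), of X us] us V by blast
    have ug: "x \<notin> \<Union>(g ` ?U)" if "x \<in> V" for x using off that by blast
    have "v \<notin> X \<union> \<Union>(set (map g us))" "y0 \<notin> X \<union> \<Union>(set (map g us)) \<union> f"
      using vX y0X ug[of v] ug[of y0] v(1) y0(1) V us(1) by auto
    then have "\<not> f \<subseteq> X \<union> \<Union>(set (map g us))" "\<not> e \<subseteq> X \<union> \<Union>(set (map g us)) \<union> f"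
      using vf y0(1) by blast+
    then have ch: "growing E X (map g us @ [f, e])" using c fB e(1) by (simp add: growing_append Un_assoc)
    have len: "length (map g us @ [f, e]) = card ?U + 2" using distinct_card[OF us(2)] us(1) by simp
    have "\<Union>(set (map g us @ [f, e])) - X \<subseteq> (e - X) \<union> (\<Union>(g ` ?U) - V)"
    proof
      fix x assume x: "x \<in> \<Union>(set (map g us @ [f, e])) - X"
      show "x \<in> (e - X) \<union> (\<Union>(g ` ?U) - V)"
      proof (cases "x \<in> f \<and> x \<notin> V")
        case True
        then show ?thesis using fanD(3)[OF f(1), of x] by auto
      qed (use x us(1) V in auto)
    qed
    then have "card (\<Union>(set (map g us @ [f, e])) - X) \<le> card ((e - X) \<union> (\<Union>(g ` ?U) - V))"
      using finl fan_card(2)[OF f(1) order_refl] by (intro card_mono) auto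
    also have "\<dots> \<le> card (e - X) + N" using N by (simp add: card_Un_le[THEN order_trans])
    finally have "card ?U + 2 \<le> wX + \<beta> * (card (e - X) + N)"
      using length_le[OF r ch, of "card (e - X) + N"] len s Ub by simp
    then show ?thesis using wX by (simp add: algebra_simps)
  qed
  have U0: "?U \<noteq> {}"
  proof
    assume U: "?U = {}"
    have "card ?U + 1 \<le> \<alpha> + \<beta> * real 0" by (rule inner) (unfold U, simp_all)
    then show False using \<alpha>_le by simp
  qed
  have all_le: "card (\<Union>(g ` ?U) - V) \<le> card ?U * a"
    using fan_card[OF f(1) order_refl] by (meson Diff_subset card_mono order_trans)
  have ra: "card ?U * \<alpha> \<le> 1" using \<alpha>_mult[OF Ub] by simp
  have off: "g u \<inter> V = {}" if u: "u \<in> ?U" for u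
  proof (rule ccontr)
    assume "g u \<inter> V \<noteq> {}"
    then obtain z where z: "z \<in> g u" "z \<in> V" by blast
    have zu: "z \<noteq> u" using z u by blast
    \<comment> \<open>A member with two old points would cost at least \<open>2 * \<beta> - \<alpha>\<close> by itself.\<close>
    have le1: "g u \<inter> V = {z}"
    proof (rule ccontr)
      assume "g u \<inter> V \<noteq> {z}"
      then obtain z' where z': "z' \<in> g u" "z' \<in> V" "z' \<noteq> z" using z by blast
      have "card (g u - V) \<le> card (g u - {z, z'})" using z z' fanD(4)[OF f(1) u] by (intro card_mono) auto
      also have "\<dots> = a - 2" using z z' fanD(4,5)[OF f(1) u] by (simp add: card_Diff_subset)
      finally have "1 \<le> \<alpha> + \<beta> * real (a - 2)" using fan_single[OF rV _ f(1) u] s by simp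
      moreover have "\<beta> * real (a - 2) = 1 + \<alpha> - 2 * \<beta>" using \<beta>_a a3 by (simp add: of_nat_diff algebra_simps)
      ultimately show False using \<alpha>_less_\<beta> by linarith
    qed
    \<comment> \<open>Otherwise the whole star counts, and the old point \<open>z\<close> costs \<open>\<beta>\<close> more.\<close>
    have np: "\<exists>u'\<in>?U - {u1}. y \<in> g u'" if "u1 \<in> ?U" "y \<in> g u1" "y \<noteq> u1" "y \<notin> V" for u1 y
    proof (rule ccontr)
      assume n: "\<not> ?thesis"
      have "card (\<Union>(g ` ?U) - V) + card {z} \<le> card ?U * a"
        by (rule fan_card_less[OF f(1) order_refl u]) (use z in auto)
      then have "card (\<Union>(g ` ?U) - V) \<le> card ?U * a - 1" by simp
      then have "card ?U + 1 \<le> \<alpha> + \<beta> * real (card ?U * a - 1)"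
        using fan_private[OF rV f(1) that(1) _ that(2-4)] n s Ub by fastforce
      moreover have "\<beta> * real (card ?U * a - 1) = \<beta> * real (card ?U * a) - \<beta>"
        using U0 fin a3 by (simp add: of_nat_diff algebra_simps Suc_le_eq card_gt_0_iff)
      ultimately show False using ra \<alpha>_less_\<beta> unfolding \<beta>_mult by simp
    qed
    have npo: "\<forall>u\<in>f - V. \<forall>y\<in>g u. y \<noteq> u \<longrightarrow> y \<notin> V \<longrightarrow> (\<exists>u'\<in>f - V - {u}. y \<in> g u')"
      using np by blast
    have "card ({z} \<union> {u}) < a" "finite {z}" "g u \<inter> V \<subseteq> {z}" using le1 a3 by (auto simp: card_insert_if)
    then obtain y u' where y: "y \<in> g u" "y \<notin> {z}" "y \<noteq> u" "u' \<in> ?U - {u}" "y \<in> g u'"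
      using fan_not_private[OF f(1) npo u] by metis
    then have yz: "y \<noteq> z" by simp
    show False
    proof (cases "?U - {u, u'} = {}")
      case True
      then have U: "?U = {u, u'}" using u y(4) by blast
      then have c: "card ?U = 2" using y(4) by (simp add: card_insert_if)
      have "?U - {u'} = {u}" using U y(4) by blast
      moreover have "card (g u - V) \<le> a - 1"
        using card_Diff_subset_Int[of "g u" V] fanD(5)[OF f(1) u] le1 by simp
      ultimately have "card (\<Union>(g ` (?U - {u'})) - V) \<le> a - 1" by simp
      then have "card ?U \<le> \<alpha> + \<beta> * (real (a - 1) + 1)" using fan_drop[OF rV f(1), of u' "a - 1"] y(4) s Ub by (auto simp: add.commute)
      then show False using c \<beta>_a \<alpha>_le a3 by (simp add: algebra_simps of_nat_diff)
    next
      case False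
      then obtain w where w: "w \<in> ?U" "w \<noteq> u" "w \<noteq> u'" by blast
      \<comment> \<open>The member at \<open>w\<close> is left out, and the two points \<open>y\<close> and \<open>z\<close> are still saved.\<close>
      have c1: "card (?U - {w}) + 1 = card ?U" using card.remove[OF fin w(1)] by simp
      have "card (\<Union>(g ` (?U - {w})) - V) + card {y, z} \<le> card (?U - {w}) * a"
        by (rule fan_card_less[OF f(1), of _ u]) (use u w y z in auto)
      then have n: "card (\<Union>(g ` (?U - {w})) - V) \<le> card (?U - {w}) * a - 2" using yz by simp
      have "card ?U \<le> \<alpha> + \<beta> * (real (card (?U - {w}) * a - 2) + 1)"
        using fan_drop[OF rV f(1) w(1) _ n] s Ub by simp
      moreover have "2 \<le> card (?U - {w}) * a" using \<open>_ + card {y, z} \<le> _\<close> yz by simp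
      then have "\<beta> * (real (card (?U - {w}) * a - 2) + 1) = \<beta> * real (card (?U - {w}) * a) - \<beta>"
        by (simp add: of_nat_diff algebra_simps)
      ultimately have "card ?U \<le> \<alpha> + (card (?U - {w}) + card (?U - {w}) * \<alpha>) - \<beta>" using \<beta>_mult[of "card (?U - {w})"] by linarith
      moreover have "card (?U - {w}) * \<alpha> \<le> 1 + \<alpha> - real 2 * \<alpha>" using \<alpha>_mult[of "card (?U - {w})" 2] Ub c1 by simp
      ultimately show False using c1 \<alpha>_less_\<beta> \<alpha>_pos by linarith
    qed
  qed
  then show "\<And>u. u \<in> f - V \<Longrightarrow> g u \<inter> V = {}" .
  show disj: "disjoint_family_on g (f - V)"
  proof (rule ccontr)
    assume "\<not> ?thesis"
    then obtain u u' y where u: "u \<in> ?U" "u' \<in> ?U" "u \<noteq> u'" "y \<in> g u" "y \<in> g u'"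
      unfolding disjoint_family_on_def by blast
    have "card (\<Union>(g ` ?U) - V) + card {y} \<le> card ?U * a"
      by (rule fan_card_less[OF f(1) order_refl u(1)]) (use u in auto)
    then have "card (\<Union>(g ` ?U) - V) \<le> card ?U * a - 1" by simp
    then have "card ?U + 1 \<le> \<alpha> + \<beta> * real (card ?U * a - 1)" using inner off by blast
    moreover have "\<beta> * real (card ?U * a - 1) = \<beta> * real (card ?U * a) - \<beta>"
      using U0 fin a3 by (simp add: of_nat_diff algebra_simps Suc_le_eq card_gt_0_iff)
    ultimately show False using ra \<alpha>_less_\<beta> unfolding \<beta>_mult by simp
  qed
  have "\<not> card ?U + 3 \<le> b"
  proof
    assume "card ?U + 3 \<le> b"
    from \<alpha>_mult[OF this] inner[OF off all_le] show False using \<alpha>_pos unfolding \<beta>_mult by simp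
  qed
  moreover have "card ?U + 1 \<noteq> b"
  proof
    assume c: "card ?U + 1 = b"
    have "card (f - {v}) = card ?U" using c cardB[OF fB] vf finB[OF fB] by simp
    moreover have "?U \<subseteq> f - {v}" using v V by auto
    ultimately have U: "?U = f - {v}" using finB[OF fB] by (metis card_subset_eq finite_Diff)
    then have "f \<inter> V = {v}" using vf v V by blast
    then have "fresh_star EA EB V v f g"
      unfolding fresh_star_def using fB off disj U fanD(1,2)[OF f(1)] by auto
    then show False using nf by blast
  qed
  ultimately show "card (f - V) + 2 = b" using Ub by linarith
qed

lemma ex_fan: assumes "f \<in> EB" shows "\<exists>g. \<forall>V. fan V f g"
proof -
  have "\<forall>u\<in>f. \<exists>e. e \<in> EA \<and> e \<inter> f = {u}" using loneB[OF assms] by blast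
  then obtain g where "\<forall>u\<in>f. g u \<in> EA \<and> g u \<inter> f = {u}" by (rule bchoice[THEN exE])
  then have "fan V f g" for V unfolding fan_def using assms by blast
  then show ?thesis by blast
qed

lemma card_disjoint_fan:
  assumes f: "fan V f g" "U \<subseteq> f - V" and d: "disjoint_family_on g U"
  shows "card (\<Union>(g ` U)) = card U * a"
proof -
  have fU: "finite U" using fan_fin[OF f(1)] f(2) finite_subset by blast
  have "card (\<Union>(g ` U)) = (\<Sum>u\<in>U. card (g u))"
  proof (rule card_UN_disjoint[OF fU])
    show "\<forall>u\<in>U. finite (g u)" using fanD(4)[OF f(1)] f(2) by blast
    show "\<forall>i\<in>U. \<forall>j\<in>U. i \<noteq> j \<longrightarrow> g i \<inter> g j = {}" using d unfolding disjoint_family_on_def by blast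
  qed
  also have "\<dots> = (\<Sum>u\<in>U. a)" using fanD(5)[OF f(1)] f(2) by (intro sum.cong) auto
  finally show ?thesis by simp
qed

text \<open>
  A longest path of stars ends with \<open>b - 1\<close> free edges of the first kind. The star at a point
  \<open>v1\<close> of one of them is not fresh and, by \<open>leaf_star\<close>, brings the weight down to exactly 0; its edge
  \<open>f1\<close> meets the path in one further point \<open>z\<close>. Since \<open>b - 1 \<ge> 3\<close>, there is another free edge
  that avoids \<open>z\<close>. The star at one of its points loses weight once more, even if it
  has no new points at all, and this is impossible.
\<close>
lemma no_edges: assumes ne: "EA \<noteq> {}" shows False
proof -
  let ?P = "\<lambda>j. \<exists>W e. star_path EA EB j W e"
  have finU: "finite (\<Union>EA)" using finAB finA by blast
  have grow: "j \<le> card W" if "star_path EA EB j W e" for j W e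
    using that
  proof induction
    case (step j W e v f g u)
    have "g u \<inter> W = {}" "g u \<inter> f = {u}" using step.hyps(3,4) unfolding fresh_star_def by blast+
    then have "u \<in> g u" "u \<notin> W" by blast+
    then have "W \<subset> W \<union> \<Union>(g ` (f - {v}))" using step.hyps(4) by blast
    moreover have "finite (W \<union> \<Union>(g ` (f - {v})))"
      using star_path_sub[OF star_path.step[OF step.hyps]] finU finite_subset by blast
    ultimately have "card W < card (W \<union> \<Union>(g ` (f - {v})))" by (rule psubset_card_mono[rotated])
    then show ?case using step.IH by linarith
  qed simp
  have P0: "?P 0" using ne star_path.start by blast
  have bdd: "j < Suc (card (\<Union>EA))" if "?P j" for j
    using that grow card_mono[OF finU] star_path_sub by (meson le_imp_less_Suc order_trans)
  obtain j where j: "?P j" and mx: "\<And>i. ?P i \<Longrightarrow> i \<le> j"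
    using ex_has_greatest_nat[of ?P 0 "\<lambda>j. j"] P0 bdd by blast
  have nf: "\<not> fresh_star EA EB W v f g" if "star_path EA EB j W e" "v \<in> e" for W e v f g
  proof
    assume fs: "fresh_star EA EB W v f g"
    have "f \<in> EB" using fs unfolding fresh_star_def by blast
    then have "card {v} < card f" using cardB a3 ab by simp
    then obtain u where "u \<in> f - {v}" using card_less_obtain[of "{v}" f] by auto
    then have "?P (Suc j)" using star_path.step[OF that fs] by blast
    then show False using mx by fastforce
  qed
  obtain W e where We: "star_path EA EB j W e" using j by blast
  from We show False
  proof cases
    case start
    have eA: "e \<in> EA" and We: "star_path EA EB j e e" using start We by simp_all
    have "card ({} :: 'v set) < card e" using cardA[OF eA] a3 by simp
    then obtain u0 where u0: "u0 \<in> e" using card_less_obtain[of "{}" e] by auto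
    have "card {u0} < card e" using cardA[OF eA] a3 by simp
    then obtain v where v: "v \<in> e" "v \<noteq> u0" using card_less_obtain[of "{u0}" e] by auto
    obtain f where f: "f \<in> EB" "e \<inter> f = {v}" using loneA[OF eA v(1)] by blast
    obtain g where g: "\<And>V. fan V f g" using ex_fan[OF f(1)] by blast
    have "card (f - e) + 2 = b"
    proof (rule leaf_star(1))
      show "rch 0 {} 0" by (rule reaches_empty)
      show "0 + \<beta> * real (card (e - {})) - 1 = \<alpha>" using cardA[OF eA] \<beta>_a by simp
      show "\<not> fresh_star EA EB e v f g" using nf[OF We v(1)] .
      show "0 + b + 2 \<le> 3 * b" using a3 ab by simp
      show "e \<in> EA" "{} \<inter> e \<subseteq> {u0}" "e = {} \<union> e" "v \<in> e" "v \<noteq> u0" "fan e f g" "e \<inter> f = {v}"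
        using eA v f g by simp_all
    qed
    moreover have "f - e = f - {v}" "v \<in> f" using f by blast+
    ultimately show False using cardB[OF f(1)] finB[OF f(1)] ab by simp
  next
    case (step i W0 e0 v0 f0 g0 u0)
    let ?U0 = "f0 - {v0}"
    have fs: "f0 \<in> EB" "f0 \<inter> W0 = {v0}" "disjoint_family_on g0 ?U0"
      and gs: "\<And>u. u \<in> ?U0 \<Longrightarrow> g0 u \<in> EA \<and> g0 u \<inter> f0 = {u} \<and> g0 u \<inter> W0 = {}"
      using step(6) unfolding fresh_star_def by blast+
    have U0: "f0 - W0 = ?U0" using fs(2) by blast
    have fan0: "fan W0 f0 g0" unfolding fan_def U0 using fs(1) gs by blast
    have finU0: "finite ?U0" using finB[OF fs(1)] by simp
    have cU0: "card ?U0 + 1 = b" using cardB[OF fs(1)] finB[OF fs(1)] fs(2) ab by (metis Int_insert_left_if1 Suc_eq_plus1 card_Suc_Diff1 inf_le1 insert_subset)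
    have Wst: "star_path EA EB j W (g0 u)" if "u \<in> ?U0" for u
      using star_path.step[OF step(4,5,6) that] step(1,2) by simp
    have rch0: "rch 0 W0 \<alpha>" using reaches_state step(4) by (metis (mono_tags, lifting))
    \<comment> \<open>The path without the free edge at \<open>u\<close>; of this edge it keeps the point \<open>u\<close>, which \<open>f0\<close> contributes.\<close>
    define X where "X u = W0 \<union> \<Union>(g0 ` (?U0 - {u})) \<union> f0" for u
    define wX where "wX u = \<alpha> + 1 - \<beta> * card (g0 u - X u)" for u
    have WX: "W = X u \<union> g0 u" if u: "u \<in> ?U0" for u
    proof -
      have "f0 \<subseteq> W"
      proof
        fix x assume "x \<in> f0"
        then show "x \<in> W" using fs(2) fanD(3)[OF fan0, of x] U0 step(2) by (cases "x = v0") auto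
      qed
      then show ?thesis unfolding X_def using step(2) u by blast
    qed
    have Xe: "X u \<inter> g0 u = {u}" if u: "u \<in> ?U0" for u
    proof -
      have "g0 u \<inter> g0 u' = {}" if "u' \<in> ?U0 - {u}" for u'
        using fs(3) that u unfolding disjoint_family_on_def by blast
      then show ?thesis unfolding X_def using gs[OF u] by blast
    qed
    have finWW: "finite (\<Union>(g0 ` ?U0))" using fan_card(2)[OF fan0] U0 by simp
    have Xr: "rch (b - 1) (X u) (wX u)" if u: "u \<in> ?U0" for u
    proof -
      obtain us where us: "set us = ?U0 - {u}" "distinct us" using finite_distinct_list[of "?U0 - {u}"] finU0 by auto
      have c: "growing E W0 (map g0 us)" using fan_growing[OF fan0 order_refl us(2)] us(1) U0 by blast
      have "u \<notin> \<Union>(set (map g0 us))" using fan_apart[OF fan0] U0 us(1) u by auto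
      moreover have "u \<notin> W0" "u \<in> f0" using u U0 by blast+
      ultimately have "\<not> f0 \<subseteq> W0 \<union> \<Union>(set (map g0 us))" by blast
      then have ch: "growing E W0 (map g0 us @ [f0])" using c fs(1) by (simp add: growing_append)
      have "length us + 1 = card ?U0" using us(1) distinct_card[OF us(2)] card.remove[OF finU0 u] by simp
      then have len: "length (map g0 us @ [f0]) = b - 1" using cU0 by simp
      have XX: "W0 \<union> \<Union>(set (map g0 us @ [f0])) = X u" using us(1) unfolding X_def by auto
      have new: "\<Union>(set (map g0 us @ [f0])) - W0 = X u - W0" using XX by auto
      have "\<Union>(g0 ` ?U0) = (X u - W0) \<union> (g0 u - X u)"
      proof -
        have "\<Union>(g0 ` ?U0) \<inter> W0 = {}" using gs by blast
        then have "\<Union>(g0 ` ?U0) = W - W0" using step(2) by blast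
        then show ?thesis using WX[OF u] gs[OF u] by blast
      qed
      then have "card (\<Union>(g0 ` ?U0)) = card (X u - W0) + card (g0 u - X u)"
        using finWW by (subst card_Un_disjoint[symmetric]) auto
      then have "card (X u - W0) + card (g0 u - X u) = card ?U0 * a"
        using card_disjoint_fan[OF fan0 _ fs(3)] U0 by simp
      then have "\<beta> * card (X u - W0) + \<beta> * card (g0 u - X u) = card ?U0 + card ?U0 * \<alpha>"
        using \<beta>_mult[of "card ?U0"] by (metis distrib_left of_nat_add)
      moreover have "real (card ?U0) + 1 = b" using cU0 by (metis of_nat_1 of_nat_add)
      moreover have "card ?U0 * \<alpha> = 1"
        using \<alpha>_b calculation(2) by (metis add_right_cancel distrib_left mult.commute mult.right_neutral)
      ultimately have "\<alpha> + \<beta> * card (X u - W0) - real (b - 1) = wX u"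
        using cU0 unfolding wX_def by linarith
      moreover have "rch (b - 1) (X u) (\<alpha> + \<beta> * card (X u - W0) - real (b - 1))"
        using reaches_extend[OF rch0 ch finE] unfolding XX new len by simp
      ultimately show ?thesis by simp
    qed
    have leaf: "card (f - W) + 2 = b \<and> (\<forall>u\<in>f - W. g u \<inter> W = {}) \<and> disjoint_family_on g (f - W)"
      if u: "u \<in> ?U0" and v: "v \<in> g0 u" "v \<noteq> u" and f: "fan W f g" "g0 u \<inter> f = {v}" for u v f g
    proof -
      have s: "b - 1 + b + 2 \<le> 3 * b" using ab a3 by simp
      have gA: "g0 u \<in> EA" using gs u by blast
      have "wX u + \<beta> * card (g0 u - X u) - 1 = \<alpha>" unfolding wX_def by simp
      note L = leaf_star[OF Xr[OF u] s gA equalityD1[OF Xe[OF u]] this WX[OF u] v f nf[OF Wst[OF u] v(1)]]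
      show ?thesis using L(1,3) by (intro conjI ballI L(2))
    qed
    obtain u1 where u1: "u1 \<in> ?U0" using step(7) by blast
    have g1A: "g0 u1 \<in> EA" using gs u1 by blast
    have "card {u1} < card (g0 u1)" using cardA[OF g1A] a3 by simp
    then obtain v1 where v1: "v1 \<in> g0 u1" "v1 \<noteq> u1" using card_less_obtain[of "{u1}" "g0 u1"] by auto
    obtain f1 where f1: "f1 \<in> EB" "g0 u1 \<inter> f1 = {v1}" using loneA[OF g1A v1(1)] by blast
    obtain g1 where fan1: "\<And>V. fan V f1 g1" using ex_fan[OF f1(1)] by blast
    let ?U1 = "f1 - W"
    have L1: "card ?U1 + 2 = b" "\<And>u. u \<in> ?U1 \<Longrightarrow> g1 u \<inter> W = {}" "disjoint_family_on g1 ?U1"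
      using leaf[OF u1 v1 fan1 f1(2)] by blast+
    have v1W: "v1 \<in> W" "v1 \<in> f1" using WX[OF u1] v1 f1 by blast+
    have "card (f1 \<inter> W) + card ?U1 = b" using cardB[OF f1(1)] finB[OF f1(1)]
      by (metis card_Diff_subset_Int card_mono finite_Int inf_le1 le_add_diff_inverse)
    then have "card (f1 \<inter> W) = 2" using L1(1) by simp
    then obtain z1 z2 where z12: "f1 \<inter> W = {z1, z2}" by (metis card_2_iff)
    moreover have "v1 \<in> f1 \<inter> W" using v1W by blast
    ultimately have "v1 = z1 \<or> v1 = z2" by simp
    then obtain z where z: "f1 \<inter> W = {v1, z}"
    proof
      assume "v1 = z1"
      then show thesis using that[of z2] z12 by simp
    next
      assume "v1 = z2"
      then show thesis using that[of z1] z12 by (simp add: insert_commute)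
    qed
    obtain u2 where u2: "u2 \<in> ?U0" "u2 \<noteq> u1" "z \<notin> g0 u2"
    proof (cases "\<exists>u3\<in>?U0. z \<in> g0 u3")
      case True
      then obtain u3 where u3: "u3 \<in> ?U0" "z \<in> g0 u3" by blast
      have "card {u1, u3} < card ?U0" using cU0 ab a3 by (simp add: card_insert_if)
      then obtain u2 where u2: "u2 \<in> ?U0" "u2 \<noteq> u1" "u2 \<noteq> u3" using card_less_obtain[of "{u1, u3}" ?U0] by auto
      then have "g0 u2 \<inter> g0 u3 = {}" using fs(3) u3(1) unfolding disjoint_family_on_def by blast
      then show ?thesis using that u2 u3 by blast
    next
      case False
      have "card {u1} < card ?U0" using cU0 ab a3 by simp
      then obtain u2 where "u2 \<in> ?U0" "u2 \<noteq> u1" using card_less_obtain[of "{u1}" ?U0] by auto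
      then show ?thesis using that False by blast
    qed
    let ?e2 = "g0 u2"
    have g2A: "?e2 \<in> EA" using gs u2 by blast
    have "card {u2} < card ?e2" using cardA[OF g2A] a3 by simp
    then obtain v2 where v2: "v2 \<in> ?e2" "v2 \<noteq> u2" using card_less_obtain[of "{u2}" ?e2] by auto
    obtain f2 where f2: "f2 \<in> EB" "?e2 \<inter> f2 = {v2}" using loneA[OF g2A v2(1)] by blast
    obtain g2 where fan2: "\<And>V. fan V f2 g2" using ex_fan[OF f2(1)] by blast
    have L2: "card (f2 - W) + 2 = b" using leaf[OF u2(1) v2 fan2 f2(2)] by blast
    have e2W: "?e2 \<subseteq> W" using WX[OF u2(1)] by blast
    have e2f1: "x \<notin> f1" if x: "x \<in> ?e2" for x
    proof
      assume "x \<in> f1"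
      then have "x = v1 \<or> x = z" using z x e2W by blast
      moreover have "?e2 \<inter> g0 u1 = {}" using fs(3) u1 u2 unfolding disjoint_family_on_def by blast
      ultimately show False using v1 u2(3) x by blast
    qed
    have fin1: "finite ?U1" using finB[OF f1(1)] by simp
    have "card ?U1 \<noteq> 0" using L1(1) ab a3 by simp
    then obtain u' where u': "u' \<in> ?U1" by (metis card.empty ex_in_conv)
    obtain us where us: "set us = ?U1 - {u'}" "distinct us" using finite_distinct_list[of "?U1 - {u'}"] fin1 by auto
    have len_us: "length us + 1 = card ?U1" using us(1) distinct_card[OF us(2)] card.remove[OF fin1 u'] by simp
    have card1: "card (\<Union>(g1 ` ?U1)) = card ?U1 * a" using card_disjoint_fan[OF fan1 order_refl L1(3)] .
    have fin1': "finite (\<Union>(g1 ` ?U1))" using fan_card(2)[OF fan1 order_refl] .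
    \<comment> \<open>This is \<open>(b - 2) * (1 + \<alpha>)\<close>.\<close>
    have bc: "\<beta> * card (\<Union>(g1 ` ?U1)) = real b - 1 - \<alpha>"
    proof -
      have "real (card ?U1) + 2 = b" using L1(1) by (metis of_nat_add of_nat_numeral)
      then have c: "real (card ?U1) = real b - 2" by simp
      have "real (card ?U1) * \<alpha> = 1 - \<alpha>" unfolding c using \<alpha>_b by (simp add: algebra_simps)
      then show ?thesis unfolding card1 \<beta>_mult using c by simp
    qed
    have cov: "\<Union>(set (map g1 us @ [f1, g1 u'])) = f1 \<union> \<Union>(g1 ` ?U1)" using us(1) u' by auto
    have f1cov: "f1 \<subseteq> (f1 \<inter> W) \<union> \<Union>(g1 ` ?U1)" using fanD(3)[OF fan1, of _ W] by blast
    have off1: "x \<notin> \<Union>(g1 ` ?U1)" if "x \<in> W" for x using that L1(2) by blast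
    \<comment> \<open>The star at \<open>v1\<close> counts completely whether it is added to the whole path or to the path without another free edge.\<close>
    have mid: "growing E Z (map g1 us @ [f1, g1 u'])" if Z: "Z \<subseteq> W" for Z
    proof -
      have c: "growing E Z (map g1 us)" using fan_growing[OF fan1 Z us(2)] us(1) by blast
      have "u' \<notin> \<Union>(set (map g1 us))" using fan_apart[OF fan1 u'] us(1) by auto
      then have n1: "\<not> f1 \<subseteq> Z \<union> \<Union>(set (map g1 us))" using u' Z by blast
      have gu: "card {u'} < card (g1 u')" using fanD(5)[OF fan1 u'] a3 by simp
      then obtain y where y: "y \<in> g1 u'" "y \<noteq> u'" using card_less_obtain[of "{u'}" "g1 u'"] by auto
      have "y \<notin> f1" using fanD(2)[OF fan1 u'] y by blast
      moreover have "y \<notin> Z" using y u' Z L1(2) by blast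
      moreover have "y \<notin> g1 u" if "u \<in> ?U1 - {u'}" for u
        using L1(3) y(1) u' that unfolding disjoint_family_on_def by blast
      ultimately have "y \<notin> Z \<union> \<Union>(set (map g1 us)) \<union> f1" using us(1) by auto
      then have "\<not> g1 u' \<subseteq> Z \<union> \<Union>(set (map g1 us)) \<union> f1" using y(1) by blast
      then show ?thesis using c n1 f1(1) fanD(1)[OF fan1 u'] by (simp add: growing_append Un_assoc)
    qed
    define V1 where "V1 = W \<union> \<Union>(g1 ` ?U1)"
    have V1: "W \<union> \<Union>(set (map g1 us @ [f1, g1 u'])) = V1"
      unfolding V1_def cov using f1cov by blast
    have len: "length (map g1 us @ [f1, g1 u']) = b - 1" using len_us L1(1) by simp
    have new1: "\<Union>(set (map g1 us @ [f1, g1 u'])) - W = \<Union>(g1 ` ?U1)"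
      unfolding cov using f1cov off1 by blast
    have rW: "rch 0 W \<alpha>" using reaches_state We by (metis (mono_tags, lifting))
    have "rch (0 + (b - 1)) V1 (\<alpha> + \<beta> * card (\<Union>(g1 ` ?U1)) - real (b - 1))"
      using reaches_extend[OF rW mid[OF order_refl] finE] unfolding V1 len new1 .
    moreover have "\<alpha> + \<beta> * card (\<Union>(g1 ` ?U1)) - real (b - 1) = 0" unfolding bc using ab by (simp add: of_nat_diff)
    ultimately have rV1: "rch (b - 1) V1 0" by simp
    show False
    proof (cases "f2 \<subseteq> V1")
      case False
      have "card (f2 - V1) \<le> card (f2 - W)" using finB[OF f2(1)] unfolding V1_def by (intro card_mono) auto
      then have le: "card (f2 - V1) + 2 \<le> b" using L2 by simp
      show False by (rule star_at_weight_zero[OF rV1 _ fan2 _ le]) (use False ab in simp_all)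
    next
      case True
      let ?hs = "map g1 us @ [f1, g1 u']" and ?X = "X u2"
      have XW: "?X \<subseteq> W" using WX[OF u2(1)] by blast
      have "card {u2, v2} < card ?e2" using cardA[OF g2A] a3 by (simp add: card_insert_if)
      then obtain y where y: "y \<in> ?e2" "y \<noteq> u2" "y \<noteq> v2" using card_less_obtain[of "{u2, v2}" ?e2] by auto
      \<comment> \<open>The free points of the second edge are untouched by the star at \<open>v1\<close>, so the second edge can come last, after \<open>f2\<close>.\<close>
      have e2X: "x \<notin> ?X \<union> \<Union>(set ?hs)" if x: "x \<in> ?e2" "x \<noteq> u2" for x
        unfolding cov using Xe[OF u2(1)] x e2f1[OF x(1)] off1[of x] e2W by blast
      have v2f: "v2 \<in> f2" using f2(2) by blast
      have "y \<notin> f2" using f2(2) y by blast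
      then have "\<not> f2 \<subseteq> ?X \<union> \<Union>(set ?hs)" "\<not> ?e2 \<subseteq> ?X \<union> \<Union>(set ?hs) \<union> f2"
        using e2X[OF v2] e2X[OF y(1,2)] v2f y(1) by blast+
      then have c2: "growing E (?X \<union> \<Union>(set ?hs)) [f2, ?e2]" using f2(1) g2A by simp
      have ch: "growing E ?X (?hs @ [f2, ?e2])" by (subst growing_append) (use mid[OF XW] c2 in blast)
      have "\<Union>(set (?hs @ [f2, ?e2])) - ?X \<subseteq> (?e2 - ?X) \<union> \<Union>(g1 ` ?U1)"
      proof -
        have "\<Union>(set (?hs @ [f2, ?e2])) = (f1 \<union> \<Union>(g1 ` ?U1)) \<union> (f2 \<union> ?e2)"
          unfolding cov[symmetric] by auto
        moreover have "W = ?X \<union> ?e2" using WX[OF u2(1)] .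
        moreover have "f1 \<subseteq> W \<union> \<Union>(g1 ` ?U1)" using f1cov by blast
        moreover have "f2 \<subseteq> W \<union> \<Union>(g1 ` ?U1)" using True V1_def by simp
        ultimately show ?thesis by blast
      qed
      then have "card (\<Union>(set (?hs @ [f2, ?e2])) - ?X) \<le> card ((?e2 - ?X) \<union> \<Union>(g1 ` ?U1))"
        using finA[OF g2A] fin1' by (intro card_mono) auto
      also have "\<dots> \<le> card (?e2 - ?X) + card (\<Union>(g1 ` ?U1))" by (rule card_Un_le)
      finally have new: "card (\<Union>(set (?hs @ [f2, ?e2])) - ?X) \<le> card (?e2 - ?X) + card (\<Union>(g1 ` ?U1))" .
      have len2: "length (?hs @ [f2, ?e2]) = b + 1" using len ab by simp
      have "length (?hs @ [f2, ?e2]) \<le> wX u2 + \<beta> * real (card (?e2 - ?X) + card (\<Union>(g1 ` ?U1)))"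
        by (rule length_le[OF Xr[OF u2(1)] ch _ new]) (unfold len2, use ab a3 in simp)
      then show False unfolding len2 wX_def of_nat_add distrib_left bc by simp
    qed
  qed
qed

end

theorem asymmetric_case:
  assumes crit: "critical EA EB" and fin: "finite EA" "finite EB" and ab: "3 \<le> a" "a < b"
    and card: "\<And>e. e \<in> EA \<Longrightarrow> card e = a" "\<And>e. e \<in> EB \<Longrightarrow> card e = b"
  shows "\<exists>X w. reaches (EA \<union> EB) (\<lambda>Q. \<exists>j e. star_path EA EB j Q e) a b (3 * b) X w \<and> w < 0"
proof (rule ccontr)
  assume "\<not> ?thesis"
  then have nonneg: "\<forall>X w. reaches (EA \<union> EB) (\<lambda>Q. \<exists>j e. star_path EA EB j Q e) a b (3 * b) X w \<longrightarrow> 0 \<le> w"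
    by force
  interpret star_graph EA EB a b
  proof
    show "\<exists>f\<in>EB. e \<inter> f = {v}" if "e \<in> EA" "v \<in> e" for e v
      by (rule critical_privateA[OF crit that]) (rule bexI)
    show "\<exists>e\<in>EA. e \<inter> f = {u}" if "f \<in> EB" "u \<in> f" for f u
      by (rule critical_privateB[OF crit that]) (rule bexI)
  qed (use fin ab card nonneg in auto)
  have "EA \<noteq> {}"
  proof
    assume "EA = {}"
    moreover have "f \<inter> UNIV \<noteq> {}" if "f \<in> EB" for f using card(2)[OF that] ab by force
    ultimately have "colourable EA EB" unfolding colourable_def by blast
    then show False using critical_not_colourable[OF crit] by simp
  qed
  then show False by (rule no_edges)
qed

section \<open>Counting configurations built from a path\<close>

lemma sum_UN_le:
  fixes g :: "'b \<Rightarrow> real"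
  assumes "finite I" "\<And>i. i \<in> I \<Longrightarrow> finite (A i)" "\<And>x. 0 \<le> g x"
  shows "sum g (\<Union>i\<in>I. A i) \<le> (\<Sum>i\<in>I. sum g (A i))"
  using assms(1,2)
proof (induction I rule: finite_induct)
  case (insert i I)
  have "sum g (A i \<union> (\<Union>i\<in>I. A i)) \<le> sum g (A i) + sum g (\<Union>i\<in>I. A i)"
    using insert assms(3) by (subst sum_Un) (auto intro!: sum_nonneg)
  moreover have "sum g (\<Union>i\<in>I. A i) \<le> (\<Sum>i\<in>I. sum g (A i))" using insert by simp
  ultimately show ?case using insert(1,2) by simp
qed simp

text \<open>
  The property of the solution sets of an equation of length \<open>k\<close> in the first \<open>n\<close> integers that the
  counting uses: once \<open>t < k\<close> entries are known, all but one of the others are free.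
\<close>
definition sparse :: "nat \<Rightarrow> nat \<Rightarrow> nat \<Rightarrow> 'v set set \<Rightarrow> bool" where
  "sparse n K k H \<longleftrightarrow> finite H \<and> (\<forall>h\<in>H. finite h \<and> card h = k) \<and>
     (\<forall>T. finite T \<longrightarrow> card T < k \<longrightarrow> card {h \<in> H. T \<subseteq> h} \<le> K * n ^ (k - 1 - card T))"

lemma sparseD:
  assumes "sparse n K k H"
  shows "finite H" "h \<in> H \<Longrightarrow> finite h" "h \<in> H \<Longrightarrow> card h = k"
    "finite T \<Longrightarrow> card T < k \<Longrightarrow> card {h \<in> H. T \<subseteq> h} \<le> K * n ^ (k - 1 - card T)"
  using assms unfolding sparse_def by blast+

lemma sparse_count:
  assumes sp: "sparse n K k H" and W: "finite W" and q: "1 \<le> q"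
  shows "card {h \<in> H. card (h - W) = q} \<le> (card W + 1) ^ k * K * n ^ (q - 1)"
proof (cases "q \<le> k")
  case False
  have "card (h - W) \<noteq> q" if "h \<in> H" for h
    using card_mono[of h "h - W"] sparseD(2,3)[OF sp that] False by auto
  then have "{h \<in> H. card (h - W) = q} = {}" by blast
  then show ?thesis by (simp only: card.empty)
next
  case True
  let ?\<T> = "{T. T \<subseteq> W \<and> card T = k - q}"
  have fin: "finite ?\<T>" using W by simp
  have "{h \<in> H. card (h - W) = q} \<subseteq> (\<Union>T\<in>?\<T>. {h \<in> H. T \<subseteq> h})"
  proof
    fix h assume h: "h \<in> {h \<in> H. card (h - W) = q}"
    then have "card (h \<inter> W) + card (h - W) = k"
      using sparseD(2,3)[OF sp, of h] by (metis (mono_tags, lifting) card_Diff_subset_Int card_mono finite_Int inf_le1 le_add_diff_inverse mem_Collect_eq)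
    then have "card (h \<inter> W) = k - q" using h by auto
    then show "h \<in> (\<Union>T\<in>?\<T>. {h \<in> H. T \<subseteq> h})" using h by auto
  qed
  then have "card {h \<in> H. card (h - W) = q} \<le> card (\<Union>T\<in>?\<T>. {h \<in> H. T \<subseteq> h})"
    using fin sparseD(1)[OF sp] by (intro card_mono) auto
  also have "\<dots> \<le> (\<Sum>T\<in>?\<T>. card {h \<in> H. T \<subseteq> h})" by (rule card_UN_le[OF fin])
  also have "\<dots> \<le> (\<Sum>T\<in>?\<T>. K * n ^ (q - 1))"
  proof (rule sum_mono)
    fix T assume T: "T \<in> ?\<T>"
    then have "finite T" "card T < k" "k - 1 - card T = q - 1" using W finite_subset q True by auto
    then show "card {h \<in> H. T \<subseteq> h} \<le> K * n ^ (q - 1)" using sparseD(4)[OF sp, of T] by simp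
  qed
  also have "\<dots> = (card W choose (k - q)) * (K * n ^ (q - 1))" using n_subsets[OF W] by simp
  also have "\<dots> \<le> (card W + 1) ^ k * (K * n ^ (q - 1))"
  proof (rule mult_right_mono)
    have "card W choose (k - q) \<le> (card W + 1) ^ (k - q)"
    proof (cases "k - q \<le> card W")
      case True
      then have "card W choose (k - q) \<le> card W ^ (k - q)" by (rule binomial_le_pow)
      also have "\<dots> \<le> (card W + 1) ^ (k - q)" by (rule power_mono) auto
      finally show ?thesis .
    qed (simp add: binomial_eq_0)
    also have "\<dots> \<le> (card W + 1) ^ k" by (rule power_increasing) auto
    finally show "card W choose (k - q) \<le> (card W + 1) ^ k" .
  qed simp
  finally show ?thesis by (simp add: mult.assoc)
qed

text \<open>
  With \<open>y\<close> of order $1 / n$, an edge with \<open>q\<close> new points contributes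
  $y^q$, and there are at most $n^{q - 1}$ of them up to a factor that
  depends on the size of \<open>W\<close> only: each edge that counts gains a factor $1 / n$.
\<close>
lemma sparse_sum:
  fixes y :: real
  assumes sp: "sparse n K k H" and W: "finite W" and y: "0 \<le> y" "y * n \<le> 1" and n: "1 \<le> n"
  shows "(\<Sum>h | h \<in> H \<and> \<not> h \<subseteq> W. y ^ card (h - W)) \<le> k * K * (card W + 1) ^ k / n"
proof -
  let ?c = "real ((card W + 1) ^ k * K)"
  have "{h \<in> H. \<not> h \<subseteq> W} \<subseteq> (\<Union>q\<in>{1..k}. {h \<in> H. card (h - W) = q})"
  proof
    fix h assume h: "h \<in> {h \<in> H. \<not> h \<subseteq> W}"
    then have f: "finite h" "card h = k" using sparseD(2,3)[OF sp] by auto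
    then have "card (h - W) \<le> k" using card_mono[of h "h - W"] by auto
    moreover have "card (h - W) \<noteq> 0" using h f by auto
    ultimately show "h \<in> (\<Union>q\<in>{1..k}. {h \<in> H. card (h - W) = q})" using h by auto
  qed
  then have "(\<Sum>h | h \<in> H \<and> \<not> h \<subseteq> W. y ^ card (h - W))
      \<le> (\<Sum>h\<in>(\<Union>q\<in>{1..k}. {h \<in> H. card (h - W) = q}). y ^ card (h - W))"
    using sparseD(1)[OF sp] y by (intro sum_mono2) auto
  also have "\<dots> \<le> (\<Sum>q\<in>{1..k}. \<Sum>h | h \<in> H \<and> card (h - W) = q. y ^ card (h - W))"
    using sparseD(1)[OF sp] y by (intro sum_UN_le) auto
  also have "\<dots> \<le> (\<Sum>q\<in>{1..k}. ?c / n)"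
  proof (rule sum_mono)
    fix q assume q: "q \<in> {1..k}"
    have "(\<Sum>h | h \<in> H \<and> card (h - W) = q. y ^ card (h - W)) = card {h \<in> H. card (h - W) = q} * y ^ q"
      by simp
    also have "\<dots> \<le> real ((card W + 1) ^ k * K * n ^ (q - 1)) * y ^ q"
      using sparse_count[OF sp W, of q] q y by (intro mult_right_mono of_nat_mono) auto
    also have "\<dots> = ?c * (real n ^ (q - 1) * y ^ q)" by simp
    also have "\<dots> = ?c * ((y * n) ^ q / n)"
    proof -
      have "real n ^ (q - 1) * y ^ q = (y * n) ^ q / n"
        using q n by (cases q) (auto simp: power_mult_distrib field_simps)
      then show ?thesis by (simp only:)
    qed
    also have "\<dots> \<le> ?c * (1 / n)"
      using y by (intro mult_left_mono divide_right_mono power_le_one) auto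
    finally show "(\<Sum>h | h \<in> H \<and> card (h - W) = q. y ^ card (h - W)) \<le> ?c / n" by (simp only: times_divide_eq_right mult_1_right)
  qed
  also have "\<dots> = k * K * (card W + 1) ^ k / n" by (simp add: mult_ac)
  finally show ?thesis .
qed

lemma sparse_sum2:
  fixes y :: real
  assumes sp: "sparse n K a HA" "sparse n K b HB" and ab: "a \<le> b" and W: "finite W" and y: "0 \<le> y" "y * n \<le> 1" and n: "1 \<le> n"
  shows "(\<Sum>h | h \<in> HA \<union> HB \<and> \<not> h \<subseteq> W. y ^ card (h - W)) \<le> 2 * b * K * (card W + 1) ^ b / n"
proof -
  have e: "{h. h \<in> HA \<union> HB \<and> \<not> h \<subseteq> W} = {h. h \<in> HA \<and> \<not> h \<subseteq> W} \<union> {h. h \<in> HB \<and> \<not> h \<subseteq> W}" by blast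
  have "(\<Sum>h | h \<in> HA \<union> HB \<and> \<not> h \<subseteq> W. y ^ card (h - W))
     \<le> (\<Sum>h | h \<in> HA \<and> \<not> h \<subseteq> W. y ^ card (h - W)) + (\<Sum>h | h \<in> HB \<and> \<not> h \<subseteq> W. y ^ card (h - W))"
    unfolding e using sparseD(1)[OF sp(1)] sparseD(1)[OF sp(2)] y by (subst sum_Un) (auto intro!: sum_nonneg)
  also have "\<dots> \<le> a * K * (card W + 1) ^ a / n + b * K * (card W + 1) ^ b / n"
    by (intro add_mono sparse_sum sp W y n)
  also have "a * K * (card W + 1) ^ a / n \<le> b * K * (card W + 1) ^ b / n"
  proof -
    have "a * K * (card W + 1) ^ a \<le> b * K * (card W + 1) ^ b"
      using ab by (intro mult_mono power_increasing) auto
    then show ?thesis by (intro divide_right_mono of_nat_mono) auto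
  qed
  finally show ?thesis by (simp add: field_simps)
qed

definition grown :: "'v set set \<Rightarrow> nat \<Rightarrow> 'v set \<Rightarrow> 'v set set" where
  "grown E s Q = {Q \<union> \<Union>(set hs) |hs. growing E Q hs \<and> length hs = s}"

lemma grown_Suc: "grown E (Suc s) Q = (\<lambda>(X, h). X \<union> h) ` (SIGMA X:grown E s Q. {h \<in> E. \<not> h \<subseteq> X})"
proof (intro equalityI subsetI)
  fix Y assume "Y \<in> grown E (Suc s) Q"
  then obtain hs where hs: "growing E Q hs" "length hs = Suc s" "Y = Q \<union> \<Union>(set hs)" unfolding grown_def by blast
  then obtain ks h where [simp]: "hs = ks @ [h]" by (metis length_0_conv nat.distinct(1) rev_exhaust)
  have "growing E Q ks" "h \<in> E" "\<not> h \<subseteq> Q \<union> \<Union>(set ks)" using hs(1) by (auto simp: growing_append)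
  then have "(Q \<union> \<Union>(set ks), h) \<in> (SIGMA X:grown E s Q. {h \<in> E. \<not> h \<subseteq> X})"
    using hs(2) unfolding grown_def by auto
  moreover have "Y = (\<lambda>(X, h). X \<union> h) (Q \<union> \<Union>(set ks), h)" using hs(3) by auto
  ultimately show "Y \<in> (\<lambda>(X, h). X \<union> h) ` (SIGMA X:grown E s Q. {h \<in> E. \<not> h \<subseteq> X})" by (rule rev_image_eqI)
next
  fix Y assume "Y \<in> (\<lambda>(X, h). X \<union> h) ` (SIGMA X:grown E s Q. {h \<in> E. \<not> h \<subseteq> X})"
  then obtain hs h where "growing E Q hs" "length hs = s" "h \<in> E" "\<not> h \<subseteq> Q \<union> \<Union>(set hs)" "Y = Q \<union> \<Union>(set hs) \<union> h"
    unfolding grown_def by auto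
  then show "Y \<in> grown E (Suc s) Q" unfolding grown_def
    by (intro CollectI exI[of _ "hs @ [h]"]) (auto simp: growing_append)
qed

lemma grown_0: "grown E 0 Q = {Q}" unfolding grown_def by auto

lemma grown_finite: "finite E \<Longrightarrow> finite (grown E s Q)"
  by (induction s) (auto simp: grown_0 grown_Suc)

lemma grown_card:
  assumes "\<And>h. h \<in> E \<Longrightarrow> finite h \<and> card h \<le> b" "finite Q" "X \<in> grown E s Q"
  shows "finite X \<and> Q \<subseteq> X \<and> card X \<le> card Q + s * b"
  using assms(3)
proof (induction s arbitrary: X)
  case (Suc s)
  then obtain Y h where Y: "Y \<in> grown E s Q" "h \<in> E" "X = Y \<union> h" unfolding grown_Suc by auto
  then show ?case using Suc.IH[OF Y(1)] assms(1)[OF Y(2)] card_Un_le[of Y h] by auto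
qed (use assms(2) in \<open>simp add: grown_0\<close>)

lemma grown_sum:
  fixes y :: real
  assumes sp: "sparse n K a HA" "sparse n K b HB" and ab: "a \<le> b" and Q: "finite Q"
    and y: "0 \<le> y" "y * n \<le> 1" and n: "1 \<le> n"
    and st: "s \<le> t"
  shows "(\<Sum>X\<in>grown (HA \<union> HB) s Q. y ^ card (X - Q)) \<le> (real (2 * b * K * (card Q + t * b + 1) ^ b) / n) ^ s"
  using st
proof (induction s)
  case 0
  show ?case by (simp add: grown_0)
next
  case (Suc s)
  let ?E = "HA \<union> HB" and ?G = "real (2 * b * K * (card Q + t * b + 1) ^ b) / n"
  have finE: "finite ?E" using sparseD(1)[OF sp(1)] sparseD(1)[OF sp(2)] by simp
  have E: "finite h \<and> card h \<le> b" if "h \<in> ?E" for h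
    using that sparseD(2,3)[OF sp(1)] sparseD(2,3)[OF sp(2)] ab by auto
  have "(\<Sum>X\<in>grown ?E (Suc s) Q. y ^ card (X - Q))
      \<le> (\<Sum>(X, h)\<in>(SIGMA X:grown ?E s Q. {h \<in> ?E. \<not> h \<subseteq> X}). y ^ card (X \<union> h - Q))"
    unfolding grown_Suc
    by (rule order_trans[OF sum_image_le]) (use grown_finite[OF finE] finE y in \<open>auto simp: o_def case_prod_beta\<close>)
  also have "\<dots> = (\<Sum>X\<in>grown ?E s Q. \<Sum>h | h \<in> ?E \<and> \<not> h \<subseteq> X. y ^ card (X \<union> h - Q))"
    using grown_finite[OF finE] finE by (subst sum.Sigma) auto
  also have "\<dots> = (\<Sum>X\<in>grown ?E s Q. y ^ card (X - Q) * (\<Sum>h | h \<in> ?E \<and> \<not> h \<subseteq> X. y ^ card (h - X)))"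
    unfolding sum_distrib_left
  proof (intro sum.cong refl)
    fix X h assume X: "X \<in> grown ?E s Q" and h: "h \<in> {h \<in> ?E. \<not> h \<subseteq> X}"
    have f: "finite X" "Q \<subseteq> X" "finite h" using grown_card[OF E Q X] E h by auto
    then have "X \<union> h - Q = (X - Q) \<union> (h - X)" by auto
    then have "card (X \<union> h - Q) = card (X - Q) + card (h - X)"
      using f by (simp only:) (intro card_Un_disjoint, auto)
    then show "y ^ card (X \<union> h - Q) = y ^ card (X - Q) * y ^ card (h - X)" by (simp add: power_add)
  qed
  also have "\<dots> \<le> (\<Sum>X\<in>grown ?E s Q. y ^ card (X - Q) * ?G)"
  proof (intro sum_mono mult_left_mono)
    fix X assume X: "X \<in> grown ?E s Q"
    have c: "finite X" "card X \<le> card Q + s * b" using grown_card[OF E Q X] by auto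
    have "(\<Sum>h | h \<in> ?E \<and> \<not> h \<subseteq> X. y ^ card (h - X)) \<le> 2 * b * K * (card X + 1) ^ b / n"
      by (rule sparse_sum2[OF sp ab c(1) y n])
    also have "\<dots> \<le> ?G"
    proof (intro divide_right_mono of_nat_mono mult_left_mono power_mono)
      have "s * b \<le> t * b" using Suc.prems by (intro mult_right_mono) auto
      then show "card X + 1 \<le> card Q + t * b + 1" using c(2) by linarith
    qed auto
    finally show "(\<Sum>h | h \<in> ?E \<and> \<not> h \<subseteq> X. y ^ card (h - X)) \<le> ?G" .
  qed (use y in auto)
  also have "\<dots> = (\<Sum>X\<in>grown ?E s Q. y ^ card (X - Q)) * ?G" by (rule sum_distrib_right[symmetric])
  also have "\<dots> \<le> ?G ^ s * ?G" using Suc by (intro mult_right_mono) auto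
  finally show ?case by (simp add: mult.commute)
qed

lemma linear_le_exponential:
  fixes r :: real assumes "1 < r"
  obtains M where "0 \<le> M" "\<And>j::nat. real (j + 1) \<le> M * r ^ j"
proof
  let ?d = "min 1 (r - 1)"
  have d: "0 < ?d" using assms by simp
  show "0 \<le> 1 / ?d" using d by simp
  fix j :: nat
  have "?d * (j + 1) = ?d + ?d * j" by (simp add: algebra_simps)
  also have "\<dots> \<le> 1 + j * (r - 1)" using assms by (simp add: mult.commute mult_left_mono add_mono)
  also have "\<dots> \<le> (1 + (r - 1)) ^ j" using assms by (intro Bernoulli_inequality) auto
  finally have "?d * (j + 1) \<le> r ^ j" by simp
  then show "real (j + 1) \<le> 1 / ?d * r ^ j" using d by (simp add: field_simps)
qed

lemma power_le_exponential:
  fixes r :: real assumes "1 < r"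
  shows "\<exists>M. 0 \<le> M \<and> (\<forall>j::nat. real (j + 1) ^ m \<le> M * r ^ j)"
  using assms
proof (induction m arbitrary: r)
  case 0
  then show ?case by (intro exI[of _ 1]) simp
next
  case (Suc m)
  have q: "1 < sqrt r" "sqrt r * sqrt r = r" using Suc.prems by auto
  obtain M where M: "0 \<le> M" "\<And>j::nat. real (j + 1) ^ m \<le> M * sqrt r ^ j" using Suc.IH[OF q(1)] by blast
  obtain L where L: "0 \<le> L" "\<And>j::nat. real (j + 1) \<le> L * sqrt r ^ j" using linear_le_exponential[OF q(1)] by blast
  have "real (j + 1) ^ Suc m \<le> (L * M) * r ^ j" for j
  proof -
    have "real (j + 1) * real (j + 1) ^ m \<le> (L * sqrt r ^ j) * (M * sqrt r ^ j)"
      using L M q by (intro mult_mono) auto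
    also have "\<dots> = (L * M) * (sqrt r * sqrt r) ^ j" by (simp only: power_mult_distrib mult_ac)
    finally show ?thesis unfolding q(2) by simp
  qed
  then show ?case using M(1) L(1) by (intro exI[of _ "L * M"]) auto
qed

lemma summable_poly_halves: "summable (\<lambda>j::nat. c * real (j + 1) ^ m / 2 ^ j)"
proof -
  obtain M where M: "0 \<le> M" "\<And>j::nat. real (j + 1) ^ m \<le> M * (3/2) ^ j"
    using power_le_exponential[of "3/2" m] by auto
  have "summable (\<lambda>j::nat. real (j + 1) ^ m / 2 ^ j)"
  proof (rule summable_comparison_test')
    show "summable (\<lambda>j. M * (3/4) ^ j :: real)" by (intro summable_mult summable_geometric) auto
    show "norm (real (j + 1) ^ m / 2 ^ j) \<le> M * (3/4) ^ j" for j
    proof -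
      have "real (j + 1) ^ m / 2 ^ j \<le> M * (3/2) ^ j / 2 ^ j" by (intro divide_right_mono M) auto
      also have "\<dots> = M * (3/4) ^ j" by (simp add: power_divide field_simps flip: power_mult_distrib)
      finally show ?thesis by simp
    qed
  qed
  then show ?thesis using summable_mult[of _ c] by fastforce
qed

text \<open>
  A bound, up to the power of \<open>n\<close>, for the number of ways to add \<open>s \<le> S\<close> edges to a set of \<open>q\<close>
  points. It is polynomial in \<open>q\<close> and thus harmless in a geometric series over the lengths of paths.
\<close>
definition growth :: "nat \<Rightarrow> nat \<Rightarrow> nat \<Rightarrow> nat \<Rightarrow> nat \<Rightarrow> real" where
  "growth b K S q s = real (2 * b * K * (q + S * b + 1) ^ b) ^ s"

lemma growth_mono: "q \<le> q' \<Longrightarrow> growth b K S q s \<le> growth b K S q' s"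
  unfolding growth_def by (intro power_mono of_nat_mono mult_left_mono) auto

lemma growth_nonneg: "0 \<le> growth b K S q s" unfolding growth_def by simp

lemma growth_poly: "growth b K S (C * (j + 1)) s \<le> (real (2 * b * K) * real (C + S * b + 1) ^ b) ^ s * real (j + 1) ^ (b * s)"
proof -
  have "C * (j + 1) + S * b + 1 \<le> (C + S * b + 1) * (j + 1)" by (simp add: algebra_simps)
  then have "growth b K S (C * (j + 1)) s \<le> real (2 * b * K * ((C + S * b + 1) * (j + 1)) ^ b) ^ s"
    unfolding growth_def by (intro power_mono of_nat_mono mult_left_mono) auto
  also have "\<dots> = (real (2 * b * K) * real (C + S * b + 1) ^ b) ^ s * real (j + 1) ^ (b * s)"
    by (simp only: of_nat_mult of_nat_power power_mult_distrib power_mult mult.assoc)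
  finally show ?thesis .
qed

lemma growth_summable: "summable (\<lambda>j. growth b K S (C * (j + 1)) s / 2 ^ j)"
proof (rule summable_comparison_test'[OF summable_poly_halves])
  fix j
  show "norm (growth b K S (C * (j + 1)) s / 2 ^ j)
      \<le> (real (2 * b * K) * real (C + S * b + 1) ^ b) ^ s * real (j + 1) ^ (b * s) / 2 ^ j"
    using divide_right_mono[OF growth_poly[of b K S C j s], of "2 ^ j"] growth_nonneg[of b K S "C * (j + 1)" s] by simp
qed

text \<open>
  The sum over all configurations of negative weight, up to the power of \<open>n\<close>: those built
  from nothing, and those built from a path of \<open>j\<close> steps with at most \<open>C * (j + 1)\<close> points, which
  account for a fraction of at most \<open>D / 2 ^ j\<close>.
\<close>
definition total_mass :: "nat \<Rightarrow> nat \<Rightarrow> nat \<Rightarrow> nat \<Rightarrow> real \<Rightarrow> real" where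
  "total_mass b K S C D = (\<Sum>s\<le>S. growth b K S 0 s + D * (\<Sum>j. growth b K S (C * (j + 1)) s / 2 ^ j))"

text \<open>
  All weights are integral multiples of \<open>1 / (a * (b - 1))\<close>, so a negative weight is bounded away
  from zero.
\<close>
lemma weight_gap:
  assumes ab: "1 \<le> a" "2 \<le> b" and w: "w = w0 + beta a b * real N - real s" "w0 = 0 \<or> w0 = alpha b" "w < 0"
  shows "w \<le> - (1 / (real a * (real b - 1)))"
proof -
  let ?d = "real a * (real b - 1)"
  have d: "0 < ?d" using ab by simp
  define i :: int where "i = (if w0 = 0 then 0 else int a) + int b * int N - int s * int a * (int b - 1)"
  have ad: "alpha b * ?d = a" and bd: "beta a b * ?d = b"
    using ab by (simp_all add: alpha_def beta_def)
  have "w * ?d = w0 * ?d + (beta a b * ?d) * N - s * ?d" unfolding w(1) by (simp add: algebra_simps)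
  also have "w0 * ?d = (if w0 = 0 then 0 else real a)" using w(2) ad by auto
  finally have "w * ?d = of_int i" unfolding bd i_def using ab by simp
  moreover have "w * ?d < 0" using w(3) d by (simp add: mult_neg_pos)
  ultimately have "i < 0" by simp
  then have "real_of_int i \<le> -1" by linarith
  then have "w * ?d \<le> -1" using \<open>w * ?d = of_int i\<close> by simp
  then show ?thesis using d by (simp add: field_simps)
qed

text \<open>
  With $p = y n^\beta$ the factor $p$ for each new point splits into $y$,
  which is summed by \<open>grown_sum\<close>, and $n^\beta$. The powers of \<open>n\<close> collect to the weight, which is at
  most minus the gap.
\<close>
lemma mass_of_bad_from:
  fixes p :: real
  assumes sp: "sparse n K a HA" "sparse n K b HB" and ab: "3 \<le> a" "a \<le> b" and Q: "finite Q"
    and p: "0 \<le> p" "p \<le> real n powr (beta a b - 1)" and n: "1 \<le> n"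
    and s: "s \<le> S" and w0: "w0 = 0 \<or> w0 = alpha b"
  shows "(\<Sum>X | X \<in> grown (HA \<union> HB) s Q \<and> w0 + beta a b * card (X - Q) - s < 0. p ^ card X)
    \<le> p ^ card Q * real n powr (- w0 - 1 / (real a * (real b - 1))) * growth b K S (card Q) s"
proof -
  let ?E = "HA \<union> HB" and ?\<beta> = "beta a b" and ?\<delta> = "1 / (real a * (real b - 1))"
  \<comment> \<open>Of order $1 / n$, in contrast to \<open>p\<close>.\<close>
  define y where "y = p / real n powr ?\<beta>"
  have y0: "0 \<le> y" unfolding y_def using p by simp
  have "y * n \<le> real n powr (?\<beta> - 1) / real n powr ?\<beta> * n"
    unfolding y_def using p by (intro mult_right_mono divide_right_mono) auto
  also have "\<dots> = 1" using n by (simp add: powr_diff)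
  finally have y1: "y * n \<le> 1" .
  have finE: "finite ?E" using sparseD(1)[OF sp(1)] sparseD(1)[OF sp(2)] by simp
  have E: "finite h \<and> card h \<le> b" if "h \<in> ?E" for h
    using that sparseD(2,3)[OF sp(1)] sparseD(2,3)[OF sp(2)] ab by auto
  have "(\<Sum>X | X \<in> grown ?E s Q \<and> w0 + ?\<beta> * card (X - Q) - s < 0. p ^ card X)
    \<le> (\<Sum>X | X \<in> grown ?E s Q \<and> w0 + ?\<beta> * card (X - Q) - s < 0.
        p ^ card Q * (real n powr (- w0 - ?\<delta>) * real n ^ s) * y ^ card (X - Q))"
  proof (rule sum_mono)
    fix X assume X: "X \<in> {X. X \<in> grown ?E s Q \<and> w0 + ?\<beta> * card (X - Q) - s < 0}"
    have f: "finite X" "Q \<subseteq> X" using grown_card[OF E Q] X by blast+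
    let ?N = "card (X - Q)"
    have "card X = card Q + ?N" using f by (metis card_Diff_subset card_mono finite_subset le_add_diff_inverse)
    then have "p ^ card X = p ^ card Q * p ^ ?N" by (simp add: power_add)
    also have "p ^ ?N = y ^ ?N * (real n powr ?\<beta>) ^ ?N" unfolding y_def using n by (simp add: power_divide)
    also have "(real n powr ?\<beta>) ^ ?N = real n powr (?\<beta> * ?N)" using n by (simp add: powr_powr flip: powr_realpow)
    also have "p ^ card Q * (y ^ ?N * real n powr (?\<beta> * ?N))
        \<le> p ^ card Q * (y ^ ?N * (real n powr (- w0 - ?\<delta>) * real n ^ s))"
    proof (intro mult_left_mono)
      have "w0 + ?\<beta> * ?N - s \<le> - ?\<delta>"
        using weight_gap[of a b _ w0 ?N s] ab w0 X by simp
      then have "?\<beta> * ?N \<le> (- w0 - ?\<delta>) + real s" by linarith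
      then have "real n powr (?\<beta> * ?N) \<le> real n powr ((- w0 - ?\<delta>) + real s)" using n by (intro powr_mono) auto
      also have "\<dots> = real n powr (- w0 - ?\<delta>) * real n ^ s" using n by (simp add: powr_add powr_realpow)
      finally show "real n powr (?\<beta> * ?N) \<le> real n powr (- w0 - ?\<delta>) * real n ^ s" .
    qed (use y0 p in auto)
    finally show "p ^ card X \<le> p ^ card Q * (real n powr (- w0 - ?\<delta>) * real n ^ s) * y ^ ?N"
      by (simp only: mult_ac)
  qed
  also have "\<dots> \<le> (\<Sum>X\<in>grown ?E s Q. p ^ card Q * (real n powr (- w0 - ?\<delta>) * real n ^ s) * y ^ card (X - Q))"
    using grown_finite[OF finE] y0 p by (intro sum_mono2) auto
  also have "\<dots> = p ^ card Q * (real n powr (- w0 - ?\<delta>) * real n ^ s) * (\<Sum>X\<in>grown ?E s Q. y ^ card (X - Q))"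
    by (simp add: sum_distrib_left)
  also have "\<dots> \<le> p ^ card Q * (real n powr (- w0 - ?\<delta>) * real n ^ s) * (real (2 * b * K * (card Q + S * b + 1) ^ b) / n) ^ s"
    using grown_sum[OF sp ab(2) Q y0 y1 n s] p by (intro mult_left_mono) auto
  also have "\<dots> = p ^ card Q * real n powr (- w0 - ?\<delta>) * growth b K S (card Q) s"
    unfolding growth_def using n by (simp add: power_divide)
  finally show ?thesis .
qed

text \<open>
  The first-moment bound: the paths of length \<open>j\<close> have total mass at most
  $D n^\alpha / 2^j$, and the negative weight of a configuration more than cancels
  $n^\alpha$.
\<close>
lemma mass_of_bad:
  fixes p D :: real and St :: "nat \<Rightarrow> 'v set set" and S :: nat
  assumes sp: "sparse n K a HA" "sparse n K b HB" and ab: "3 \<le> a" "a \<le> b"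
    and p: "0 \<le> p" "p \<le> real n powr (beta a b - 1)" and n: "1 \<le> n"
    and fin: "finite (\<Union>j. St j)" and St: "\<And>j Q. Q \<in> St j \<Longrightarrow> finite Q \<and> card Q \<le> C * (j + 1)"
    and D: "0 \<le> D" and mass: "\<And>j. (\<Sum>Q\<in>St j. p ^ card Q) \<le> D * real n powr alpha b / 2 ^ j"
  defines "Bad \<equiv> {X. \<exists>w<0. reaches (HA \<union> HB) (\<lambda>Q. \<exists>j. Q \<in> St j) a b S X w}"
  shows "finite Bad" "(\<Sum>X\<in>Bad. p ^ card X) \<le> total_mass b K S C D * real n powr (- (1 / (real a * (real b - 1))))"
proof -
  let ?E = "HA \<union> HB" and ?\<beta> = "beta a b" and ?\<delta> = "1 / (real a * (real b - 1))"
  define B where "B w0 s Q = {X. X \<in> grown ?E s Q \<and> w0 + ?\<beta> * card (X - Q) - real s < 0}" for w0 s Q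
  have finE: "finite ?E" using sparseD(1)[OF sp(1)] sparseD(1)[OF sp(2)] by simp
  have finB: "finite (B w0 s Q)" for w0 s Q unfolding B_def using grown_finite[OF finE] by auto
  let ?Q = "\<Union>j. St j"
  have sub: "Bad \<subseteq> (\<Union>s\<in>{..S}. B 0 s {} \<union> (\<Union>Q\<in>?Q. B (alpha b) s Q))"
  proof
    fix X assume "X \<in> Bad"
    then obtain w Q w0 hs where *: "w < 0" "Q = {} \<and> w0 = 0 \<or> (\<exists>j. Q \<in> St j) \<and> w0 = alpha b" "growing ?E Q hs" "length hs \<le> S"
      "X = Q \<union> \<Union>(set hs)" "w = w0 + ?\<beta> * card (X - Q) - length hs"
      unfolding Bad_def reaches_def by blast
    then have "X \<in> B w0 (length hs) Q" unfolding B_def grown_def by auto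
    then show "X \<in> (\<Union>s\<in>{..S}. B 0 s {} \<union> (\<Union>Q\<in>?Q. B (alpha b) s Q))" using *(2,4) by blast
  qed
  have finall: "finite (B 0 s {} \<union> (\<Union>Q\<in>?Q. B (alpha b) s Q))" for s
    by (intro finite_UnI finite_UN_I fin finB)
  then show "finite Bad" using sub finite_subset by blast
  have fj: "\<forall>Q\<in>?Q. \<exists>j. Q \<in> St j" by blast
  then obtain jf where jf: "\<forall>Q\<in>?Q. Q \<in> St (jf Q)" by (rule bchoice[THEN exE])
  define J where "J = Max (insert 0 (jf ` ?Q))"
  have J: "?Q \<subseteq> (\<Union>j\<in>{..J}. St j)"
  proof
    fix Q assume Q: "Q \<in> ?Q"
    then have "jf Q \<le> J" unfolding J_def using fin by (intro Max_ge) auto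
    then show "Q \<in> (\<Union>j\<in>{..J}. St j)" using jf Q by blast
  qed
  have finSt: "finite (St j)" for j by (rule finite_subset[OF _ fin]) blast
  have states: "(\<Sum>Q\<in>?Q. \<Sum>X\<in>B (alpha b) s Q. p ^ card X)
     \<le> D * (\<Sum>j. growth b K S (C * (j + 1)) s / 2 ^ j) * real n powr (- ?\<delta>)" if s: "s \<le> S" for s
  proof -
    define g where "g Q = p ^ card Q * real n powr (- alpha b - ?\<delta>) * growth b K S (card Q) s" for Q :: "'v set"
    have g0: "0 \<le> g Q" for Q unfolding g_def using p growth_nonneg by (intro mult_nonneg_nonneg) auto
    have "(\<Sum>Q\<in>?Q. \<Sum>X\<in>B (alpha b) s Q. p ^ card X) \<le> (\<Sum>Q\<in>?Q. g Q)"
      unfolding B_def g_def using St by (intro sum_mono mass_of_bad_from sp ab p n s) auto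
    also have "\<dots> \<le> (\<Sum>Q\<in>(\<Union>j\<in>{..J}. St j). g Q)" using J finSt g0 by (intro sum_mono2) auto
    also have "\<dots> \<le> (\<Sum>j\<le>J. \<Sum>Q\<in>St j. g Q)" using finSt g0 by (intro sum_UN_le) auto
    also have "\<dots> \<le> (\<Sum>j\<le>J. D * real n powr (- ?\<delta>) * (growth b K S (C * (j + 1)) s / 2 ^ j))"
    proof (rule sum_mono)
      fix j
      let ?G = "growth b K S (C * (j + 1)) s"
      have "(\<Sum>Q\<in>St j. g Q) \<le> (\<Sum>Q\<in>St j. p ^ card Q * real n powr (- alpha b - ?\<delta>) * ?G)"
        unfolding g_def using p St by (intro sum_mono mult_left_mono growth_mono) auto
      also have "\<dots> = (\<Sum>Q\<in>St j. p ^ card Q) * (real n powr (- alpha b - ?\<delta>) * ?G)"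
        by (simp add: sum_distrib_right mult.assoc)
      also have "\<dots> \<le> (D * real n powr alpha b / 2 ^ j) * (real n powr (- alpha b - ?\<delta>) * ?G)"
        using mass growth_nonneg by (intro mult_right_mono) auto
      also have "\<dots> = D * (real n powr alpha b * real n powr (- alpha b - ?\<delta>)) * (?G / 2 ^ j)" by simp
      also have "real n powr alpha b * real n powr (- alpha b - ?\<delta>) = real n powr (- ?\<delta>)" by (simp flip: powr_add)
      finally show "(\<Sum>Q\<in>St j. g Q) \<le> D * real n powr (- ?\<delta>) * (?G / 2 ^ j)" .
    qed
    also have "\<dots> = D * real n powr (- ?\<delta>) * (\<Sum>j\<le>J. growth b K S (C * (j + 1)) s / 2 ^ j)"
      by (simp add: sum_distrib_left)
    also have "\<dots> \<le> D * real n powr (- ?\<delta>) * (\<Sum>j. growth b K S (C * (j + 1)) s / 2 ^ j)"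
      using D growth_summable growth_nonneg by (intro mult_left_mono sum_le_suminf) auto
    finally show ?thesis by (simp only: mult_ac)
  qed
  have "(\<Sum>X\<in>Bad. p ^ card X) \<le> (\<Sum>X\<in>(\<Union>s\<in>{..S}. B 0 s {} \<union> (\<Union>Q\<in>?Q. B (alpha b) s Q)). p ^ card X)"
    using sub finall p by (intro sum_mono2) auto
  also have "\<dots> \<le> (\<Sum>s\<le>S. \<Sum>X\<in>B 0 s {} \<union> (\<Union>Q\<in>?Q. B (alpha b) s Q). p ^ card X)"
    using finall p by (intro sum_UN_le) auto
  also have "\<dots> \<le> (\<Sum>s\<le>S. (growth b K S 0 s + D * (\<Sum>j. growth b K S (C * (j + 1)) s / 2 ^ j)) * real n powr (- ?\<delta>))"
  proof (rule sum_mono)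
    fix s assume "s \<in> {..S}"
    then have s: "s \<le> S" by simp
    have "(\<Sum>X\<in>B 0 s {}. p ^ card X) \<le> p ^ card ({} :: 'v set) * real n powr (- 0 - ?\<delta>) * growth b K S (card ({} :: 'v set)) s"
      unfolding B_def by (intro mass_of_bad_from sp ab p n s) auto
    then have e: "(\<Sum>X\<in>B 0 s {}. p ^ card X) \<le> growth b K S 0 s * real n powr (- ?\<delta>)" by (simp add: mult.commute)
    have f2: "finite (\<Union>Q\<in>?Q. B (alpha b) s Q)" by (intro finite_UN_I fin finB)
    have "0 \<le> (\<Sum>X\<in>B 0 s {} \<inter> (\<Union>Q\<in>?Q. B (alpha b) s Q). p ^ card X)" using p by (intro sum_nonneg) auto
    moreover have "(\<Sum>X\<in>(\<Union>Q\<in>?Q. B (alpha b) s Q). p ^ card X) \<le> (\<Sum>Q\<in>?Q. \<Sum>X\<in>B (alpha b) s Q. p ^ card X)"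
      using fin finB p by (intro sum_UN_le) auto
    ultimately show "(\<Sum>X\<in>B 0 s {} \<union> (\<Union>Q\<in>?Q. B (alpha b) s Q). p ^ card X)
       \<le> (growth b K S 0 s + D * (\<Sum>j. growth b K S (C * (j + 1)) s / 2 ^ j)) * real n powr (- ?\<delta>)"
      using e states[OF s] unfolding sum_Un[OF finB f2] distrib_right by linarith
  qed
  also have "\<dots> = total_mass b K S C D * real n powr (- ?\<delta>)" unfolding total_mass_def by (simp only: sum_distrib_right)
  finally show "(\<Sum>X\<in>Bad. p ^ card X) \<le> total_mass b K S C D * real n powr (- ?\<delta>)" .
qed

section \<open>Counting paths\<close>

text \<open>
  Every step of a path adds the same number \<open>m\<close> of points and can be made in at most \<open>N\<close> ways.
\<close>
lemma halving_mass:
  fixes p D :: real and T :: "nat \<Rightarrow> 'x set" and U :: "'x \<Rightarrow> 'v set"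
  assumes p: "0 \<le> p" and fin0: "finite (T 0)" and D: "(\<Sum>x\<in>T 0. p ^ card (U x)) \<le> D"
    and step: "\<And>j. T (Suc j) \<subseteq> (\<Union>x\<in>T j. Ext j x)"
    and finE: "\<And>j x. x \<in> T j \<Longrightarrow> finite (Ext j x)" and N: "\<And>j x. x \<in> T j \<Longrightarrow> card (Ext j x) \<le> N"
    and new: "\<And>j x y. x \<in> T j \<Longrightarrow> y \<in> Ext j x \<Longrightarrow> card (U y) = card (U x) + m"
    and half: "N * p ^ m \<le> 1 / 2"
  shows "finite (T j) \<and> (\<Sum>x\<in>T j. p ^ card (U x)) \<le> D / 2 ^ j"
proof (induction j)
  case (Suc j)
  have fU: "finite (\<Union>x\<in>T j. Ext j x)" using Suc finE by blast
  have "(\<Sum>y\<in>T (Suc j). p ^ card (U y)) \<le> (\<Sum>y\<in>(\<Union>x\<in>T j. Ext j x). p ^ card (U y))"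
    using step[of j] fU p by (intro sum_mono2) auto
  also have "\<dots> \<le> (\<Sum>x\<in>T j. \<Sum>y\<in>Ext j x. p ^ card (U y))" using Suc finE p by (intro sum_UN_le) auto
  also have "\<dots> \<le> (\<Sum>x\<in>T j. p ^ card (U x) * (1/2))"
  proof (rule sum_mono)
    fix x assume x: "x \<in> T j"
    have "(\<Sum>y\<in>Ext j x. p ^ card (U y)) = (\<Sum>y\<in>Ext j x. p ^ card (U x) * p ^ m)"
      using new[OF x] by (intro sum.cong) (auto simp: power_add)
    also have "\<dots> = p ^ card (U x) * (card (Ext j x) * p ^ m)" by simp
    also have "\<dots> \<le> p ^ card (U x) * (N * p ^ m)" using N[OF x] p by (intro mult_left_mono mult_right_mono) auto
    also have "\<dots> \<le> p ^ card (U x) * (1/2)" using half p by (intro mult_left_mono) auto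
    finally show "(\<Sum>y\<in>Ext j x. p ^ card (U y)) \<le> p ^ card (U x) * (1/2)" .
  qed
  also have "\<dots> = (\<Sum>x\<in>T j. p ^ card (U x)) * (1/2)" by (rule sum_distrib_right[symmetric])
  also have "\<dots> \<le> D / 2 ^ j * (1/2)" using Suc by (intro mult_right_mono) auto
  finally have "(\<Sum>y\<in>T (Suc j). p ^ card (U y)) \<le> D / 2 ^ Suc j" by simp
  then show ?case using finite_subset[OF step fU] by blast
qed (use fin0 D in simp)

lemma image_mass:
  fixes p :: real assumes "finite T" "0 \<le> p"
  shows "(\<Sum>Q\<in>U ` T. p ^ card Q) \<le> (\<Sum>x\<in>T. p ^ card (U x))"
  by (rule order_trans[OF sum_image_le]) (use assms in \<open>auto simp: o_def\<close>)

text \<open>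
  One factor \<open>c\<close> is kept, so that a small \<open>c\<close> makes each step of a path lose at least one half.
\<close>
lemma powr_cancel:
  assumes n: "1 \<le> n" and p: "0 \<le> p" "p \<le> c * real n powr e" and c: "0 \<le> c" "c \<le> 1" and m: "1 \<le> m"
  shows "real n ^ r * p ^ m \<le> c * real n powr (r + e * m)"
proof -
  have "p ^ m \<le> (c * real n powr e) ^ m" using p by (intro power_mono) auto
  also have "\<dots> = c ^ m * real n powr (e * m)" using n by (simp add: power_mult_distrib powr_powr flip: powr_realpow)
  also have "\<dots> \<le> c ^ 1 * real n powr (e * m)" using c m by (intro mult_right_mono power_decreasing) auto
  finally have "real n ^ r * p ^ m \<le> real n ^ r * (c * real n powr (e * m))" by (intro mult_left_mono) auto
  also have "\<dots> = c * real n powr (r + e * m)" using n by (simp add: powr_add powr_realpow)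
  finally show ?thesis .
qed

lemma sparse_point: assumes "sparse n K k H" "2 \<le> k" shows "card {h \<in> H. v \<in> h} \<le> K * n ^ (k - 2)"
  using sparseD(4)[OF assms(1), of "{v}"] assms(2) by (simp add: numeral_2_eq_2)

lemma sparse_all: assumes "sparse n K k H" "2 \<le> k" shows "card H \<le> K * n ^ (k - 1)"
  using sparseD(4)[OF assms(1), of "{}"] assms(2) by simp

lemma start_mass:
  assumes n: "1 \<le> n" and ab: "3 \<le> a" "a \<le> b" and p: "0 \<le> p" "p \<le> real n powr (beta a b - 1)"
    and fin: "finite H" and card: "\<And>h. h \<in> H \<Longrightarrow> card h = a" "card H \<le> M * n ^ (a - 1)"
  shows "(\<Sum>h\<in>H. p ^ card h) \<le> M * real n powr alpha b"
proof -
  have "(\<Sum>h\<in>H. p ^ card h) = card H * p ^ a" using card by simp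
  also have "\<dots> \<le> real (M * n ^ (a - 1)) * p ^ a" using card p by (intro mult_right_mono of_nat_mono) auto
  also have "\<dots> = M * (real n ^ (a - 1) * p ^ a)" by simp
  also have "\<dots> \<le> M * (1 * real n powr (real (a - 1) + (beta a b - 1) * a))"
    using powr_cancel[of n p 1 "beta a b - 1" a "a - 1"] n p ab by (intro mult_left_mono) auto
  also have "real (a - 1) + (beta a b - 1) * a = alpha b"
    using ab by (simp add: alpha_def beta_def field_simps of_nat_diff)
  finally show ?thesis by simp
qed

lemma loose_mass:
  fixes p :: real
  assumes sp: "sparse n K k HA" "sparse n K k HB" and k: "3 \<le> k" and n: "1 \<le> n"
    and p: "0 \<le> p" "p \<le> c * real n powr (beta k k - 1)" and c: "0 \<le> c" "c \<le> 1" "2 * K * k * c \<le> 1 / 2"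
  defines "St \<equiv> \<lambda>j. (\<lambda>es. \<Union>(set es)) ` {es. loose (HA \<union> HB) es \<and> length es = Suc j}"
  shows "(\<Sum>Q\<in>St j. p ^ card Q) \<le> real (2 * K) * real n powr alpha k / 2 ^ j"
    "Q \<in> St j \<Longrightarrow> finite Q \<and> card Q \<le> k * (j + 1)"
proof -
  let ?E = "HA \<union> HB"
  define T where "T j = {es. loose ?E es \<and> length es = Suc j}" for j
  define Ext where "Ext es = (\<lambda>e. e # es) ` {e \<in> ?E. \<exists>v\<in>hd es. e \<inter> \<Union>(set es) = {v}}" for es
  have finE: "finite ?E" using sparseD(1)[OF sp(1)] sparseD(1)[OF sp(2)] by simp
  have E: "finite h" "card h = k" if "h \<in> ?E" for h
    using that sparseD(2,3)[OF sp(1)] sparseD(2,3)[OF sp(2)] by auto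
  have len: "length es = Suc j \<Longrightarrow> loose ?E es \<Longrightarrow> finite (\<Union>(set es)) \<and> card (\<Union>(set es)) \<le> k * (j + 1)" for es j
  proof (induction es arbitrary: j)
    case (Cons e es)
    have eE: "e \<in> ?E" using loose_edges[OF Cons.prems(2)] by auto
    show ?case
    proof (cases "es = []")
      case True
      then show ?thesis using E[OF eE] Cons.prems(1) by simp
    next
      case False
      then obtain i where i: "j = Suc i" "length es = Suc i" using Cons.prems(1) by (cases es) auto
      have "finite (\<Union>(set es)) \<and> card (\<Union>(set es)) \<le> k * (i + 1)" using Cons.IH[OF i(2) loose_tl[OF Cons.prems(2) False]] .
      then show ?thesis using E[OF eE] card_Un_le[of e "\<Union>(set es)"] i by auto
    qed
  qed simp
  then show "Q \<in> St j \<Longrightarrow> finite Q \<and> card Q \<le> k * (j + 1)" unfolding St_def by blast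
  have pn: "p \<le> real n powr (beta k k - 1)"
    using p(2) c by (meson mult_left_le_one_le order_trans powr_ge_zero)
  have T0: "T 0 = (\<lambda>e. [e]) ` ?E" unfolding T_def by (auto simp: length_Suc_conv)
  have card0: "card ?E \<le> (2 * K) * n ^ (k - 1)"
    using sparse_all[OF sp(1)] sparse_all[OF sp(2)] k card_Un_le[of HA HB] by simp
  have "finite (T j) \<and> (\<Sum>es\<in>T j. p ^ card (\<Union>(set es))) \<le> real (2 * K) * real n powr alpha k / 2 ^ j"
  proof (rule halving_mass[where Ext = "\<lambda>_. Ext" and N = "2 * K * k * n ^ (k - 2)" and m = "k - 1"])
    show "finite (T 0)" unfolding T0 using finE by simp
    have "(\<Sum>es\<in>T 0. p ^ card (\<Union>(set es))) = (\<Sum>e\<in>?E. p ^ card e)"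
      unfolding T0 by (subst sum.reindex) (auto simp: inj_on_def)
    also have "\<dots> \<le> real (2 * K) * real n powr alpha k" using start_mass[OF n k order_refl p(1) pn finE _ card0] E by simp
    finally show "(\<Sum>es\<in>T 0. p ^ card (\<Union>(set es))) \<le> real (2 * K) * real n powr alpha k" .
    show "T (Suc j) \<subseteq> (\<Union>es\<in>T j. Ext es)" for j
    proof
      fix es assume "es \<in> T (Suc j)"
      then obtain e ms where es: "es = e # ms" "loose ?E (e # ms)" "length ms = Suc j" unfolding T_def by (auto simp: length_Suc_conv)
      then have ne: "ms \<noteq> []" by auto
      obtain v where v: "e \<inter> \<Union>(set ms) = {v}" using loose_joint[OF es(2) ne] .
      have "v \<in> hd ms" using es(2) ne v by (cases ms) auto
      moreover have "e \<in> ?E" using loose_edges[OF es(2)] by auto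
      ultimately have "es \<in> Ext ms" unfolding Ext_def es(1) using v by blast
      moreover have "ms \<in> T j" unfolding T_def using es(3) loose_tl[OF es(2) ne] by simp
      ultimately show "es \<in> (\<Union>es\<in>T j. Ext es)" by blast
    qed
    show "finite (Ext es)" for es unfolding Ext_def using finE by simp
    show "card (Ext es) \<le> 2 * K * k * n ^ (k - 2)" if es: "es \<in> T j" for es j
    proof -
      have hd: "hd es \<in> ?E" using loose_edges[of ?E es] es unfolding T_def by (cases es) auto
      have "card (Ext es) \<le> card {e \<in> ?E. \<exists>v\<in>hd es. e \<inter> \<Union>(set es) = {v}}"
        unfolding Ext_def using finE by (intro card_image_le) auto
      also have "\<dots> \<le> card (\<Union>v\<in>hd es. {e \<in> ?E. v \<in> e})" using finE E[OF hd] by (intro card_mono) auto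
      also have "\<dots> \<le> (\<Sum>v\<in>hd es. card {e \<in> ?E. v \<in> e})" using E[OF hd] by (intro card_UN_le) auto
      also have "\<dots> \<le> (\<Sum>v\<in>hd es. 2 * K * n ^ (k - 2))"
      proof (rule sum_mono)
        fix v
        have "{e \<in> ?E. v \<in> e} = {e \<in> HA. v \<in> e} \<union> {e \<in> HB. v \<in> e}" by blast
        then have "card {e \<in> ?E. v \<in> e} \<le> card {e \<in> HA. v \<in> e} + card {e \<in> HB. v \<in> e}" by (simp only: card_Un_le)
        then show "card {e \<in> ?E. v \<in> e} \<le> 2 * K * n ^ (k - 2)"
          using sparse_point[OF sp(1), of v] sparse_point[OF sp(2), of v] k by simp
      qed
      also have "\<dots> = 2 * K * k * n ^ (k - 2)" using E[OF hd] by simp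
      finally show ?thesis .
    qed
    show "card (\<Union>(set ks)) = card (\<Union>(set es)) + (k - 1)" if es: "es \<in> T j" and ks: "ks \<in> Ext es" for es ks j
    proof -
      obtain e v where e: "ks = e # es" "e \<in> ?E" "e \<inter> \<Union>(set es) = {v}" using ks unfolding Ext_def by blast
      have f: "finite (\<Union>(set es))" using len es unfolding T_def by blast
      have "card (\<Union>(set ks)) + 1 = card e + card (\<Union>(set es))"
        using card_Un_Int[OF E(1)[OF e(2)] f] e(1,3) by simp
      then show ?thesis using E(2)[OF e(2)] k by simp
    qed
    show "real (2 * K * k * n ^ (k - 2)) * p ^ (k - 1) \<le> 1 / 2"
    proof -
      have "real n ^ (k - 2) * p ^ (k - 1) \<le> c * real n powr (real (k - 2) + (beta k k - 1) * real (k - 1))"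
        by (rule powr_cancel[OF n p c(1,2)]) (use k in simp)
      also have "real (k - 2) + (beta k k - 1) * real (k - 1) = 0"
        using k by (simp add: beta_def field_simps of_nat_diff)
      finally have "real n ^ (k - 2) * p ^ (k - 1) \<le> c" using n by simp
      then have "real (2 * K * k) * (real n ^ (k - 2) * p ^ (k - 1)) \<le> real (2 * K * k) * c" by (intro mult_left_mono) auto
      then show ?thesis using c(3) by (simp add: mult_ac)
    qed
  qed (use p in auto)
  then have m: "finite (T j)" "(\<Sum>es\<in>T j. p ^ card (\<Union>(set es))) \<le> real (2 * K) * real n powr alpha k / 2 ^ j"
    by blast+
  have "(\<Sum>Q\<in>St j. p ^ card Q) \<le> (\<Sum>es\<in>T j. p ^ card (\<Union>(set es)))"
    unfolding St_def T_def[symmetric] by (rule image_mass[OF m(1) p(1)])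
  then show "(\<Sum>Q\<in>St j. p ^ card Q) \<le> real (2 * K) * real n powr alpha k / 2 ^ j" using m(2) by linarith
qed

text \<open>
  A step chooses \<open>v\<close>, an edge \<open>f\<close> through \<open>v\<close>, an edge of the first kind through each other
  point of \<open>f\<close>, and the edge at which the path goes on. The powers of \<open>n\<close> and \<open>p\<close> cancel
  because a fresh star has weight 0.
\<close>
lemma star_mass:
  fixes p :: real
  assumes sp: "sparse n K a HA" "sparse n K b HB" and ab: "3 \<le> a" "a \<le> b" and n: "1 \<le> n"
    and p: "0 \<le> p" "p \<le> c * real n powr (beta a b - 1)" and c: "0 \<le> c" "c \<le> 1" "a * b * K ^ b * c \<le> 1 / 2"
  defines "St \<equiv> \<lambda>j. {W. \<exists>e. star_path HA HB j W e}"
  shows "(\<Sum>Q\<in>St j. p ^ card Q) \<le> real K * real n powr alpha b / 2 ^ j"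
    "Q \<in> St j \<Longrightarrow> finite Q \<and> card Q \<le> (a * b) * (j + 1)"
proof -
  define T where "T j = {(W, e). star_path HA HB j W e}" for j
  define J where "J e = (SIGMA v:e. SIGMA f:{f \<in> HB. v \<in> f}. (PiE (f - {v}) (\<lambda>u. {h \<in> HA. u \<in> h})) \<times> (f - {v}))" for e
  define Ext where "Ext x = (\<lambda>(v, f, g, u). (fst x \<union> \<Union>(g ` (f - {v})), g u)) `
      {(v, f, g, u) \<in> J (snd x). fresh_star HA HB (fst x) v f g}" for x :: "'a set \<times> 'a set"
  note fin = sparseD(1)[OF sp(1)] sparseD(1)[OF sp(2)]
  note A = sparseD(2,3)[OF sp(1)] and B = sparseD(2,3)[OF sp(2)]
  have finJ: "finite (J e)" if "finite e" for e
    unfolding J_def using that fin B by (intro finite_SigmaI finite_cartesian_product finite_PiE) auto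
  have cardJ: "card (J e) \<le> a * b * K ^ b * n ^ ((b - 2) + (a - 2) * (b - 1))" if e: "finite e" "card e = a" for e
  proof -
    define P where "P v f = PiE (f - {v}) (\<lambda>u. {h \<in> HA. u \<in> h}) \<times> (f - {v})" for v f
    have fP: "finite (P v f)" if "f \<in> HB" for f v
      unfolding P_def using fin B that by (intro finite_cartesian_product finite_PiE) auto
    have cP: "card (P v f) = (\<Prod>u\<in>f - {v}. card {h \<in> HA. u \<in> h}) * card (f - {v})" if "f \<in> HB" for f v
      unfolding P_def using B that by (simp only: card_cartesian_product) (subst card_PiE, auto)
    have J: "J e = (SIGMA v:e. SIGMA f:{f \<in> HB. v \<in> f}. P v f)" unfolding J_def P_def ..
    have "card (J e) = (\<Sum>v\<in>e. card (SIGMA f:{f \<in> HB. v \<in> f}. P v f))"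
      unfolding J using e fin fP by (intro card_SigmaI ballI finite_SigmaI) auto
    also have "\<dots> = (\<Sum>v\<in>e. \<Sum>f\<in>{f \<in> HB. v \<in> f}. card (P v f))"
      using fin fP by (intro sum.cong refl card_SigmaI ballI) auto
    also have "\<dots> = (\<Sum>v\<in>e. \<Sum>f\<in>{f \<in> HB. v \<in> f}. (\<Prod>u\<in>f - {v}. card {h \<in> HA. u \<in> h}) * card (f - {v}))"
      using cP by (intro sum.cong refl) auto
    also have "\<dots> \<le> (\<Sum>v\<in>e. \<Sum>f\<in>{f \<in> HB. v \<in> f}. (K * n ^ (a - 2)) ^ (b - 1) * b)"
    proof (intro sum_mono mult_mono)
      fix v f assume f: "f \<in> {f \<in> HB. v \<in> f}"
      then have cf: "card (f - {v}) = b - 1" "finite (f - {v})" using B[of f] by auto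
      have "(\<Prod>u\<in>f - {v}. card {h \<in> HA. u \<in> h}) \<le> (\<Prod>u\<in>f - {v}. K * n ^ (a - 2))"
        using sparse_point[OF sp(1)] ab by (intro prod_mono) auto
      also have "\<dots> = (K * n ^ (a - 2)) ^ (b - 1)" using cf by simp
      finally show "(\<Prod>u\<in>f - {v}. card {h \<in> HA. u \<in> h}) \<le> (K * n ^ (a - 2)) ^ (b - 1)" .
      show "card (f - {v}) \<le> b" using cf by simp
    qed auto
    also have "\<dots> = (\<Sum>v\<in>e. card {f \<in> HB. v \<in> f} * ((K * n ^ (a - 2)) ^ (b - 1) * b))" by simp
    also have "\<dots> \<le> (\<Sum>v\<in>e. (K * n ^ (b - 2)) * ((K * n ^ (a - 2)) ^ (b - 1) * b))"
      using sparse_point[OF sp(2)] ab by (intro sum_mono mult_right_mono) auto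
    also have "\<dots> = a * b * K ^ Suc (b - 1) * n ^ ((b - 2) + (a - 2) * (b - 1))"
      using e by (simp add: power_add power_mult power_mult_distrib)
    also have "Suc (b - 1) = b" using ab by simp
    finally show ?thesis .
  qed
  have fresh_card: "finite W \<Longrightarrow> card (W \<union> \<Union>(g ` (f - {v}))) = card W + (b - 1) * a \<and> finite (W \<union> \<Union>(g ` (f - {v})))"
    if fs: "fresh_star HA HB W v f g" for W v f g
  proof -
    assume W: "finite W"
    have f: "f \<in> HB" "v \<in> f" using fs unfolding fresh_star_def by blast+
    have gA: "g u \<in> HA" if "u \<in> f - {v}" for u using fs that unfolding fresh_star_def by blast
    have ff: "finite (f - {v})" "card (f - {v}) = b - 1" using B[OF f(1)] f(2) by auto
    have "card (\<Union>(g ` (f - {v}))) = (\<Sum>u\<in>f - {v}. card (g u))"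
    proof (rule card_UN_disjoint[OF ff(1)])
      show "\<forall>i\<in>f - {v}. finite (g i)" using gA A by blast
      show "\<forall>i\<in>f - {v}. \<forall>j\<in>f - {v}. i \<noteq> j \<longrightarrow> g i \<inter> g j = {}"
        using fs unfolding fresh_star_def disjoint_family_on_def by blast
    qed
    also have "\<dots> = (\<Sum>u\<in>f - {v}. a)" using gA A by (intro sum.cong) auto
    also have "\<dots> = (b - 1) * a" using ff by simp
    finally have c: "card (\<Union>(g ` (f - {v}))) = (b - 1) * a" .
    have fg: "finite (\<Union>(g ` (f - {v})))" using ff gA A by blast
    have "W \<inter> \<Union>(g ` (f - {v})) = {}" using fs unfolding fresh_star_def by blast
    then show ?thesis using card_Un_disjoint[OF W fg] c W fg by simp
  qed
  have inv: "finite W \<and> card W \<le> (a * b) * (j + 1) \<and> e \<in> HA" if "star_path HA HB j W e" for j W e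
    using that
  proof induction
    case (start e)
    then show ?case using A ab by auto
  next
    case (step j W e v f g u)
    have "(b - 1) * a \<le> a * b" by (simp add: mult.commute)
    moreover have "g u \<in> HA" using step.hyps unfolding fresh_star_def by blast
    ultimately show ?case using fresh_card[OF step.hyps(3)] step.IH by (auto simp: algebra_simps)
  qed
  then show "Q \<in> St j \<Longrightarrow> finite Q \<and> card Q \<le> (a * b) * (j + 1)" unfolding St_def by blast
  have pn: "p \<le> real n powr (beta a b - 1)"
    using p(2) c by (meson mult_left_le_one_le order_trans powr_ge_zero)
  have T0: "T 0 = (\<lambda>e. (e, e)) ` HA" unfolding T_def by (auto elim: star_path.cases intro: star_path.start)
  have "finite (T j) \<and> (\<Sum>x\<in>T j. p ^ card (fst x)) \<le> real K * real n powr alpha b / 2 ^ j"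
  proof (rule halving_mass[where Ext = "\<lambda>_. Ext" and N = "a * b * K ^ b * n ^ ((b - 2) + (a - 2) * (b - 1))" and m = "(b - 1) * a"])
    show "finite (T 0)" unfolding T0 using fin by simp
    have "(\<Sum>x\<in>T 0. p ^ card (fst x)) = (\<Sum>e\<in>HA. p ^ card e)"
      unfolding T0 by (subst sum.reindex) (auto simp: inj_on_def)
    also have "\<dots> \<le> real K * real n powr alpha b"
      using start_mass[OF n ab p(1) pn fin(1) A(2) sparse_all[OF sp(1)]] ab by simp
    finally show "(\<Sum>x\<in>T 0. p ^ card (fst x)) \<le> real K * real n powr alpha b" .
    show "T (Suc j) \<subseteq> (\<Union>x\<in>T j. Ext x)" for j
    proof
      fix x assume "x \<in> T (Suc j)"
      then obtain W' e' where x: "x = (W', e')" "star_path HA HB (Suc j) W' e'" unfolding T_def by auto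
      from x(2) show "x \<in> (\<Union>x\<in>T j. Ext x)"
      proof cases
        case (step W e v f g u)
        let ?g = "restrict g (f - {v})"
        have f: "f \<in> HB" "v \<in> f" using step unfolding fresh_star_def by blast+
        have fs: "fresh_star HA HB W v f ?g"
          using step unfolding fresh_star_def disjoint_family_on_def by simp
        have "?g \<in> PiE (f - {v}) (\<lambda>u. {h \<in> HA. u \<in> h})"
          using step(5) unfolding fresh_star_def by (intro restrict_PiE_iff[THEN iffD2]) blast
        then have "(v, f, ?g, u) \<in> J e" unfolding J_def using step f by auto
        then have mem: "(v, f, ?g, u) \<in> {(v, f, g, u) \<in> J (snd (W, e)). fresh_star HA HB (fst (W, e)) v f g}"
          using fs by simp
        have "x = (\<lambda>(v, f, g, u). (fst (W, e) \<union> \<Union>(g ` (f - {v})), g u)) (v, f, ?g, u)"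
          using x step by simp
        then have "x \<in> Ext (W, e)" unfolding Ext_def by (rule rev_image_eqI[OF mem])
        moreover have "(W, e) \<in> T j" unfolding T_def using step by simp
        ultimately show ?thesis by blast
      qed
    qed
    have e: "finite (snd x)" "card (snd x) = a" "finite (fst x)" if "x \<in> T j" for x j
      using that inv A unfolding T_def by auto
    show "finite (Ext x)" if "x \<in> T j" for x j
      unfolding Ext_def by (rule finite_imageI, rule finite_subset[OF _ finJ[OF e(1)[OF that]]]) auto
    show "card (Ext x) \<le> a * b * K ^ b * n ^ ((b - 2) + (a - 2) * (b - 1))" if x: "x \<in> T j" for x j
    proof -
      have s: "{(v, f, g, u) \<in> J (snd x). fresh_star HA HB (fst x) v f g} \<subseteq> J (snd x)" by auto
      have "card (Ext x) \<le> card {(v, f, g, u) \<in> J (snd x). fresh_star HA HB (fst x) v f g}"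
        unfolding Ext_def by (rule card_image_le, rule finite_subset[OF s finJ[OF e(1)[OF x]]])
      also have "\<dots> \<le> card (J (snd x))" by (rule card_mono[OF finJ[OF e(1)[OF x]] s])
      finally show ?thesis using cardJ[OF e(1,2)[OF x]] by linarith
    qed
    show "card (fst y) = card (fst x) + (b - 1) * a" if x: "x \<in> T j" and y: "y \<in> Ext x" for x y j
      using y fresh_card e(3)[OF x] unfolding Ext_def by auto
    show "real (a * b * K ^ b * n ^ ((b - 2) + (a - 2) * (b - 1))) * p ^ ((b - 1) * a) \<le> 1 / 2"
    proof -
      have "real n ^ ((b - 2) + (a - 2) * (b - 1)) * p ^ ((b - 1) * a)
          \<le> c * real n powr (real ((b - 2) + (a - 2) * (b - 1)) + (beta a b - 1) * real ((b - 1) * a))"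
        by (rule powr_cancel[OF n p c(1,2)]) (use ab in simp)
      also have "(beta a b - 1) * real ((b - 1) * a) = real b - real ((b - 1) * a)"
        using ab by (simp add: beta_def field_simps of_nat_diff)
      also have "real ((b - 2) + (a - 2) * (b - 1)) + (real b - real ((b - 1) * a)) = 0"
      proof -
        have "real (a - 2) = real a - 2" "real (b - 2) = real b - 2" "real (b - 1) = real b - 1" using ab by auto
        then show ?thesis by (simp only: of_nat_add of_nat_mult) (simp add: algebra_simps)
      qed
      finally have "real n ^ ((b - 2) + (a - 2) * (b - 1)) * p ^ ((b - 1) * a) \<le> c" using n by simp
      then have "real (a * b * K ^ b) * (real n ^ ((b - 2) + (a - 2) * (b - 1)) * p ^ ((b - 1) * a)) \<le> real (a * b * K ^ b) * c"
        by (intro mult_left_mono) auto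
      then show ?thesis using c(3) by (simp add: mult_ac)
    qed
  qed (use p in auto)
  then have m: "finite (T j)" "(\<Sum>x\<in>T j. p ^ card (fst x)) \<le> real K * real n powr alpha b / 2 ^ j" by blast+
  have "St j = fst ` T j" unfolding St_def T_def by force
  then have "(\<Sum>Q\<in>St j. p ^ card Q) \<le> (\<Sum>x\<in>T j. p ^ card (fst x))"
    using image_mass[OF m(1) p(1), of fst] by simp
  then show "(\<Sum>Q\<in>St j. p ^ card Q) \<le> real K * real n powr alpha b / 2 ^ j" using m(2) by linarith
qed

section \<open>Solution sets of linear equations\<close>

definition solution_sets :: "lin_eq \<Rightarrow> int set \<Rightarrow> int set set" where
  "solution_sets A S = vec_set ` {x. eq_solution A S x}"

lemma eq_solutionD:
  assumes "linear_equation k A" "eq_solution A S x"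
  shows "dim_vec x = k" "vec_set x \<subseteq> S" "card (vec_set x) = k"
    "(\<Sum>i<k. underlying_matrix A $$ (0, i) * vec_index x i) = rhs A"
proof -
  let ?M = "underlying_matrix A"
  have M: "dim_row ?M = 1" "dim_col ?M = k" using assms(1) unfolding linear_equation_def by auto
  have x: "x \<in> carrier_vec k" "vec_set x \<subseteq> S" "?M *\<^sub>v x = vec 1 (\<lambda>_. rhs A)" "distinct (list_of_vec x)"
    using assms(2) M unfolding eq_solution_def distinct_solution_def by auto
  show d: "dim_vec x = k" and "vec_set x \<subseteq> S" using x by auto
  show "card (vec_set x) = k" using distinct_card[OF x(4)] d by (simp add: set_list_of_vec)
  have "vec_index (?M *\<^sub>v x) 0 = rhs A" using x(3) by simp
  moreover have "vec_index (?M *\<^sub>v x) 0 = (\<Sum>i<k. ?M $$ (0, i) * vec_index x i)"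
    using M d by (simp add: scalar_prod_def atLeast0LessThan)
  ultimately show "(\<Sum>i<k. ?M $$ (0, i) * vec_index x i) = rhs A" by simp
qed

lemma rado_imp_not_colourable:
  assumes "rado A B S" shows "\<not> colourable (solution_sets A S) (solution_sets B S)"
proof
  assume "colourable (solution_sets A S) (solution_sets B S)"
  then obtain R where R: "\<forall>e\<in>solution_sets A S. \<not> e \<subseteq> R" "\<forall>f\<in>solution_sets B S. f \<inter> R \<noteq> {}"
    unfolding colourable_def by blast
  define col where "col y = (if y \<in> R then 1 else 2 :: nat)" for y
  have "col \<in> S \<rightarrow> {1, 2}" unfolding col_def by auto
  then consider x where "eq_solution A S x" "\<forall>y\<in>vec_set x. col y = 1"
    | x where "eq_solution B S x" "\<forall>y\<in>vec_set x. col y = 2"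
    using assms unfolding rado_def by blast
  then show False
  proof cases
    case 1
    then have "vec_set x \<subseteq> R" unfolding col_def by (auto split: if_splits)
    then show False using R(1) 1(1) unfolding solution_sets_def by blast
  next
    case 2
    then have "vec_set x \<inter> R = {}" unfolding col_def by (auto split: if_splits)
    then show False using R(2) 2(1) unfolding solution_sets_def by blast
  qed
qed

text \<open>
  All coefficients are nonzero, so the equation determines each entry from the others.
\<close>
lemma solution_determined:
  assumes A: "linear_equation k A" and x: "eq_solution A S x" and y: "eq_solution A S y"
    and i: "i < k" and agree: "\<And>j. j < k \<Longrightarrow> j \<noteq> i \<Longrightarrow> vec_index x j = vec_index y j"
  shows "x = y"
proof -
  let ?m = "\<lambda>j. underlying_matrix A $$ (0, j)"
  have "(\<Sum>j<k. ?m j * vec_index x j) = (\<Sum>j<k. ?m j * vec_index y j)" using eq_solutionD(4)[OF A x] eq_solutionD(4)[OF A y] by simp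
  moreover have split: "(\<Sum>j<k. ?m j * vec_index z j) = ?m i * vec_index z i + (\<Sum>j\<in>{..<k} - {i}. ?m j * vec_index z j)" for z :: "int vec"
    using i by (intro sum.remove) auto
  moreover have "(\<Sum>j\<in>{..<k} - {i}. ?m j * vec_index x j) = (\<Sum>j\<in>{..<k} - {i}. ?m j * vec_index y j)"
    using agree by (intro sum.cong) auto
  ultimately have "?m i * vec_index x i = ?m i * vec_index y i" by simp
  moreover have "?m i \<noteq> 0" using A i unfolding linear_equation_def by blast
  ultimately have "vec_index x i = vec_index y i" by simp
  then show ?thesis
    using agree eq_solutionD(1)[OF A x] eq_solutionD(1)[OF A y] by (intro eq_vecI) metis+
qed

text \<open>
  After the positions \<open>\<pi>\<close> of the elements of \<open>T\<close> are fixed, one more position \<open>i\<close> is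
  determined by the equation, and only the others can be chosen freely.
\<close>
lemma solutions_through:
  fixes n :: nat
  assumes A: "linear_equation k A" and T: "finite T" "card T < k" and \<pi>: "\<pi> \<in> T \<rightarrow> {..<k}"
  defines "Z \<equiv> {x. eq_solution A {1..int n} x \<and> (\<forall>u\<in>T. vec_index x (\<pi> u) = u)}"
  shows "finite Z \<and> card Z \<le> n ^ (k - 1 - card T)"
proof (cases "Z = {}")
  case False
  then obtain x0 where x0: "\<forall>u\<in>T. vec_index x0 (\<pi> u) = u" unfolding Z_def by blast
  then have inj: "inj_on \<pi> T" by (intro inj_onI) metis
  have cI: "card (\<pi> ` T) = card T" by (rule card_image[OF inj])
  then have "card (\<pi> ` T) < card {..<k}" using T(2) by simp
  then obtain i where i: "i < k" "i \<notin> \<pi> ` T" using card_less_obtain[of "\<pi> ` T" "{..<k}"] T(1) by auto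
  let ?J = "{..<k} - \<pi> ` T - {i}"
  have "\<pi> ` T \<subseteq> {..<k}" using \<pi> by auto
  then have cJ: "card ?J = k - 1 - card T" using i T(1) cI by (simp add: card_Diff_subset)
  let ?r = "\<lambda>x. restrict (\<lambda>j. vec_index x j) ?J"
  have inj: "inj_on ?r Z"
  proof (rule inj_onI)
    fix x y assume x: "x \<in> Z" and y: "y \<in> Z" and r: "?r x = ?r y"
    show "x = y"
    proof (rule solution_determined[OF A _ _ i(1)])
      show "eq_solution A {1..int n} x" "eq_solution A {1..int n} y" using x y unfolding Z_def by auto
      fix j assume j: "j < k" "j \<noteq> i"
      show "vec_index x j = vec_index y j"
      proof (cases "j \<in> \<pi> ` T")
        case True
        then show ?thesis using x y unfolding Z_def by auto
      next
        case False
        then have "j \<in> ?J" using j by blast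
        then show ?thesis using fun_cong[OF r, of j] by simp
      qed
    qed
  qed
  have sub: "?r ` Z \<subseteq> ?J \<rightarrow>\<^sub>E {1..int n}"
  proof (intro image_subsetI restrict_PiE_iff[THEN iffD2] ballI)
    fix x j assume x: "x \<in> Z" and j: "j \<in> ?J"
    have s: "eq_solution A {1..int n} x" using x unfolding Z_def by auto
    have "vec_index x j \<in> vec_set x" using j eq_solutionD(1)[OF A s] by (intro vec_setI[of x j]) auto
    then show "vec_index x j \<in> {1..int n}" using eq_solutionD(2)[OF A s] by blast
  qed
  have finP: "finite (?J \<rightarrow>\<^sub>E {1..int n})" by (intro finite_PiE) auto
  have "finite Z" using finite_subset[OF sub finP] finite_imageD[OF _ inj] by blast
  moreover have "card Z \<le> card (?J \<rightarrow>\<^sub>E {1..int n})" using card_mono[OF finP sub] card_image[OF inj] by simp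
  moreover have "card (?J \<rightarrow>\<^sub>E {1..int n}) = n ^ (k - 1 - card T)" by (subst card_PiE) (auto simp: cJ)
  ultimately show ?thesis by simp
qed simp

lemma finite_solutions: assumes "linear_equation k A" "1 \<le> k" shows "finite {x. eq_solution A {1..int n} x}"
  using solutions_through[OF assms(1), of "{}" "\<lambda>_. 0" n] assms(2) by simp

lemma sparse_solution_sets:
  assumes A: "linear_equation k A" and k: "1 \<le> k" "k ^ k \<le> K"
  shows "sparse n K k (solution_sets A {1..int n})"
  unfolding sparse_def
proof (intro conjI ballI allI impI)
  let ?S = "{1..int n}"
  show "finite (solution_sets A ?S)" unfolding solution_sets_def using finite_solutions[OF A k(1)] by (rule finite_imageI)
  fix h assume "h \<in> solution_sets A ?S"
  then obtain x where "eq_solution A ?S x" "h = vec_set x" unfolding solution_sets_def by blast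
  then have "h \<subseteq> ?S" "card h = k" using eq_solutionD(2,3)[OF A] by simp_all
  then show "card h = k" "finite h" using finite_subset[of h ?S] by simp_all
next
  let ?S = "{1..int n}"
  fix T :: "int set" assume T: "finite T" "card T < k"
  let ?Z = "\<lambda>\<pi>. {x. eq_solution A ?S x \<and> (\<forall>u\<in>T. vec_index x (\<pi> u) = u)}"
  let ?\<Pi> = "T \<rightarrow>\<^sub>E {..<k}"
  have fin\<Pi>: "finite ?\<Pi>" using T by (intro finite_PiE) auto
  have Z: "finite (?Z \<pi>) \<and> card (?Z \<pi>) \<le> n ^ (k - 1 - card T)" if "\<pi> \<in> ?\<Pi>" for \<pi>
    using solutions_through[OF A T, of \<pi> n] that by blast
  have sub: "{x. eq_solution A ?S x \<and> T \<subseteq> vec_set x} \<subseteq> (\<Union>\<pi>\<in>?\<Pi>. ?Z \<pi>)"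
  proof
    fix x assume x: "x \<in> {x. eq_solution A ?S x \<and> T \<subseteq> vec_set x}"
    then have d: "dim_vec x = k" using eq_solutionD(1)[OF A] by blast
    have "\<forall>u\<in>T. \<exists>i. i < k \<and> vec_index x i = u"
    proof
      fix u assume "u \<in> T"
      then have "u \<in> vec_set x" using x by blast
      then show "\<exists>i. i < k \<and> vec_index x i = u" using d by (elim vec_setE) auto
    qed
    then obtain \<pi> where \<pi>: "\<forall>u\<in>T. \<pi> u < k \<and> vec_index x (\<pi> u) = u" by (rule bchoice[THEN exE])
    then have "restrict \<pi> T \<in> ?\<Pi>" "x \<in> ?Z (restrict \<pi> T)" using x by auto
    then show "x \<in> (\<Union>\<pi>\<in>?\<Pi>. ?Z \<pi>)" by (rule UN_I[where a = "restrict \<pi> T"])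
  qed
  have finU: "finite (\<Union>\<pi>\<in>?\<Pi>. ?Z \<pi>)" using fin\<Pi> Z by blast
  have "{h \<in> solution_sets A ?S. T \<subseteq> h} = vec_set ` {x. eq_solution A ?S x \<and> T \<subseteq> vec_set x}"
    unfolding solution_sets_def by blast
  then have "card {h \<in> solution_sets A ?S. T \<subseteq> h} \<le> card {x. eq_solution A ?S x \<and> T \<subseteq> vec_set x}"
    using card_image_le[OF finite_subset[OF sub finU]] by simp
  also have "\<dots> \<le> card (\<Union>\<pi>\<in>?\<Pi>. ?Z \<pi>)" by (rule card_mono[OF finU sub])
  also have "\<dots> \<le> (\<Sum>\<pi>\<in>?\<Pi>. card (?Z \<pi>))" by (rule card_UN_le[OF fin\<Pi>])
  also have "\<dots> \<le> (\<Sum>\<pi>\<in>?\<Pi>. n ^ (k - 1 - card T))" using Z by (intro sum_mono) blast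
  also have "\<dots> = k ^ card T * n ^ (k - 1 - card T)" using T by (simp add: card_PiE)
  also have "\<dots> \<le> K * n ^ (k - 1 - card T)"
  proof (rule mult_right_mono)
    have "k ^ card T \<le> k ^ k" using T k by (intro power_increasing) auto
    then show "k ^ card T \<le> K" using k(2) by linarith
  qed simp
  finally show "card {h \<in> solution_sets A ?S. T \<subseteq> h} \<le> K * n ^ (k - 1 - card T)" .
qed

section \<open>The random set\<close>

lemma prob_superset:
  assumes p: "0 \<le> p" "p \<le> 1" and X: "X \<subseteq> {1..int n}"
  shows "measure_pmf.prob (random_subset n p) {S. X \<subseteq> S} \<le> p ^ card X"
proof -
  let ?V = "{1..int n}" and ?M = "Pi_pmf {1..int n} False (\<lambda>_. bernoulli_pmf p)"
  let ?B = "\<lambda>i. if i \<in> X then {True} else UNIV"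
  have "measure_pmf.prob (random_subset n p) {S. X \<subseteq> S} = measure_pmf.prob ?M {f. \<forall>i\<in>X. f i}"
    unfolding random_subset_def using X by (auto intro!: arg_cong[where f = "measure_pmf.prob ?M"])
  also have "\<dots> = measure_pmf.prob ?M ({f. \<forall>i\<in>X. f i} \<inter> set_pmf ?M)" by (rule measure_Int_set_pmf[symmetric])
  also have "\<dots> \<le> measure_pmf.prob ?M (PiE_dflt ?V False ?B)"
  proof (rule measure_pmf.finite_measure_mono)
    have "set_pmf ?M \<subseteq> PiE_dflt ?V False (set_pmf \<circ> (\<lambda>_. bernoulli_pmf p))" by (rule set_Pi_pmf_subset') simp
    then show "{f. \<forall>i\<in>X. f i} \<inter> set_pmf ?M \<subseteq> PiE_dflt ?V False ?B" unfolding PiE_dflt_def by auto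
  qed simp
  also have "\<dots> = (\<Prod>i\<in>?V. measure_pmf.prob (bernoulli_pmf p) (?B i))" by (rule measure_Pi_pmf_PiE_dflt) simp
  also have "\<dots> = (\<Prod>i\<in>?V. if i \<in> X then p else 1)"
    using p by (intro prod.cong) (auto simp: measure_pmf_single)
  also have "\<dots> = (\<Prod>i\<in>?V \<inter> X. p)" by (subst prod.inter_restrict) simp_all
  also have "\<dots> = p ^ card X" using X by (simp add: Int_absorb1)
  finally show ?thesis .
qed

lemma random_subset_range: "S \<in> set_pmf (random_subset n p) \<Longrightarrow> S \<subseteq> {1..int n}"
  unfolding random_subset_def by auto

lemma prob_le_sum:
  assumes p: "0 \<le> p" "p \<le> 1" and fin: "finite F"
    and wit: "\<And>S. S \<subseteq> {1..int n} \<Longrightarrow> S \<in> G \<Longrightarrow> \<exists>X\<in>F. X \<subseteq> S"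
  shows "measure_pmf.prob (random_subset n p) G \<le> (\<Sum>X\<in>F. p ^ card X)"
proof -
  let ?M = "random_subset n p" and ?F = "{X \<in> F. X \<subseteq> {1..int n}}"
  have "measure_pmf.prob ?M G = measure_pmf.prob ?M (G \<inter> set_pmf ?M)" by (rule measure_Int_set_pmf[symmetric])
  also have "\<dots> \<le> measure_pmf.prob ?M (\<Union>X\<in>?F. {S. X \<subseteq> S})"
  proof (rule measure_pmf.finite_measure_mono)
    show "G \<inter> set_pmf ?M \<subseteq> (\<Union>X\<in>?F. {S. X \<subseteq> S})"
    proof
      fix S assume S: "S \<in> G \<inter> set_pmf ?M"
      then have "S \<subseteq> {1..int n}" using random_subset_range by blast
      then show "S \<in> (\<Union>X\<in>?F. {S. X \<subseteq> S})" using wit[of S] S by blast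
    qed
  qed simp
  also have "\<dots> \<le> (\<Sum>X\<in>?F. measure_pmf.prob ?M {S. X \<subseteq> S})"
    using fin by (intro measure_pmf.finite_measure_subadditive_finite) auto
  also have "\<dots> \<le> (\<Sum>X\<in>?F. p ^ card X)" using prob_superset[OF p] by (intro sum_mono) auto
  also have "\<dots> \<le> (\<Sum>X\<in>F. p ^ card X)" using fin p by (intro sum_mono2) auto
  finally show ?thesis .
qed

lemma critical_solutions:
  assumes A: "linear_equation a A" "linear_equation b B" "1 \<le> a" "1 \<le> b" and S: "S \<subseteq> {1..int n}" and r: "rado A B S"
  obtains EA EB where "critical EA EB" "finite EA" "finite EB"
    "EA \<subseteq> solution_sets A {1..int n}" "EB \<subseteq> solution_sets B {1..int n}" "\<Union>(EA \<union> EB) \<subseteq> S"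
proof -
  have sub: "solution_sets C S \<subseteq> solution_sets C {1..int n} \<and> \<Union>(solution_sets C S) \<subseteq> S" for C
    using S unfolding solution_sets_def eq_solution_def distinct_solution_def by blast
  have fin: "finite (solution_sets A S)" "finite (solution_sets B S)"
    using sparseD(1)[OF sparse_solution_sets[OF A(1,3) order_refl, of n]]
      sparseD(1)[OF sparse_solution_sets[OF A(2,4) order_refl, of n]] sub finite_subset by blast+
  obtain EA EB where "EA \<subseteq> solution_sets A S" "EB \<subseteq> solution_sets B S" "critical EA EB"
    using critical_subpair[OF fin rado_imp_not_colourable[OF r]] .
  moreover from this have "finite EA" "finite EB" using fin finite_subset by auto
  moreover have "\<Union>(EA \<union> EB) \<subseteq> S" using calculation(1,2) sub by blast
  ultimately show ?thesis using that sub by blast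
qed

lemma reaches_sub:
  assumes r: "reaches E P a b s X w" and P: "\<And>Q. P Q \<Longrightarrow> Q \<subseteq> \<Union>E"
  shows "X \<subseteq> \<Union>E"
proof -
  obtain Q hs where *: "Q = {} \<or> P Q" "growing E Q hs" "X = Q \<union> \<Union>(set hs)"
    using r unfolding reaches_def by blast
  have "set hs \<subseteq> E" by (rule growing_subset[OF *(2)])
  then have "\<Union>(set hs) \<subseteq> \<Union>E" by (rule Union_mono)
  moreover have "Q \<subseteq> \<Union>E" using *(1) P[of Q] by auto
  ultimately show ?thesis unfolding *(3) by (rule Un_least[rotated])
qed

text \<open>
  If the random set is Rado, it contains a critical pair and thus, by the two deterministic
  theorems, a configuration of negative weight. The paths are loose or consist of stars according to
  whether the lengths agree.
\<close>
lemma prob_rado_le: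
  assumes A: "linear_equation a A" and B: "linear_equation b B" and ab: "3 \<le> a" "a \<le> b"
    and n: "1 \<le> n" and p: "0 \<le> p" "p \<le> 1" "p \<le> c * real n powr (beta a b - 1)"
    and K: "K = b ^ b" and c: "0 \<le> c" "c \<le> 1" "4 * a * b * K ^ b * c \<le> 1"
  shows "measure_pmf.prob (random_subset n p) {S. rado A B S}
    \<le> total_mass b K (3 * b) (a * b) (real (2 * K)) * real n powr (- (1 / (real a * (real b - 1))))"
proof -
  let ?V = "{1..int n}"
  let ?HA = "solution_sets A ?V" and ?HB = "solution_sets B ?V"
  have "a ^ a \<le> b ^ a" using ab by (intro power_mono) auto
  also have "b ^ a \<le> b ^ b" using ab by (intro power_increasing) auto
  finally have "a ^ a \<le> K" unfolding K .
  then have sp: "sparse n K a ?HA" "sparse n K b ?HB" using sparse_solution_sets[OF A] sparse_solution_sets[OF B] ab K by auto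
  have K1: "1 \<le> K" unfolding K using ab by simp
  have Pow: "\<Union>(?HA \<union> ?HB) \<subseteq> ?V" unfolding solution_sets_def eq_solution_def distinct_solution_def by blast
  have cards: "e \<in> ?HA \<Longrightarrow> card e = a" "f \<in> ?HB \<Longrightarrow> card f = b" for e f
    using sparseD(3)[OF sp(1)] sparseD(3)[OF sp(2)] by auto
  have pn: "p \<le> real n powr (beta a b - 1)"
    using p(3) c by (meson mult_left_le_one_le order_trans powr_ge_zero)
  \<comment> \<open>The point sets of paths with \<open>j\<close> steps.\<close>
  define Pstate where "Pstate j = (if a = b then (\<lambda>es. \<Union>(set es)) ` {es. loose (?HA \<union> ?HB) es \<and> length es = Suc j}
      else {W. \<exists>e. star_path ?HA ?HB j W e})" for j
  have c2: "a * b * K ^ b * c \<le> 1 / 2" using c(1,3) by simp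
  have mass: "(\<Sum>Q\<in>Pstate j. p ^ card Q) \<le> real (2 * K) * real n powr alpha b / 2 ^ j"
    and size: "Q \<in> Pstate j \<Longrightarrow> finite Q \<and> card Q \<le> (a * b) * (j + 1)" for j Q
  proof (atomize (full), cases "a = b")
    case True
    have "2 * K * b * c \<le> 2 * (a * b * K ^ b) * c"
    proof (intro mult_right_mono c of_nat_mono)
      have "K * b \<le> K ^ b * (a * b)" using K1 ab by (intro mult_mono self_le_power) auto
      then show "2 * K * b \<le> 2 * (a * b * K ^ b)" by (simp add: mult_ac)
    qed
    then have c3: "2 * K * b * c \<le> 1 / 2" using c(3) by simp
    note L = loose_mass[OF sp[unfolded True], of p c]
    show "(\<Sum>Q\<in>Pstate j. p ^ card Q) \<le> real (2 * K) * real n powr alpha b / 2 ^ j \<and>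
      (Q \<in> Pstate j \<longrightarrow> finite Q \<and> card Q \<le> (a * b) * (j + 1))"
    proof (intro conjI impI)
      show "(\<Sum>Q\<in>Pstate j. p ^ card Q) \<le> real (2 * K) * real n powr alpha b / 2 ^ j"
        unfolding Pstate_def using L(1) ab n p c c3 True by simp
      assume "Q \<in> Pstate j"
      then have q: "finite Q \<and> card Q \<le> b * (j + 1)"
        unfolding Pstate_def using L(2)[of Q j] ab n p c c3 True by simp
      have "b * (j + 1) \<le> (a * b) * (j + 1)" using ab by (intro mult_right_mono) auto
      then show "finite Q" "card Q \<le> (a * b) * (j + 1)" using q by linarith+
    qed
  next
    case False
    note L = star_mass[OF sp ab n p(1,3) c(1,2) c2]
    have "(\<Sum>Q\<in>Pstate j. p ^ card Q) \<le> real K * real n powr alpha b / 2 ^ j"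
      unfolding Pstate_def using L(1) False by simp
    also have "\<dots> \<le> real (2 * K) * real n powr alpha b / 2 ^ j" by (intro divide_right_mono mult_right_mono) auto
    finally show "(\<Sum>Q\<in>Pstate j. p ^ card Q) \<le> real (2 * K) * real n powr alpha b / 2 ^ j \<and>
      (Q \<in> Pstate j \<longrightarrow> finite Q \<and> card Q \<le> (a * b) * (j + 1))"
      using L(2)[of Q j] False unfolding Pstate_def by auto
  qed
  have "Q \<subseteq> ?V" if mem: "Q \<in> Pstate j" for Q j
  proof (cases "a = b")
    case True
    then obtain es where "loose (?HA \<union> ?HB) es" "Q = \<Union>(set es)" using mem True unfolding Pstate_def by auto
    then have "Q \<subseteq> \<Union>(?HA \<union> ?HB)" by (simp only: Union_mono[OF loose_edges])
    then show ?thesis using Pow by (rule order_trans)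
  next
    case False
    then obtain e where "star_path ?HA ?HB j Q e" using mem False unfolding Pstate_def by auto
    then have "Q \<subseteq> \<Union>?HA" using star_path_sub by blast
    then show ?thesis using Pow by blast
  qed
  then have "(\<Union>j. Pstate j) \<subseteq> Pow ?V" by blast
  then have finP: "finite (\<Union>j. Pstate j)" by (rule finite_subset) simp
  define Bad where "Bad = {X. \<exists>w<0. reaches (?HA \<union> ?HB) (\<lambda>Q. \<exists>j. Q \<in> Pstate j) a b (3 * b) X w}"
  note sb = mass_of_bad[where St = Pstate and C = "a * b" and D = "real (2 * K)" and S = "3 * b",
      OF sp ab p(1) pn n finP size _ mass, folded Bad_def]
  have wit: "\<exists>X\<in>Bad. X \<subseteq> S" if S: "S \<subseteq> ?V" and r: "S \<in> {S. rado A B S}" for S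
  proof -
    obtain EA EB where E: "critical EA EB" "finite EA" "finite EB" "EA \<subseteq> ?HA" "EB \<subseteq> ?HB" "\<Union>(EA \<union> EB) \<subseteq> S"
      using critical_solutions[OF A B _ _ S] r ab by auto
    have cE: "e \<in> EA \<Longrightarrow> card e = a" "f \<in> EB \<Longrightarrow> card f = b" for e f using E(4,5) cards by blast+
    show ?thesis
    proof (cases "a = b")
      case True
      obtain X w where X: "reaches (EA \<union> EB) (\<lambda>Q. \<exists>es. loose (EA \<union> EB) es \<and> Q = \<Union>(set es)) a b 3 X w" "w < 0"
        using symmetric_case[OF E(1-3), of b] cE ab True by auto
      have "X \<subseteq> \<Union>(EA \<union> EB)" by (rule reaches_sub[OF X(1)]) (use loose_edges in blast)
      moreover have "reaches (?HA \<union> ?HB) (\<lambda>Q. \<exists>j. Q \<in> Pstate j) a b (3 * b) X w"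
      proof (rule reaches_mono[OF X(1)])
        fix Q assume "\<exists>es. loose (EA \<union> EB) es \<and> Q = \<Union>(set es)"
        then obtain es where es: "loose (EA \<union> EB) es" "Q = \<Union>(set es)" by blast
        then have "loose (?HA \<union> ?HB) es" using loose_mono E(4,5) by (metis Un_mono)
        moreover obtain j where "length es = Suc j" using es(1) by (cases es) auto
        ultimately show "\<exists>j. Q \<in> Pstate j" unfolding Pstate_def using True es(2) by auto
      qed (use E(4,5) ab in auto)
      ultimately show ?thesis using X(2) E(6) unfolding Bad_def by blast
    next
      case False
      obtain X w where X: "reaches (EA \<union> EB) (\<lambda>Q. \<exists>j e. star_path EA EB j Q e) a b (3 * b) X w" "w < 0"
        using asymmetric_case[OF E(1-3) ab(1) _ cE] ab False by auto
      have "X \<subseteq> \<Union>(EA \<union> EB)" by (rule reaches_sub[OF X(1)]) (use star_path_sub in blast)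
      moreover have "reaches (?HA \<union> ?HB) (\<lambda>Q. \<exists>j. Q \<in> Pstate j) a b (3 * b) X w"
      proof (rule reaches_mono[OF X(1)])
        fix Q assume "\<exists>j e. star_path EA EB j Q e"
        then obtain j e where "star_path EA EB j Q e" by blast
        then have "star_path ?HA ?HB j Q e" by (rule star_path_mono[OF _ E(4,5)])
        then show "\<exists>j. Q \<in> Pstate j" unfolding Pstate_def using False by auto
      qed (use E(4,5) in auto)
      ultimately show ?thesis using X(2) E(6) unfolding Bad_def by blast
    qed
  qed
  have "measure_pmf.prob (random_subset n p) {S. rado A B S} \<le> (\<Sum>X\<in>Bad. p ^ card X)"
    by (rule prob_le_sum[OF p(1,2) sb(1) wit]) auto
  also have "\<dots> \<le> total_mass b K (3 * b) (a * b) (real (2 * K)) * real n powr (- (1 / (real a * (real b - 1))))"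
    by (rule sb(2)) auto
  finally show ?thesis .
qed

theorem theorem1p5:
  fixes kA kB :: nat
  assumes "3 \<le> kA" and "kA \<le> kB"
  shows "\<exists>c::real. c > 0 \<and>
    (\<forall>A B p.
       linear_equation kA A \<longrightarrow> linear_equation kB B \<longrightarrow>
       irredundant (underlying_matrix A) \<longrightarrow> irredundant (underlying_matrix B) \<longrightarrow>
       (\<forall>n::nat. n \<ge> 1 \<longrightarrow> 0 \<le> p n \<and> p n \<le> 1 \<and>
          p n \<le> c * real n powr
            (- ((real kA * real kB - real kA - real kB) / (real kA * real kB - real kA)))) \<longrightarrow>
       (\<lambda>n. measure_pmf.prob (random_subset n (p n)) {S. rado A B S}) \<longlonglongrightarrow> 0)"
proof -
  define K where "K = kB ^ kB"
  \<comment> \<open>Large enough for both kinds of paths.\<close>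
  define N where "N = 4 * kA * kB * K ^ kB"
  define \<delta> where "\<delta> = 1 / (real kA * (real kB - 1))"
  have N: "1 \<le> N" unfolding N_def K_def using assms by (simp add: Suc_le_eq)
  have \<delta>: "0 < \<delta>" unfolding \<delta>_def using assms by simp
  have expo: "- ((real kA * real kB - real kA - real kB) / (real kA * real kB - real kA)) = beta kA kB - 1"
  proof -
    have "real kA * real kB - real kA = real kA * (real kB - 1)" by (simp add: algebra_simps)
    moreover have "real kA * (real kB - 1) \<noteq> 0" using assms by simp
    ultimately show ?thesis unfolding beta_def by (simp add: divide_simps)
  qed
  show ?thesis
  proof (intro exI[of _ "1 / real N"] conjI allI impI)
    show "0 < 1 / real N" using N by simp
    fix A B p
    assume A: "linear_equation kA A" and B: "linear_equation kB B"
      and p: "\<forall>n::nat. n \<ge> 1 \<longrightarrow> 0 \<le> p n \<and> p n \<le> 1 \<and>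
          p n \<le> 1 / real N * real n powr
            (- ((real kA * real kB - real kA - real kB) / (real kA * real kB - real kA)))"
    define M where "M = total_mass kB K (3 * kB) (kA * kB) (real (2 * K))"
    have le: "measure_pmf.prob (random_subset n (p n)) {S. rado A B S} \<le> M * real n powr (- \<delta>)" if "1 \<le> n" for n
      unfolding M_def \<delta>_def
    proof (rule prob_rado_le[OF A B assms that, where c = "1 / real N"])
      show "0 \<le> p n" "p n \<le> 1" "p n \<le> 1 / real N * real n powr (beta kA kB - 1)"
        using p that unfolding expo by blast+
      show "K = kB ^ kB" by (rule K_def)
      show "0 \<le> 1 / real N" "1 / real N \<le> 1" using N by simp_all
      show "real (4 * kA * kB * K ^ kB) * (1 / real N) \<le> 1" unfolding N_def[symmetric] using N by simp
    qed
    have "- \<delta> < 0" using \<delta> by simp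
    then have "(\<lambda>n. real n powr (- \<delta>)) \<longlonglongrightarrow> 0"
      by (rule tendsto_neg_powr[OF _ filterlim_real_sequentially])
    then have lim: "(\<lambda>n. M * real n powr (- \<delta>)) \<longlonglongrightarrow> 0" by (rule tendsto_mult_right_zero)
    show "(\<lambda>n. measure_pmf.prob (random_subset n (p n)) {S. rado A B S}) \<longlonglongrightarrow> 0"
    proof (rule tendsto_sandwich[OF _ _ tendsto_const lim])
      show "\<forall>\<^sub>F n in sequentially. 0 \<le> measure_pmf.prob (random_subset n (p n)) {S. rado A B S}" by simp
      show "\<forall>\<^sub>F n in sequentially. measure_pmf.prob (random_subset n (p n)) {S. rado A B S} \<le> M * real n powr (- \<delta>)"
        using le by (auto simp: eventually_sequentially)
    qed
  qed
qed

end
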